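(* Let $k,c>0$ and let $f,g\in\mathcal{D}'(\mathbb{R})$. The distribution $u$ given, for $t\in\mathbb{R}$ and $\varphi\in\mathcal{C}_0^\infty(\mathbb{R})$, by $$\langle u(t),\varphi\rangle:=e^{-\frac{k}{2}t}\left\{\left\langle f,\left(\psi_t(t)+\tfrac{k}{2}\psi(t)\right)\ast\varphi\right\rangle+\left\langle g,\psi(t)\ast\varphi\right\rangle\right\}=e^{-\frac{k}{2}t}\left\{\left\langle f,\psi_t(t)\ast\varphi\right\rangle+\left\langle \tfrac{k}{2}f+g,\psi(t)\ast\varphi\right\rangle\right\}$$ is the unique solution in $\mathcal{C}^1(\mathbb{R},\mathcal{D}'(\mathbb{R}))$, in the sense of distributions, of the problem $$u_{tt}+ku_t=c^2u_{xx},\qquad u(0)=f,\qquad u_t(0)=g.$$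
   Context: Let $\alpha=\frac{k}{4c}$ and $$\psi(x,t)=\operatorname{sgn}(t)\,\frac{1}{2c}\,I_0\!\left(2\alpha\sqrt{c^2t^2-x^2}\right)\mathcal{X}_{[-c|t|,c|t|]}(x),$$ $$\psi_t(\cdot,t)=\frac12\left[\delta(\cdot-ct)+\delta(\cdot+ct)\right]+\alpha c|t|\,\frac{I_0'\!\left(2\alpha\sqrt{c^2t^2-\cdot^2}\right)}{\sqrt{c^2t^2-\cdot^2}}\,\mathcal{X}_{[-c|t|,c|t|]}(\cdot),$$ where $I_0$ is the modified Bessel function of the first kind of order $0$, $\mathcal{X}_\Omega$ is the characteristic function of $\Omega$, $\delta(\cdot-a)$ is the Dirac delta at $x=a$, $\psi(\cdot,0)=0$, and $I_0'(2\alpha z)/z$ is understood by its limit $\alpha$ at $z=0$. We write $\psi(t)=\psi(\cdot,t)$, $\psi_t(t)=\psi_t(\cdot,t)$; both are compactly supported distributions in $x$, and $\ast$ is convolution in $x$, so $\psi(t)\ast\varphi,\psi_t(t)\ast\varphi\in\mathcal{C}_0^\infty(\mathbb{R})$. $\mathcal{C}^1(\mathbb{R},\mathcal{D}'(\mathbb{R}))$ is the space of maps $t\mapsto u(t)\in\mathcal{D}'(\mathbb{R})$ for which there is a map $t\mapsto u_t(t)\in\mathcal{D}'(\mathbb{R})$ such that, for every $\varphi\in\mathcal{C}_0^\infty(\mathbb{R})$ and $t\in\mathbb{R}$, $\left\langle \frac{u(t+h)-u(t)}{h},\varphi\right\rangle\to\langle u_t(t),\varphi\rangle$ and $\langle u_t(t+h),\varphi\rangle\to\langle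 u_t(t),\varphi\rangle$ as $h\to0$. A $u\in\mathcal{C}^1(\mathbb{R},\mathcal{D}'(\mathbb{R}))$ solves the equation in the sense of distributions if it holds in $\mathcal{D}'(\mathbb{R}\times\mathbb{R})$, i.e. $\int_{\mathbb{R}}\left\langle u(t),\left(\phi_{tt}-k\phi_t-c^2\phi_{xx}\right)(\cdot,t)\right\rangle dt=0$ for all $\phi\in\mathcal{C}_0^\infty(\mathbb{R}^2)$. The initial conditions are equalities in $\mathcal{D}'(\mathbb{R})$ at $t=0$. *)

theory Defs
  imports "HOL-Analysis.Analysis"
begin

text \<open>
  Scalars range over a type of sort \<open>{real_normed_field, euclidean_space}\<close>; the instances are
  \<^typ>\<open>real\<close> and \<^typ>\<open>complex\<close>, so real- and complex-valued test functions and
  distributions are treated simultaneously.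
\<close>

definition partial :: "'n::euclidean_space \<Rightarrow> ('n \<Rightarrow> 'a::real_normed_vector) \<Rightarrow> 'n \<Rightarrow> 'a" where
  "partial b \<phi> = (\<lambda>x. frechet_derivative \<phi> (at x) b)"

definition partials :: "'n::euclidean_space list \<Rightarrow> ('n \<Rightarrow> 'a::real_normed_vector) \<Rightarrow> 'n \<Rightarrow> 'a" where
  "partials bs \<phi> = foldr partial bs \<phi>"

text \<open>
  Being \<open>C\<^sup>\<infinity>\<close>: every iterated partial derivative, of any order and in any order of the
  coordinate directions, is (totally) differentiable, hence also continuous.
\<close>

definition smooth :: "('n::euclidean_space \<Rightarrow> 'a::real_normed_vector) \<Rightarrow> bool" where
  "smooth \<phi> \<longleftrightarrow> (\<forall>bs. set bs \<subseteq> Basis \<longrightarrow> (\<forall>x. partials bs \<phi> differentiable (at x)))"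

definition supp :: "('n::euclidean_space \<Rightarrow> 'a::real_normed_vector) \<Rightarrow> 'n set" where
  "supp \<phi> = closure {x. \<phi> x \<noteq> 0}"

definition test_function :: "('n::euclidean_space \<Rightarrow> 'a::real_normed_vector) \<Rightarrow> bool" where
  "test_function \<phi> \<longleftrightarrow> smooth \<phi> \<and> compact (supp \<phi>)"

definition test_converges ::
    "(nat \<Rightarrow> 'n::euclidean_space \<Rightarrow> 'a::real_normed_vector) \<Rightarrow> ('n \<Rightarrow> 'a) \<Rightarrow> bool" where
  "test_converges \<Phi> \<phi> \<longleftrightarrow>
     (\<forall>n. test_function (\<Phi> n)) \<and> test_function \<phi> \<and>
     (\<exists>K. compact K \<and> (\<forall>n. supp (\<Phi> n) \<subseteq> K)) \<and>
     (\<forall>bs. set bs \<subseteq> Basis \<longrightarrow>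
        uniform_limit UNIV (\<lambda>n. partials bs (\<Phi> n)) (partials bs \<phi>) sequentially)"

text \<open>
  A distribution is a functional on arbitrary functions of which only the values on test functions
  are meaningful. Accordingly, equality of distributions is \<open>dist_eq\<close>, not HOL equality.
\<close>

definition distribution ::
    "(('n::euclidean_space \<Rightarrow> 'a::{real_normed_field, euclidean_space}) \<Rightarrow> 'a) \<Rightarrow> bool" where
  "distribution T \<longleftrightarrow>
     (\<forall>\<phi> \<eta> a b. test_function \<phi> \<longrightarrow> test_function \<eta> \<longrightarrow>
        T (\<lambda>x. a * \<phi> x + b * \<eta> x) = a * T \<phi> + b * T \<eta>) \<and>
     (\<forall>\<Phi> \<phi>. test_converges \<Phi> \<phi> \<longrightarrow> (\<lambda>n. T (\<Phi> n)) \<longlonglongrightarrow> T \<phi>)"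

definition dist_eq ::
    "(('n::euclidean_space \<Rightarrow> 'a::real_normed_vector) \<Rightarrow> 'a) \<Rightarrow> (('n \<Rightarrow> 'a) \<Rightarrow> 'a) \<Rightarrow> bool" where
  "dist_eq S T \<longleftrightarrow> (\<forall>\<phi>. test_function \<phi> \<longrightarrow> S \<phi> = T \<phi>)"

definition dist_conv :: "((real \<Rightarrow> 'a) \<Rightarrow> 'a) \<Rightarrow> (real \<Rightarrow> 'a) \<Rightarrow> real \<Rightarrow> 'a" where
  "dist_conv T \<phi> = (\<lambda>x. T (\<lambda>y. \<phi> (x - y)))"

definition regular_dist ::
    "(real \<Rightarrow> real) \<Rightarrow> (real \<Rightarrow> 'a::{banach, second_countable_topology}) \<Rightarrow> 'a" where
  "regular_dist h \<phi> = (LINT x|lborel. h x *\<^sub>R \<phi> x)"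

definition dirac :: "real \<Rightarrow> (real \<Rightarrow> 'a) \<Rightarrow> 'a" where
  "dirac a \<phi> = \<phi> a"

text \<open>The modified Bessel function of the first kind of order 0.\<close>

definition bessel_I0 :: "real \<Rightarrow> real" where
  "bessel_I0 z = (\<Sum>m. (z / 2) ^ (2 * m) / (fact m)\<^sup>2)"

definition bessel_quot :: "real \<Rightarrow> real \<Rightarrow> real" where
  "bessel_quot \<alpha> z = (if z = 0 then \<alpha> else deriv bessel_I0 (2 * \<alpha> * z) / z)"

text \<open>
  Outside \<open>\<bar>x\<bar> \<le> c * \<bar>t\<bar>\<close>, where the radicand is negative, the indicator makes the value of
  \<^const>\<open>sqrt\<close> irrelevant.
\<close>

definition psi_kernel :: "real \<Rightarrow> real \<Rightarrow> real \<Rightarrow> real \<Rightarrow> real" where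
  "psi_kernel k c t x =
     (let \<alpha> = k / (4 * c) in
      sgn t * (1 / (2 * c)) * bessel_I0 (2 * \<alpha> * sqrt (c\<^sup>2 * t\<^sup>2 - x\<^sup>2))
        * indicator {- c * \<bar>t\<bar>..c * \<bar>t\<bar>} x)"

definition psi_t_kernel :: "real \<Rightarrow> real \<Rightarrow> real \<Rightarrow> real \<Rightarrow> real" where
  "psi_t_kernel k c t x =
     (let \<alpha> = k / (4 * c) in
      \<alpha> * c * \<bar>t\<bar> * bessel_quot \<alpha> (sqrt (c\<^sup>2 * t\<^sup>2 - x\<^sup>2))
        * indicator {- c * \<bar>t\<bar>..c * \<bar>t\<bar>} x)"

definition psi ::
    "real \<Rightarrow> real \<Rightarrow> real \<Rightarrow> (real \<Rightarrow> 'a::{banach, second_countable_topology}) \<Rightarrow> 'a" where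
  "psi k c t = regular_dist (psi_kernel k c t)"

definition psi_t ::
    "real \<Rightarrow> real \<Rightarrow> real \<Rightarrow> (real \<Rightarrow> 'a::{banach, second_countable_topology}) \<Rightarrow> 'a" where
  "psi_t k c t = (\<lambda>\<phi>. (1 / 2) *\<^sub>R (dirac (c * t) \<phi> + dirac (- c * t) \<phi>)
                       + regular_dist (psi_t_kernel k c t) \<phi>)"

text \<open>\<open>C1_dist u v\<close>: the map \<open>u\<close> is in \<open>C\<^sup>1(\<real>, D'(\<real>))\<close>, with time derivative \<open>v\<close>.\<close>

definition C1_dist ::
    "(real \<Rightarrow> (real \<Rightarrow> 'a::{real_normed_field, euclidean_space}) \<Rightarrow> 'a) \<Rightarrow>
     (real \<Rightarrow> (real \<Rightarrow> 'a) \<Rightarrow> 'a) \<Rightarrow> bool" where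
  "C1_dist u v \<longleftrightarrow>
     (\<forall>t. distribution (u t)) \<and> (\<forall>t. distribution (v t)) \<and>
     (\<forall>\<phi> t. test_function \<phi> \<longrightarrow>
        ((\<lambda>h. (u (t + h) \<phi> - u t \<phi>) /\<^sub>R h) \<longlongrightarrow> v t \<phi>) (at 0) \<and>
        ((\<lambda>h. v (t + h) \<phi>) \<longlongrightarrow> v t \<phi>) (at 0))"

text \<open>
  Points of the plane are pairs \<open>(x, t)\<close>. With \<^const>\<open>has_bochner_integral\<close>, the integral is
  required to exist and not only to have the value 0, which \<^const>\<open>lebesgue_integral\<close> also takes
  on non-integrable functions.
\<close>

definition weak_damped_wave ::
    "real \<Rightarrow> real \<Rightarrow> (real \<Rightarrow> (real \<Rightarrow> 'a::{real_normed_field, euclidean_space}) \<Rightarrow> 'a) \<Rightarrow> bool" where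
  "weak_damped_wave k c u \<longleftrightarrow>
     (\<forall>\<phi> :: real \<times> real \<Rightarrow> 'a. test_function \<phi> \<longrightarrow>
        has_bochner_integral lborel
          (\<lambda>t. u t (\<lambda>x. partial (0, 1) (partial (0, 1) \<phi>) (x, t)
                        - k *\<^sub>R partial (0, 1) \<phi> (x, t)
                        - c\<^sup>2 *\<^sub>R partial (1, 0) (partial (1, 0) \<phi>) (x, t))) 0)"

definition solves_damped_wave ::
    "real \<Rightarrow> real \<Rightarrow> ((real \<Rightarrow> 'a) \<Rightarrow> 'a) \<Rightarrow> ((real \<Rightarrow> 'a) \<Rightarrow> 'a) \<Rightarrow>
     (real \<Rightarrow> (real \<Rightarrow> 'a::{real_normed_field, euclidean_space}) \<Rightarrow> 'a) \<Rightarrow> bool" where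
  "solves_damped_wave k c f g u \<longleftrightarrow>
     (\<exists>u\<^sub>t. C1_dist u u\<^sub>t \<and> weak_damped_wave k c u \<and> dist_eq (u 0) f \<and> dist_eq (u\<^sub>t 0) g)"

end

theory Submission imports Defs begin

text \<open>
  Substituting \<open>y = c t s\<close>, convolution with \<open>\<psi>(t)\<close> and \<open>\<psi>\<^sub>t(t)\<close> becomes integration over the fixed
  interval \<open>[-1, 1]\<close> against kernels that are smooth in \<open>t\<close>, because \<open>I\<^sub>0(z) = E(z\<^sup>2/4)\<close> with the entire
  function \<open>E(r) = \<Sum> r\<^sup>n / (n!)\<^sup>2\<close>. Integrating by parts in \<open>s\<close> and using \<open>E' + r E'' = E\<close> one finds that
  \<open>\<psi>(t) * \<phi>\<close> has the time derivative \<open>\<psi>\<^sub>t(t) * \<phi>\<close>, whose own derivative is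
  \<open>c\<^sup>2 \<psi>(t) * \<phi>'' + (k\<^sup>2/4) \<psi>(t) * \<phi>\<close>, all in the topology of test functions; this gives existence.

  For uniqueness, tensor products \<open>\<xi>(t) \<phi>(x)\<close> as test functions and the lemma of du Bois-Reymond show that
  \<open>u\<^sub>t\<close> is itself differentiable in time, so that the equation holds pointwise in \<open>t\<close>. The solution
  paired with the backward solution \<open>\<psi>(T - t) * \<phi>\<close> of the adjoint equation is then a conserved
  quantity, which expresses \<open>u(T)\<close> through the initial data. Differentiating such a pairing of two
  moving objects rests on the Banach-Steinhaus theorem for distributions.
\<close>

section \<open>Test functions of one variable\<close>

text \<open>The damping enters only through the substitution u = exp(-kt/2) w, which turns the
  equation into w_tt = c^2 w_xx + (k^2/4) w. This is the origin of the exponential in front, of the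
  combination (k/2) f + g and of the constant k^2/4; psi is the fundamental solution of that
  equation with value 0 and velocity delta at t = 0. Rescaling to a fixed interval removes sgn(t),
  |t|, the jump of the indicator and the square root at the light cone, so that the calculus needs
  no separate treatment of t = 0 or of the sign of t.

  The obstacle in the uniqueness half is that membership in C^1(R, D') gives convergence for one
  fixed test function at a time, whereas the conserved quantity pairs u(t) with a test function that
  itself moves with t. The uniformity has to come from the functionals alone. Since continuity of a
  distribution is expressed by sequences, the uniform boundedness argument is carried out directly
  on sequences of test functions.\<close>

definition nderiv :: "nat \<Rightarrow> (real \<Rightarrow> 'a::real_normed_vector) \<Rightarrow> real \<Rightarrow> 'a" where
  "nderiv j = partial 1 ^^ j"

lemma nderiv_0 [simp]: "nderiv 0 \<phi> = \<phi>"
  by (simp add: nderiv_def)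

lemma nderiv_Suc: "nderiv (Suc j) \<phi> = partial 1 (nderiv j \<phi>)"
  by (simp add: nderiv_def)

lemma nderiv_partial: "nderiv j (partial 1 \<phi>) = nderiv (Suc j) \<phi>"
  by (simp add: nderiv_def funpow_swap1)

lemma nderiv_nderiv: "nderiv i (nderiv j \<phi>) = nderiv (i + j) \<phi>"
  by (simp add: nderiv_def funpow_add)

text \<open>\<open>Basis\<close> on the real line is \<open>{1}\<close>, so only the length of the
  list of directions matters. All work in one variable is therefore done with
  \<open>nderiv\<close>.\<close>

lemma partials_real_eq_nderiv:
  fixes bs :: "real list"
  assumes "set bs \<subseteq> Basis"
  shows "partials bs \<phi> = nderiv (length bs) \<phi>"
  using assms by (induction bs) (auto simp: partials_def nderiv_def)

lemma smooth_real_iff: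
  "smooth (\<phi> :: real \<Rightarrow> 'a::real_normed_vector) \<longleftrightarrow> (\<forall>j x. nderiv j \<phi> differentiable (at x))"
  (is "?l \<longleftrightarrow> ?r")
proof
  assume l: ?l
  show ?r
  proof (intro allI)
    fix j x
    have "set (replicate j (1::real)) \<subseteq> Basis" by auto
    then show "nderiv j \<phi> differentiable (at x)"
      using l partials_real_eq_nderiv[of "replicate j 1" \<phi>] by (auto simp: smooth_def)
  qed
qed (auto simp: smooth_def partials_real_eq_nderiv)

lemma has_vector_derivative_partial:
  fixes \<phi> :: "real \<Rightarrow> 'a::real_normed_vector"
  assumes "\<phi> differentiable (at x)"
  shows "(\<phi> has_vector_derivative partial 1 \<phi> x) (at x)"
proof -
  have d: "(\<phi> has_derivative frechet_derivative \<phi> (at x)) (at x)"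
    using assms frechet_derivative_works by blast
  then have "linear (frechet_derivative \<phi> (at x))"
    by (rule has_derivative_linear)
  then have "frechet_derivative \<phi> (at x) h = h *\<^sub>R partial 1 \<phi> x" for h
    using linear_scale[of "frechet_derivative \<phi> (at x)" h 1] by (simp add: partial_def)
  then have "frechet_derivative \<phi> (at x) = (\<lambda>h. h *\<^sub>R partial 1 \<phi> x)" by (rule ext)
  with d show ?thesis
    by (simp add: has_vector_derivative_def)
qed

lemma partial_eqI:
  fixes \<phi> :: "real \<Rightarrow> 'a::real_normed_vector"
  assumes "\<And>x. (\<phi> has_vector_derivative \<psi> x) (at x)"
  shows "partial 1 \<phi> = \<psi>"
proof
  fix x
  have "(\<lambda>h. h *\<^sub>R \<psi> x) = frechet_derivative \<phi> (at x)"
    using assms[of x] by (auto simp: has_vector_derivative_def intro: frechet_derivative_at)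
  then show "partial 1 \<phi> x = \<psi> x"
    by (metis partial_def scaleR_one)
qed

text \<open>The standard way below to prove smoothness: guess all derivatives as a sequence in which
  each entry is the derivative of the one before. The derivatives of \<open>g 0\<close> are computed
  at the same time.\<close>

lemma nderiv_sequenceI:
  fixes g :: "nat \<Rightarrow> real \<Rightarrow> 'a::real_normed_vector"
  assumes "\<And>j x. (g j has_vector_derivative g (Suc j) x) (at x)"
  shows "nderiv j (g 0) = g j" and "smooth (g 0)"
proof -
  show *: "nderiv j (g 0) = g j" for j
    by (induction j) (simp_all add: nderiv_Suc partial_eqI[OF assms])
  show "smooth (g 0)"
    unfolding smooth_real_iff * using assms differentiableI_vector by blast
qed

lemma smooth_nderiv_has_vector_derivative:
  assumes "smooth (\<phi> :: real \<Rightarrow> 'a::real_normed_vector)"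
  shows "(nderiv j \<phi> has_vector_derivative nderiv (Suc j) \<phi> x) (at x)"
  using assms has_vector_derivative_partial by (auto simp: smooth_real_iff nderiv_Suc)

lemma smooth_nderiv: "smooth (\<phi> :: real \<Rightarrow> 'a::real_normed_vector) \<Longrightarrow> smooth (nderiv j \<phi>)"
  by (auto simp: smooth_real_iff nderiv_nderiv)

lemma supp_subsetI: "closed K \<Longrightarrow> (\<And>x. x \<notin> K \<Longrightarrow> \<phi> x = 0) \<Longrightarrow> supp \<phi> \<subseteq> K"
  unfolding supp_def by (rule closure_minimal) auto

lemma notin_supp: "x \<notin> supp \<phi> \<Longrightarrow> \<phi> x = 0"
  using closure_subset[of "{x. \<phi> x \<noteq> 0}"] unfolding supp_def by blast

lemma test_functionI:
  assumes "smooth \<phi>" "compact K" "\<And>x. x \<notin> K \<Longrightarrow> \<phi> x = 0"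
  shows "test_function \<phi>"
proof -
  have "supp \<phi> \<subseteq> K" using assms by (intro supp_subsetI compact_imp_closed)
  moreover have "closed (supp \<phi>)" by (simp add: supp_def)
  ultimately show ?thesis
    using assms compact_Int_closed[of K "supp \<phi>"] by (simp add: test_function_def Int_absorb1)
qed

lemma test_function_bounded_support:
  assumes "test_function (\<phi> :: real \<Rightarrow> 'a::real_normed_vector)"
  obtains R where "R > 0" "\<And>x. \<bar>x\<bar> > R \<Longrightarrow> \<phi> x = 0"
proof -
  have "bounded (supp \<phi>)" using assms compact_imp_bounded by (auto simp: test_function_def)
  then obtain R where "R > 0" "\<And>x. x \<in> supp \<phi> \<Longrightarrow> norm x \<le> R"
    using bounded_pos by metis
  then show ?thesis using that notin_supp by (metis linorder_not_le real_norm_def)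
qed

text \<open>Since the complement of the support is open, \<open>\<phi>\<close> vanishes in a
  neighbourhood of \<open>x\<close> and has derivative 0 there.\<close>

lemma partial_supp_zero:
  fixes \<phi> :: "'n::euclidean_space \<Rightarrow> 'a::real_normed_vector"
  assumes "x \<notin> supp \<phi>"
  shows "partial b \<phi> x = 0"
proof -
  have "(\<phi> has_derivative (\<lambda>h. 0)) (at x)"
  proof (rule has_derivative_transform_within_open)
    show "((\<lambda>x. 0) has_derivative (\<lambda>h. 0)) (at x)" by simp
    show "open (- supp \<phi>)" by (simp add: supp_def open_Compl)
  qed (use assms notin_supp in auto)
  then have "(\<lambda>h. 0) = frechet_derivative \<phi> (at x)" by (rule frechet_derivative_at)
  then show ?thesis by (metis partial_def)
qed

lemma test_function_partial:
  assumes "test_function \<phi>" "b \<in> Basis"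
  shows "test_function (partial b \<phi>)"
proof (rule test_functionI)
  show "smooth (partial b \<phi>)"
    unfolding smooth_def
  proof (intro allI impI)
    fix bs :: "'a list" and x assume "set bs \<subseteq> Basis"
    then have "partials (bs @ [b]) \<phi> differentiable (at x)"
      using assms by (auto simp: test_function_def smooth_def)
    then show "partials bs (partial b \<phi>) differentiable (at x)" by (simp add: partials_def)
  qed
  show "compact (supp \<phi>)" using assms by (simp add: test_function_def)
qed (rule partial_supp_zero)

lemma test_function_nderiv:
  "test_function (\<phi> :: real \<Rightarrow> 'a::real_normed_vector) \<Longrightarrow> test_function (nderiv j \<phi>)"
  by (induction j) (auto simp: nderiv_Suc intro: test_function_partial)

lemma test_function_has_vector_derivative:
  assumes "test_function (\<phi> :: real \<Rightarrow> 'a::real_normed_vector)"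
  shows "(\<phi> has_vector_derivative partial 1 \<phi> x) (at x)"
  using smooth_nderiv_has_vector_derivative[of \<phi> 0] assms by (simp add: test_function_def nderiv_Suc)

lemma test_function_differentiable: "test_function \<phi> \<Longrightarrow> \<phi> differentiable (at x)"
  unfolding test_function_def smooth_def
  by (metis (no_types, lifting) empty_subsetI foldr_Nil id_apply list.set(1) partials_def)

lemma test_function_continuous: "test_function \<phi> \<Longrightarrow> continuous_on A \<phi>"
  using test_function_differentiable differentiable_imp_continuous_within
  by (metis continuous_at_imp_continuous_on)

lemma test_function_bounded:
  assumes "test_function \<phi>"
  obtains C where "C \<ge> 0" "\<And>x. norm (\<phi> x) \<le> C"
proof -
  have "compact (\<phi> ` supp \<phi>)"
    using assms test_function_continuous by (auto simp: test_function_def intro: compact_continuous_image)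
  then obtain C where C: "C > 0" "\<And>x. x \<in> supp \<phi> \<Longrightarrow> norm (\<phi> x) \<le> C"
    using compact_imp_bounded bounded_pos by (metis imageI)
  then have "norm (\<phi> x) \<le> C" for x
    using notin_supp[of x \<phi>] by (cases "x \<in> supp \<phi>") auto
  with C(1) that[of C] show ?thesis by simp
qed

lemma smooth_lincomb:
  fixes \<phi> \<psi> :: "real \<Rightarrow> 'a::real_normed_field"
  assumes "smooth \<phi>" "smooth \<psi>"
  shows "nderiv j (\<lambda>x. a * \<phi> x + b * \<psi> x) = (\<lambda>x. a * nderiv j \<phi> x + b * nderiv j \<psi> x)"
    and "smooth (\<lambda>x. a * \<phi> x + b * \<psi> x)"
proof -
  have *: "((\<lambda>x. a * nderiv j \<phi> x + b * nderiv j \<psi> x) has_vector_derivative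
      a * nderiv (Suc j) \<phi> x + b * nderiv (Suc j) \<psi> x) (at x)" for j x
    by (intro derivative_intros smooth_nderiv_has_vector_derivative assms)
  show "nderiv j (\<lambda>x. a * \<phi> x + b * \<psi> x) = (\<lambda>x. a * nderiv j \<phi> x + b * nderiv j \<psi> x)"
    "smooth (\<lambda>x. a * \<phi> x + b * \<psi> x)"
    using nderiv_sequenceI[of "\<lambda>j x. a * nderiv j \<phi> x + b * nderiv j \<psi> x", OF *] by simp_all
qed

lemma test_function_lincomb:
  fixes \<phi> \<psi> :: "real \<Rightarrow> 'a::real_normed_field"
  assumes "test_function \<phi>" "test_function \<psi>"
  shows "test_function (\<lambda>x. a * \<phi> x + b * \<psi> x)"
proof (rule test_functionI)
  show "compact (supp \<phi> \<union> supp \<psi>)" using assms by (auto simp: test_function_def)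
  show "smooth (\<lambda>x. a * \<phi> x + b * \<psi> x)"
    using assms by (intro smooth_lincomb) (auto simp: test_function_def)
  show "a * \<phi> x + b * \<psi> x = 0" if "x \<notin> supp \<phi> \<union> supp \<psi>" for x
    using that by (simp add: notin_supp)
qed

lemma test_function_scaleR:
  "test_function (\<phi> :: real \<Rightarrow> 'a::real_normed_field) \<Longrightarrow> test_function (\<lambda>x. r *\<^sub>R \<phi> x)"
  using test_function_lincomb[of \<phi> \<phi> "of_real r" 0] by (simp add: scaleR_conv_of_real)

lemma test_function_add:
  "test_function (\<phi> :: real \<Rightarrow> 'a::real_normed_field) \<Longrightarrow> test_function \<psi> \<Longrightarrow>
    test_function (\<lambda>x. \<phi> x + \<psi> x)"
  using test_function_lincomb[of \<phi> \<psi> 1 1] by simp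

lemma test_function_diff:
  "test_function (\<phi> :: real \<Rightarrow> 'a::real_normed_field) \<Longrightarrow> test_function \<psi> \<Longrightarrow>
    test_function (\<lambda>x. \<phi> x - \<psi> x)"
  using test_function_lincomb[of \<phi> \<psi> 1 "-1"] by simp

lemma test_function_zero: "test_function (\<lambda>x::real. 0 :: 'a::real_normed_vector)"
  using nderiv_sequenceI(2)[of "\<lambda>_ _. 0 :: 'a"] by (auto intro!: test_functionI[of _ "{}"])

subsection \<open>Convergence of test functions\<close>

lemma test_converges_real_iff:
  "test_converges \<Phi> (\<phi> :: real \<Rightarrow> 'a::real_normed_vector) \<longleftrightarrow>
     (\<forall>n. test_function (\<Phi> n)) \<and> test_function \<phi> \<and>
     (\<exists>K. compact K \<and> (\<forall>n x. x \<notin> K \<longrightarrow> \<Phi> n x = 0)) \<and>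
     (\<forall>j. uniform_limit UNIV (\<lambda>n. nderiv j (\<Phi> n)) (nderiv j \<phi>) sequentially)"
proof -
  have "supp f \<subseteq> K \<longleftrightarrow> (\<forall>x. x \<notin> K \<longrightarrow> f x = 0)" if "compact K" for K and f :: "real \<Rightarrow> 'a"
    using supp_subsetI[of K f] notin_supp[of _ f] compact_imp_closed[OF that] by blast
  then have 1: "compact K \<Longrightarrow> (\<forall>n. supp (\<Phi> n) \<subseteq> K) \<longleftrightarrow> (\<forall>n x. x \<notin> K \<longrightarrow> \<Phi> n x = 0)" for K
    by blast
  have 2: "(\<forall>bs. set bs \<subseteq> Basis \<longrightarrow>
        uniform_limit UNIV (\<lambda>n. partials bs (\<Phi> n)) (partials bs \<phi>) sequentially) \<longleftrightarrow>
     (\<forall>j. uniform_limit UNIV (\<lambda>n. nderiv j (\<Phi> n)) (nderiv j \<phi>) sequentially)" (is "?l \<longleftrightarrow> ?r")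
  proof
    assume l: ?l
    show ?r
    proof
      fix j
      have *: "set (replicate j (1::real)) \<subseteq> Basis" by auto
      then have "partials (replicate j (1::real)) f = nderiv j f" for f :: "real \<Rightarrow> 'a"
        using partials_real_eq_nderiv[of "replicate j 1" f] by simp
      with l[rule_format, OF *] show "uniform_limit UNIV (\<lambda>n. nderiv j (\<Phi> n)) (nderiv j \<phi>) sequentially"
        by simp
    qed
  qed (simp add: partials_real_eq_nderiv)
  have 3: "(\<exists>K. compact K \<and> (\<forall>n. supp (\<Phi> n) \<subseteq> K)) \<longleftrightarrow>
      (\<exists>K. compact K \<and> (\<forall>n x. x \<notin> K \<longrightarrow> \<Phi> n x = 0))"
    by (rule ex_cong1) (use 1 in \<open>auto simp del: not_all\<close>)
  show ?thesis unfolding test_converges_def 2 3 ..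
qed

text \<open>Completeness of the space of test functions supported in \<open>K\<close>: uniform
  convergence of every derivative permits differentiation of the limit term by term, so the limits
  \<open>g j\<close> are automatically the derivatives of \<open>g 0\<close>.\<close>

lemma test_convergesI:
  fixes g :: "nat \<Rightarrow> real \<Rightarrow> 'a::banach"
  assumes test: "\<And>n. test_function (\<Phi> n)"
    and K: "compact K" "\<And>n x. x \<notin> K \<Longrightarrow> \<Phi> n x = 0"
    and lim: "\<And>j. uniform_limit UNIV (\<lambda>n. nderiv j (\<Phi> n)) (g j) sequentially"
  shows "test_converges \<Phi> (g 0)"
proof -
  have ptw: "(\<lambda>n. nderiv j (\<Phi> n) x) \<longlonglongrightarrow> g j x" for j x
    using tendsto_uniform_limitI[OF lim[of j]] by simp
  have "(g j has_vector_derivative g (Suc j) x) (at x)" for j x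
  proof -
    have "\<exists>G. \<forall>x\<in>UNIV. (\<lambda>n. nderiv j (\<Phi> n) x) \<longlonglongrightarrow> G x \<and>
        (G has_derivative (\<lambda>h. h *\<^sub>R g (Suc j) x)) (at x within UNIV)"
    proof (rule has_derivative_sequence[where f' = "\<lambda>n x h. h *\<^sub>R nderiv (Suc j) (\<Phi> n) x"])
      show "(nderiv j (\<Phi> n) has_derivative (\<lambda>h. h *\<^sub>R nderiv (Suc j) (\<Phi> n) x)) (at x within UNIV)" for n x
        using smooth_nderiv_has_vector_derivative[of "\<Phi> n" j x] test[of n]
        by (simp add: has_vector_derivative_def test_function_def)
      show "\<forall>\<^sub>F n in sequentially. \<forall>x\<in>UNIV. \<forall>h.
          norm (h *\<^sub>R nderiv (Suc j) (\<Phi> n) x - h *\<^sub>R g (Suc j) x) \<le> e * norm h" if "e > 0" for e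
        using uniform_limitD[OF lim[of "Suc j"] that]
      proof (eventually_elim, intro ballI allI)
        fix n x and h :: real
        assume "\<forall>x\<in>UNIV. dist (nderiv (Suc j) (\<Phi> n) x) (g (Suc j) x) < e"
        then have "norm (nderiv (Suc j) (\<Phi> n) x - g (Suc j) x) \<le> e"
          by (simp add: dist_norm less_imp_le)
        then show "norm (h *\<^sub>R nderiv (Suc j) (\<Phi> n) x - h *\<^sub>R g (Suc j) x) \<le> e * norm h"
          using mult_left_mono[of "norm (nderiv (Suc j) (\<Phi> n) x - g (Suc j) x)" e "\<bar>h\<bar>"]
          by (simp add: mult.commute flip: scaleR_diff_right)
      qed
      show "(\<lambda>n. nderiv j (\<Phi> n) 0) \<longlonglongrightarrow> g j 0" by (rule ptw)
    qed auto
    then obtain G where G: "\<And>x. (\<lambda>n. nderiv j (\<Phi> n) x) \<longlonglongrightarrow> G x"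
        "\<And>x. (G has_derivative (\<lambda>h. h *\<^sub>R g (Suc j) x)) (at x)"
      by auto
    \<comment> \<open>The theorem on limits of derivatives only yields some limit \<open>G\<close>;
      uniqueness of pointwise limits identifies it.\<close>
    have "G = g j" using LIMSEQ_unique[OF G(1) ptw] by (rule ext)
    with G(2) show ?thesis by (simp add: has_vector_derivative_def)
  qed
  note g = nderiv_sequenceI[of g, OF this]
  have "g 0 x = 0" if "x \<notin> K" for x
    using ptw[of 0 x] K(2)[OF that] by (simp add: LIMSEQ_const_iff)
  then have "test_function (g 0)" using g(2) K(1) by (intro test_functionI) auto
  with g(1) K lim test show ?thesis unfolding test_converges_real_iff by (auto intro!: exI[of _ K])
qed

lemma test_converges_lincomb:
  fixes \<phi> \<psi> :: "real \<Rightarrow> 'a::{real_normed_field, banach}"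
  assumes "test_converges \<Phi> \<phi>" "test_converges \<Psi> \<psi>"
  shows "test_converges (\<lambda>n x. a * \<Phi> n x + b * \<Psi> n x) (\<lambda>x. a * \<phi> x + b * \<psi> x)"
proof -
  obtain K L where KL: "compact K" "\<And>n x. x \<notin> K \<Longrightarrow> \<Phi> n x = 0"
      "compact L" "\<And>n x. x \<notin> L \<Longrightarrow> \<Psi> n x = 0"
    using assms unfolding test_converges_real_iff by meson
  have t: "test_function (\<Phi> n)" "test_function (\<Psi> n)" for n
    using assms by (simp_all add: test_converges_real_iff)
  then have s: "smooth (\<Phi> n)" "smooth (\<Psi> n)" for n by (simp_all add: test_function_def)
  show ?thesis
  proof (rule test_convergesI[where g = "\<lambda>j x. a * nderiv j \<phi> x + b * nderiv j \<psi> x" and K = "K \<union> L",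
        unfolded nderiv_0])
    show "uniform_limit UNIV (\<lambda>n. nderiv j (\<lambda>x. a * \<Phi> n x + b * \<Psi> n x))
        (\<lambda>x. a * nderiv j \<phi> x + b * nderiv j \<psi> x) sequentially" for j
      unfolding smooth_lincomb(1)[OF s]
      using assms unfolding test_converges_real_iff
      by (intro uniform_limit_intros bounded_linear_uniform_limit_intros) auto
  qed (use KL t in \<open>auto intro: test_function_lincomb\<close>)
qed

lemma test_converges_diff:
  fixes \<phi> \<psi> :: "real \<Rightarrow> 'a::{real_normed_field, banach}"
  assumes "test_converges \<Phi> \<phi>" "test_converges \<Psi> \<psi>"
  shows "test_converges (\<lambda>n x. \<Phi> n x - \<Psi> n x) (\<lambda>x. \<phi> x - \<psi> x)"
  using test_converges_lincomb[OF assms, of 1 "-1"] by simp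

lemma test_converges_const: "test_function (\<phi> :: real \<Rightarrow> 'a::real_normed_vector) \<Longrightarrow> test_converges (\<lambda>n. \<phi>) \<phi>"
  unfolding test_converges_real_iff
  by (auto simp: test_function_def uniform_limit_iff intro!: exI[of _ "supp \<phi>"] notin_supp)

section \<open>Distributions\<close>

lemma distribution_lincomb:
  "distribution T \<Longrightarrow> test_function \<phi> \<Longrightarrow> test_function \<psi> \<Longrightarrow>
    T (\<lambda>x. a * \<phi> x + b * \<psi> x) = a * T \<phi> + b * T \<psi>"
  by (simp add: distribution_def)

lemma distribution_add:
  "distribution T \<Longrightarrow> test_function \<phi> \<Longrightarrow> test_function \<psi> \<Longrightarrow> T (\<lambda>x. \<phi> x + \<psi> x) = T \<phi> + T \<psi>"
  using distribution_lincomb[of T \<phi> \<psi> 1 1] by simp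

lemma distribution_diff:
  "distribution T \<Longrightarrow> test_function \<phi> \<Longrightarrow> test_function \<psi> \<Longrightarrow> T (\<lambda>x. \<phi> x - \<psi> x) = T \<phi> - T \<psi>"
  using distribution_lincomb[of T \<phi> \<psi> 1 "-1"] by simp

lemma distribution_scaleR:
  "distribution T \<Longrightarrow> test_function \<phi> \<Longrightarrow> T (\<lambda>x. r *\<^sub>R \<phi> x) = r *\<^sub>R T \<phi>"
  using distribution_lincomb[of T \<phi> \<phi> "of_real r" 0] by (simp add: scaleR_conv_of_real)

lemma distribution_mult:
  "distribution T \<Longrightarrow> test_function \<phi> \<Longrightarrow> T (\<lambda>x. a * \<phi> x) = a * T \<phi>"
  using distribution_lincomb[of T \<phi> \<phi> a 0] by simp

lemma distribution_zero: "distribution T \<Longrightarrow> T (\<lambda>x::real. 0) = 0"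
  using distribution_mult[OF _ test_function_zero, of T 0] by simp

lemma distribution_tendsto: "distribution T \<Longrightarrow> test_converges \<Phi> \<phi> \<Longrightarrow> (\<lambda>n. T (\<Phi> n)) \<longlonglongrightarrow> T \<phi>"
  by (simp add: distribution_def)

lemma nderiv_scaleR:
  "smooth (\<phi> :: real \<Rightarrow> 'a::real_normed_field) \<Longrightarrow> nderiv j (\<lambda>x. r *\<^sub>R \<phi> x) = (\<lambda>x. r *\<^sub>R nderiv j \<phi> x)"
  using smooth_lincomb(1)[of \<phi> \<phi> j "of_real r" 0] by (simp add: scaleR_conv_of_real)

lemma nderiv_zero [simp]: "nderiv j (\<lambda>x. 0 :: 'a::real_normed_vector) = (\<lambda>x. 0)"
  using nderiv_sequenceI(1)[of "\<lambda>_ _. 0 :: 'a"] by simp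

text \<open>
  A gliding hump argument: if \<open>T n (\<eta> n)\<close> does not tend to zero, a sum of rescaled members of a
  subsequence of \<open>\<eta>\<close> is a test function on which the \<open>T n\<close> are unbounded.
\<close>

theorem banach_steinhaus_test_functions:
  fixes T :: "nat \<Rightarrow> (real \<Rightarrow> 'a::{real_normed_field, euclidean_space}) \<Rightarrow> 'a"
  assumes T: "\<And>n. distribution (T n)"
    and bdd: "\<And>\<phi>. test_function \<phi> \<Longrightarrow> \<exists>C. \<forall>n. norm (T n \<phi>) \<le> C"
    and \<eta>: "test_converges \<eta> (\<lambda>x. 0)"
  shows "(\<lambda>n. T n (\<eta> n)) \<longlonglongrightarrow> 0"
proof (rule ccontr)
  assume "\<not> (\<lambda>n. T n (\<eta> n)) \<longlonglongrightarrow> 0"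
  then obtain e where e: "e > 0" "\<And>N. \<exists>n\<ge>N. e \<le> norm (T n (\<eta> n))"
    by (auto simp: LIMSEQ_iff not_less)
  obtain B where B: "\<And>\<phi> n. test_function \<phi> \<Longrightarrow> norm (T n \<phi>) \<le> B \<phi>"
    using bdd by metis
  have B0: "B \<phi> \<ge> 0" if "test_function \<phi>" for \<phi>
    using B[OF that, of 0] norm_ge_zero order_trans by blast
  obtain K where K: "compact K" "\<And>n x. x \<notin> K \<Longrightarrow> \<eta> n x = 0"
    using \<eta> unfolding test_converges_real_iff by meson
  have \<eta>t: "test_function (\<eta> n)" for n using \<eta> by (simp add: test_converges_def)
  \<comment> \<open>A candidate hump: an index into \<open>\<eta>\<close> together with a scaling
    factor.\<close>
  define \<zeta> where "\<zeta> p = (\<lambda>x. snd p *\<^sub>R \<eta> (fst p) x)" for p :: "nat \<times> real"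
  have \<zeta>t: "test_function (\<zeta> p)" for p unfolding \<zeta>_def by (rule test_function_scaleR[OF \<eta>t])
  have \<zeta>d: "nderiv l (\<zeta> p) = (\<lambda>x. snd p *\<^sub>R nderiv l (\<eta> (fst p)) x)" for l p
    unfolding \<zeta>_def using \<eta>t by (intro nderiv_scaleR) (simp add: test_function_def)
  have T\<zeta>: "T m (\<zeta> p) = snd p *\<^sub>R T m (\<eta> (fst p))" for m p
    unfolding \<zeta>_def by (rule distribution_scaleR[OF T \<eta>t])
  \<comment> \<open>Requirements on the hump of stage \<open>i\<close>: all earlier functionals
    almost ignore it; its own functional exceeds on it, by at least \<open>i\<close>, the total that
    it assigns to the earlier humps; its derivatives up to order \<open>i\<close> are small enough
    for the sum of all humps to converge.\<close>
  define P where "P f i p \<longleftrightarrow> (\<forall>j<i. norm (T (fst (f j)) (\<zeta> p)) \<le> (1/2)^i) \<and>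
      real i + (\<Sum>j<i. norm (T (fst p) (\<zeta> (f j)))) \<le> norm (T (fst p) (\<zeta> p)) \<and>
      (\<forall>l\<le>i. \<forall>x. norm (nderiv l (\<zeta> p) x) \<le> (1/2)^i)" for f i p
  have "\<exists>f. \<forall>i. P f i (f i)"
  proof (rule dependent_wellorder_choice)
    fix r :: "nat \<times> real" and f g :: "nat \<Rightarrow> nat \<times> real" and i
    assume "\<And>j. j < i \<Longrightarrow> f j = g j"
    then show "P f i r = P g i r" by (simp add: P_def)
  next
    fix i and f :: "nat \<Rightarrow> nat \<times> real"
    \<comment> \<open>The factor is fixed before the index: the bounds \<open>B\<close> hold for all
      functionals at once, so \<open>c * e\<close> outweighs the earlier humps whichever index is
      taken later. The index then only has to be large.\<close>
    define c where "c = (real i + (\<Sum>j<i. B (\<zeta> (f j)))) / e"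
    have "(\<Sum>j<i. B (\<zeta> (f j))) \<ge> 0" by (rule sum_nonneg) (rule B0[OF \<zeta>t])
    then have c0: "c \<ge> 0" unfolding c_def using e(1) by simp
    have "\<forall>\<^sub>F n in sequentially. norm (T m (\<zeta> (n, c))) \<le> (1/2)^i" for m
    proof -
      have "(\<lambda>n. c *\<^sub>R T m (\<eta> n)) \<longlonglongrightarrow> c *\<^sub>R T m (\<lambda>x. 0)"
        by (rule tendsto_scaleR[OF tendsto_const distribution_tendsto[OF T \<eta>]])
      then have "(\<lambda>n. T m (\<zeta> (n, c))) \<longlonglongrightarrow> 0"
        by (simp add: T\<zeta> distribution_zero[OF T])
      then have "\<forall>\<^sub>F n in sequentially. dist (T m (\<zeta> (n, c))) 0 < (1/2)^i"
        by (rule tendstoD) simp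
      then show ?thesis by eventually_elim simp
    qed
    then have 1: "\<forall>\<^sub>F n in sequentially. \<forall>j\<in>{..<i}. norm (T (fst (f j)) (\<zeta> (n, c))) \<le> (1/2)^i"
      by (intro eventually_ball_finite) simp_all
    have "\<forall>\<^sub>F n in sequentially. \<forall>x. norm (nderiv l (\<zeta> (n, c)) x) \<le> (1/2)^i" for l
    proof -
      have "uniform_limit UNIV (\<lambda>n. nderiv l (\<eta> n)) (\<lambda>x. 0) sequentially"
        using \<eta> by (simp add: test_converges_real_iff)
      then have "\<forall>\<^sub>F n in sequentially. \<forall>x\<in>UNIV. dist (nderiv l (\<eta> n) x) 0 < (1/2)^i / (c + 1)"
        by (rule uniform_limitD) (use c0 in simp)
      then show ?thesis
      proof eventually_elim
        case (elim n)
        show ?case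
        proof
          fix x
          have "norm (nderiv l (\<zeta> (n, c)) x) = c * norm (nderiv l (\<eta> n) x)"
            using c0 by (simp add: \<zeta>d)
          also have "\<dots> \<le> (c + 1) * ((1/2)^i / (c + 1))"
            using elim c0 by (intro mult_mono) (auto simp: less_imp_le)
          also have "\<dots> = (1/2)^i" using c0 by simp
          finally show "norm (nderiv l (\<zeta> (n, c)) x) \<le> (1/2)^i" .
        qed
      qed
    qed
    then have "\<forall>\<^sub>F n in sequentially. \<forall>l\<in>{..i}. \<forall>x. norm (nderiv l (\<zeta> (n, c)) x) \<le> (1/2)^i"
      by (intro eventually_ball_finite) auto
    from eventually_conj[OF 1 this] obtain N
      where N: "\<And>n. n \<ge> N \<Longrightarrow> (\<forall>j\<in>{..<i}. norm (T (fst (f j)) (\<zeta> (n, c))) \<le> (1/2)^i) \<and>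
          (\<forall>l\<in>{..i}. \<forall>x. norm (nderiv l (\<zeta> (n, c)) x) \<le> (1/2)^i)"
      unfolding eventually_sequentially by blast
    \<comment> \<open>Failure of convergence supplies such an index beyond every
      \<open>N\<close>.\<close>
    obtain n where n: "n \<ge> N" "e \<le> norm (T n (\<eta> n))" using e(2) by blast
    have "real i + (\<Sum>j<i. norm (T n (\<zeta> (f j)))) \<le> real i + (\<Sum>j<i. B (\<zeta> (f j)))"
      by (intro add_left_mono sum_mono B \<zeta>t)
    also have "\<dots> = c * e" using e(1) by (simp add: c_def)
    also have "\<dots> \<le> c * norm (T n (\<eta> n))" using n(2) c0 by (rule mult_left_mono)
    also have "\<dots> = norm (T n (\<zeta> (n, c)))" using c0 by (simp add: T\<zeta>)
    finally have "P f i (n, c)" using N[OF n(1)] by (simp add: P_def)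
    then show "\<exists>r. P f i r" ..
  qed
  then obtain f where f: "\<And>i. P f i (f i)" by blast
  have f1: "norm (T (fst (f j)) (\<zeta> (f i))) \<le> (1/2)^i" if "j < i" for i j
    using f[of i] that by (simp add: P_def)
  have f2: "real i + (\<Sum>j<i. norm (T (fst (f i)) (\<zeta> (f j)))) \<le> norm (T (fst (f i)) (\<zeta> (f i)))" for i
    using f[of i] by (simp add: P_def)
  have f3: "norm (nderiv l (\<zeta> (f i)) x) \<le> (1/2)^i" if "l \<le> i" for i l x
    using f[of i] that by (simp add: P_def)
  define S where "S N = (\<lambda>x. \<Sum>j<N. \<zeta> (f j) x)" for N :: nat
  have S_Suc: "S (Suc N) = (\<lambda>x. S N x + \<zeta> (f N) x)" for N by (simp add: S_def)
  have St: "test_function (S N)" for N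
    by (induction N) (simp_all add: S_Suc test_function_add \<zeta>t, simp add: S_def test_function_zero)
  have Sd: "nderiv l (S N) = (\<lambda>x. \<Sum>j<N. nderiv l (\<zeta> (f j)) x)" for l N
  proof (induction N)
    case (Suc N)
    have "nderiv l (S (Suc N)) = (\<lambda>x. nderiv l (S N) x + nderiv l (\<zeta> (f N)) x)"
      using smooth_lincomb(1)[of "S N" "\<zeta> (f N)" l 1 1] St \<zeta>t by (simp add: S_Suc test_function_def)
    with Suc show ?case by simp
  qed (simp add: S_def)
  have ST: "T m (S N) = (\<Sum>j<N. T m (\<zeta> (f j)))" for m N
  proof (induction N)
    case (Suc N) then show ?case by (simp add: S_Suc distribution_add[OF T St \<zeta>t])
  qed (simp add: S_def distribution_zero[OF T])
  define g where "g l = (\<lambda>x. \<Sum>j. nderiv l (\<zeta> (f j)) x)" for l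
  have conv: "test_converges S (g 0)"
  proof (rule test_convergesI[OF St K(1)])
    show "S n x = 0" if "x \<notin> K" for n x using K(2)[OF that] by (simp add: S_def \<zeta>_def)
    show "uniform_limit UNIV (\<lambda>n. nderiv j (S n)) (g j) sequentially" for j
      unfolding Sd g_def
    proof (rule Weierstrass_m_test_ev)
      \<comment> \<open>Stage \<open>n\<close> controls orders up to \<open>n\<close> only, hence
        the bound starts at \<open>n = j\<close>.\<close>
      show "\<forall>\<^sub>F n in sequentially. \<forall>x\<in>UNIV. norm (nderiv j (\<zeta> (f n)) x) \<le> (1/2)^n"
        using eventually_ge_at_top[of j] by eventually_elim (simp add: f3)
    qed (simp add: summable_geometric)
  qed
  \<comment> \<open>Later humps contribute at most the geometric series, with sum 2, to the
    \<open>j\<close>-th functional; the earlier ones are outweighed by its own hump with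
    \<open>j\<close> to spare.\<close>
  have "real j - 2 \<le> B (g 0)" for j
  proof -
    have "real j - 2 \<le> norm (T (fst (f j)) (S N))" if "N > j" for N
    proof -
      let ?a = "\<lambda>i. T (fst (f j)) (\<zeta> (f i))"
      have split: "{..<N} = insert j ({..<j} \<union> {j<..<N})" using that by auto
      have "T (fst (f j)) (S N) = ?a j + ((\<Sum>i<j. ?a i) + (\<Sum>i\<in>{j<..<N}. ?a i))"
        unfolding ST split by (subst sum.insert, simp, simp, subst sum.union_disjoint) auto
      then have "norm (?a j) = norm (T (fst (f j)) (S N) - ((\<Sum>i<j. ?a i) + (\<Sum>i\<in>{j<..<N}. ?a i)))"
        by (simp add: algebra_simps)
      also have "\<dots> \<le> norm (T (fst (f j)) (S N)) + norm ((\<Sum>i<j. ?a i) + (\<Sum>i\<in>{j<..<N}. ?a i))"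
        by (rule norm_triangle_ineq4)
      also have "norm ((\<Sum>i<j. ?a i) + (\<Sum>i\<in>{j<..<N}. ?a i)) \<le>
          (\<Sum>i<j. norm (?a i)) + (\<Sum>i\<in>{j<..<N}. (1/2)^i)"
        by (rule order_trans[OF norm_triangle_ineq add_mono[OF norm_sum sum_norm_le]]) (simp add: f1)
      also have "(\<Sum>i\<in>{j<..<N}. (1/2::real)^i) \<le> (\<Sum>i. (1/2)^i)"
        by (intro sum_le_suminf) (auto simp: summable_geometric)
      also have "(\<Sum>i. (1/2::real)^i) = 2" by (simp add: suminf_geometric)
      finally show ?thesis using f2[of j] by simp
    qed
    then have "\<exists>N0. \<forall>N\<ge>N0. real j - 2 \<le> norm (T (fst (f j)) (S N))"
      by (intro exI[of _ "Suc j"]) auto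
    moreover have "(\<lambda>N. norm (T (fst (f j)) (S N))) \<longlonglongrightarrow> norm (T (fst (f j)) (g 0))"
      by (rule tendsto_norm[OF distribution_tendsto[OF T conv]])
    ultimately have "real j - 2 \<le> norm (T (fst (f j)) (g 0))" by (rule LIMSEQ_le_const[rotated])
    also have "\<dots> \<le> B (g 0)" using conv by (intro B) (simp add: test_converges_def)
    finally show ?thesis .
  qed
  moreover obtain j where "B (g 0) + 2 < real j" using reals_Archimedean2 by blast
  ultimately show False by (metis less_diff_eq not_le)
qed

text \<open>Split \<open>T n (\<eta> n)\<close> into \<open>T n\<close> of the difference between
  \<open>\<eta> n\<close> and \<open>\<phi>\<close>, and \<open>T n \<phi>\<close>. Pointwise
  convergence makes the functionals bounded on each test function, so Banach-Steinhaus sends the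
  first part to 0.\<close>

corollary distributions_joint_tendsto:
  fixes T :: "nat \<Rightarrow> (real \<Rightarrow> 'a::{real_normed_field, euclidean_space}) \<Rightarrow> 'a"
  assumes T: "\<And>n. distribution (T n)"
    and lim: "\<And>\<phi>. test_function \<phi> \<Longrightarrow> (\<lambda>n. T n \<phi>) \<longlonglongrightarrow> S \<phi>"
    and \<eta>: "test_converges \<eta> \<phi>"
  shows "(\<lambda>n. T n (\<eta> n)) \<longlonglongrightarrow> S \<phi>"
proof -
  have t: "test_function \<phi>" "test_function (\<eta> n)" for n using \<eta> by (simp_all add: test_converges_def)
  have "(\<lambda>n. T n (\<lambda>x. \<eta> n x - \<phi> x)) \<longlonglongrightarrow> 0"
  proof (rule banach_steinhaus_test_functions[OF T])
    show "\<exists>C. \<forall>n. norm (T n \<psi>) \<le> C" if "test_function \<psi>" for \<psi>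
      using convergent_imp_Bseq[OF convergentI[OF lim[OF that]]] by (auto simp: Bseq_def)
    show "test_converges (\<lambda>n x. \<eta> n x - \<phi> x) (\<lambda>x. 0)"
      using test_converges_diff[OF \<eta> test_converges_const[OF t(1)]] by simp
  qed
  then have "(\<lambda>n. T n (\<eta> n) - T n \<phi>) \<longlonglongrightarrow> 0" by (simp add: distribution_diff[OF T t(2,1)])
  from tendsto_add[OF this lim[OF t(1)]] show ?thesis by simp
qed

section \<open>Curves of distributions and of test functions\<close>

lemma has_vector_derivative_iff_quotient:
  "(f has_vector_derivative d) (at x) \<longleftrightarrow> ((\<lambda>h. (f (x + h) - f x) /\<^sub>R h) \<longlongrightarrow> d) (at 0)"
proof -
  have "(f has_vector_derivative d) (at x) \<longleftrightarrow>
      ((\<lambda>h. norm (f (x + h) - f x - h *\<^sub>R d) / norm h) \<longlongrightarrow> 0) (at 0)"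
    by (simp add: has_vector_derivative_def has_derivative_at bounded_linear_scaleR_left)
  also have "\<dots> \<longleftrightarrow> ((\<lambda>h. norm ((f (x + h) - f x) /\<^sub>R h - d)) \<longlongrightarrow> 0) (at 0)"
  proof (rule LIM_equal, intro allI impI)
    fix h :: real assume "h \<noteq> 0"
    then have "(f (x + h) - f x) /\<^sub>R h - d = (f (x + h) - f x - h *\<^sub>R d) /\<^sub>R h"
      by (simp add: scaleR_diff_right)
    then show "norm (f (x + h) - f x - h *\<^sub>R d) / norm h = norm ((f (x + h) - f x) /\<^sub>R h - d)"
      by (simp add: divide_inverse_commute)
  qed
  also have "\<dots> \<longleftrightarrow> ((\<lambda>h. (f (x + h) - f x) /\<^sub>R h) \<longlongrightarrow> d) (at 0)"
    by (simp only: tendsto_norm_zero_iff LIM_zero_iff)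
  finally show ?thesis .
qed

lemma C1_dist_iff:
  "C1_dist u v \<longleftrightarrow> (\<forall>t. distribution (u t)) \<and> (\<forall>t. distribution (v t)) \<and>
     (\<forall>\<phi> t. test_function \<phi> \<longrightarrow>
        ((\<lambda>s. u s \<phi>) has_vector_derivative v t \<phi>) (at t) \<and> isCont (\<lambda>s. v s \<phi>) t)"
  unfolding C1_dist_def has_vector_derivative_iff_quotient isCont_iff ..

text \<open>Differentiability of a curve in the topology of test functions, including a common
  compact support of the quotients. As \<open>test_converges\<close> speaks of sequences, the limit
  is taken along every null sequence of nonzero steps.\<close>

definition has_tderiv :: "(real \<Rightarrow> real \<Rightarrow> 'a::real_normed_vector) \<Rightarrow> (real \<Rightarrow> real \<Rightarrow> 'a) \<Rightarrow> bool" where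
  "has_tderiv \<eta> \<eta>' \<longleftrightarrow> (\<forall>t. test_function (\<eta> t)) \<and>
     (\<forall>t h. (\<forall>n. h n \<noteq> 0) \<longrightarrow> h \<longlonglongrightarrow> 0 \<longrightarrow>
        test_converges (\<lambda>n x. (\<eta> (t + h n) x - \<eta> t x) /\<^sub>R h n) (\<eta>' t))"

lemma has_tderiv_test_function: "has_tderiv \<eta> \<eta>' \<Longrightarrow> test_function (\<eta> t)"
  by (simp add: has_tderiv_def)

text \<open>Product rule. In one part of the split quotient, \<open>u (t + h)\<close> acts on the
  difference quotient of \<open>\<eta>\<close>, so that functional and argument move together; this
  is where the joint limit is used.\<close>

lemma pairing_has_vector_derivative:
  assumes u: "C1_dist u v" and \<eta>: "has_tderiv \<eta> \<eta>'"
  shows "((\<lambda>t. u t (\<eta> t)) has_vector_derivative v t (\<eta> t) + u t (\<eta>' t)) (at t)"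
  unfolding has_vector_derivative_iff_quotient tendsto_at_iff_sequentially
proof (intro allI impI)
  fix h :: "nat \<Rightarrow> real" assume h: "\<forall>n. h n \<in> UNIV - {0}" "h \<longlonglongrightarrow> 0"
  note du = u[unfolded C1_dist_iff]
  have dist: "distribution (u s)" for s using du by blast
  note t = has_tderiv_test_function[OF \<eta>]
  have q: "test_converges (\<lambda>n x. (\<eta> (t + h n) x - \<eta> t x) /\<^sub>R h n) (\<eta>' t)"
    using \<eta> h by (simp add: has_tderiv_def)
  have "(\<lambda>n. (u (t + h n) (\<eta> t) - u t (\<eta> t)) /\<^sub>R h n) \<longlonglongrightarrow> v t (\<eta> t)"
    using u t h unfolding C1_dist_def tendsto_at_iff_sequentially comp_def by blast
  moreover have "(\<lambda>n. u (t + h n) (\<lambda>x. (\<eta> (t + h n) x - \<eta> t x) /\<^sub>R h n)) \<longlonglongrightarrow> u t (\<eta>' t)"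
  proof (rule distributions_joint_tendsto[OF _ _ q])
    show "distribution (u (t + h n))" for n by (rule dist)
    show "(\<lambda>n. u (t + h n) \<phi>) \<longlonglongrightarrow> u t \<phi>" if "test_function \<phi>" for \<phi>
    proof -
      have "isCont (\<lambda>s. u s \<phi>) t" using du that has_vector_derivative_continuous by blast
      moreover have "(\<lambda>n. t + h n) \<longlonglongrightarrow> t" using tendsto_add[OF tendsto_const h(2), of t] by simp
      ultimately show ?thesis by (rule isCont_tendsto_compose)
    qed
  qed
  ultimately have "(\<lambda>n. (u (t + h n) (\<eta> t) - u t (\<eta> t)) /\<^sub>R h n +
      u (t + h n) (\<lambda>x. (\<eta> (t + h n) x - \<eta> t x) /\<^sub>R h n)) \<longlonglongrightarrow> v t (\<eta> t) + u t (\<eta>' t)"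
    by (rule tendsto_add)
  moreover have "u (t + h n) (\<lambda>x. (\<eta> (t + h n) x - \<eta> t x) /\<^sub>R h n) =
      (u (t + h n) (\<eta> (t + h n)) - u (t + h n) (\<eta> t)) /\<^sub>R h n" for n
    by (simp add: distribution_scaleR[OF dist] distribution_diff[OF dist] test_function_diff t)
  ultimately show "((\<lambda>h. (u (t + h) (\<eta> (t + h)) - u t (\<eta> t)) /\<^sub>R h) \<circ> h) \<longlonglongrightarrow> v t (\<eta> t) + u t (\<eta>' t)"
    by (simp add: comp_def flip: scaleR_add_right)
qed

lemma distribution_has_vector_derivative:
  assumes f: "distribution f" and \<eta>: "has_tderiv \<eta> \<eta>'"
  shows "((\<lambda>t. f (\<eta> t)) has_vector_derivative f (\<eta>' t)) (at t)"
  unfolding has_vector_derivative_iff_quotient tendsto_at_iff_sequentially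
proof (intro allI impI)
  fix h :: "nat \<Rightarrow> real" assume h: "\<forall>n. h n \<in> UNIV - {0}" "h \<longlonglongrightarrow> 0"
  note t = has_tderiv_test_function[OF \<eta>]
  have "(\<lambda>n. f (\<lambda>x. (\<eta> (t + h n) x - \<eta> t x) /\<^sub>R h n)) \<longlonglongrightarrow> f (\<eta>' t)"
    by (rule distribution_tendsto[OF f]) (use \<eta> h in \<open>simp add: has_tderiv_def\<close>)
  then show "((\<lambda>h. (f (\<eta> (t + h)) - f (\<eta> t)) /\<^sub>R h) \<circ> h) \<longlonglongrightarrow> f (\<eta>' t)"
    by (simp add: distribution_scaleR[OF f] distribution_diff[OF f] test_function_diff t comp_def)
qed

lemma has_vector_derivative_lipschitz:
  fixes f :: "real \<Rightarrow> 'a::real_normed_vector"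
  assumes "\<And>t. \<bar>t\<bar> \<le> R \<Longrightarrow> (f has_vector_derivative f' t) (at t)"
    and "\<And>t. \<bar>t\<bar> \<le> R \<Longrightarrow> norm (f' t) \<le> C" and "\<bar>s\<bar> \<le> R" "\<bar>t\<bar> \<le> R"
  shows "norm (f s - f t) \<le> C * \<bar>s - t\<bar>"
proof -
  have "norm (f s - f t) \<le> C * norm (s - t)"
  proof (rule differentiable_bound[where S = "{-R..R}" and f' = "\<lambda>t h. h *\<^sub>R f' t"])
    show "(f has_derivative (\<lambda>h. h *\<^sub>R f' t)) (at t within {-R..R})" if "t \<in> {-R..R}" for t
      using assms(1)[of t] that by (auto simp: has_vector_derivative_def intro: has_derivative_at_withinI)
    show "onorm (\<lambda>h. h *\<^sub>R f' t) \<le> C" if "t \<in> {-R..R}" for t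
      using assms(2)[of t] that by (intro onorm_le) (auto simp: mult.commute[of C] intro: mult_left_mono)
  qed (use assms in auto)
  then show ?thesis by simp
qed

text \<open>\<open>G\<close> is not assumed to consist of the \<open>x\<close>-derivatives of \<open>G 0\<close>: that follows.\<close>

lemma has_tderivI:
  fixes F G H :: "nat \<Rightarrow> real \<Rightarrow> real \<Rightarrow> 'a::{real_normed_field, banach}"
  assumes test: "\<And>t. test_function (F 0 t)"
    and D: "\<And>j t. nderiv j (F 0 t) = F j t"
    and supp: "\<And>R. \<exists>K. compact K \<and> (\<forall>t x. \<bar>t\<bar> \<le> R \<longrightarrow> x \<notin> K \<longrightarrow> F 0 t x = 0)"
    and FG: "\<And>j t x. ((\<lambda>t. F j t x) has_vector_derivative G j t x) (at t)"
    and GH: "\<And>j t x. ((\<lambda>t. G j t x) has_vector_derivative H j t x) (at t)"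
    and bound: "\<And>j R. \<exists>C. \<forall>t x. \<bar>t\<bar> \<le> R \<longrightarrow> norm (H j t x) \<le> C"
  shows "has_tderiv (F 0) (G 0)"
  unfolding has_tderiv_def
proof (intro conjI allI impI)
  fix t and h :: "nat \<Rightarrow> real" assume h: "\<forall>n. h n \<noteq> 0" "h \<longlonglongrightarrow> 0"
  obtain M where M: "\<And>n. \<bar>h n\<bar> \<le> M"
    using convergent_imp_Bseq[OF convergentI[OF h(2)]] by (auto simp: Bseq_def)
  \<comment> \<open>All times \<open>t + h n\<close> lie in \<open>[-R, R]\<close>, so one compact
    set and one bound on \<open>H\<close> serve the whole sequence.\<close>
  define R where "R = \<bar>t\<bar> + M"
  have "M \<ge> 0" using M[of 0] by linarith
  then have R: "\<bar>t\<bar> \<le> R" "\<bar>t + h n\<bar> \<le> R" for n using M[of n] by (auto simp: R_def)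
  obtain K where K: "compact K" "\<And>t x. \<bar>t\<bar> \<le> R \<Longrightarrow> x \<notin> K \<Longrightarrow> F 0 t x = 0" using supp[of R] by blast
  let ?\<Phi> = "\<lambda>n x. (F 0 (t + h n) x - F 0 t x) /\<^sub>R h n"
  show "test_converges ?\<Phi> (G 0 t)"
  proof (rule test_convergesI[OF _ K(1)])
    show "test_function (?\<Phi> n)" for n by (intro test_function_scaleR test_function_diff test)
    show "?\<Phi> n x = 0" if "x \<notin> K" for n x using K(2) R that by simp
    fix j
    have nd: "nderiv j (?\<Phi> n) = (\<lambda>x. (F j (t + h n) x - F j t x) /\<^sub>R h n)" for n
    proof -
      have s: "smooth (F 0 t)" for t using test by (simp add: test_function_def)
      have "smooth (\<lambda>x. F 0 (t + h n) x - F 0 t x)"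
        using test_function_diff[OF test test] by (simp add: test_function_def)
      moreover have "nderiv j (\<lambda>x. F 0 (t + h n) x - F 0 t x) = (\<lambda>x. F j (t + h n) x - F j t x)"
        using smooth_lincomb(1)[of "F 0 (t + h n)" "F 0 t" j 1 "-1"] s by (simp add: D)
      ultimately show ?thesis by (simp add: nderiv_scaleR)
    qed
    obtain C where C: "\<And>t x. \<bar>t\<bar> \<le> R \<Longrightarrow> norm (H j t x) \<le> C" using bound by blast
    \<comment> \<open>Second order remainder: the bound on \<open>H\<close> limits the variation of
      \<open>G\<close> to \<open>C\<close> times the step, and hence the error of the quotient to
      the same amount, uniformly in \<open>x\<close>.\<close>
    have est: "norm ((F j (t + h n) x - F j t x) /\<^sub>R h n - G j t x) \<le> C * \<bar>h n\<bar>" for n x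
    proof -
      let ?S = "closed_segment t (t + h n)"
      have S: "\<bar>s\<bar> \<le> R" "\<bar>s - t\<bar> \<le> \<bar>h n\<bar>" if "s \<in> ?S" for s
        using that R(1) R(2)[of n] by (auto simp: closed_segment_eq_real_ivl split: if_splits)
      have C0: "C \<ge> 0" using C[OF R(1), of 0] norm_ge_zero order_trans by blast
      have "norm (F j (t + h n) x - F j t x - ((t + h n) - t) *\<^sub>R G j t x) \<le> norm ((t + h n) - t) * (C * \<bar>h n\<bar>)"
      proof (rule vector_differentiable_bound_linearization[where S = ?S and f = "\<lambda>t. F j t x" and f' = "\<lambda>t. G j t x" and ?x0.0 = t])
        show "norm (G j s x - G j t x) \<le> C * \<bar>h n\<bar>" if "s \<in> ?S" for s
        proof -
          have "norm (G j s x - G j t x) \<le> C * \<bar>s - t\<bar>"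
            by (rule has_vector_derivative_lipschitz[OF GH C S(1)[OF that] R(1)])
          also have "\<dots> \<le> C * \<bar>h n\<bar>" using C0 S(2)[OF that] by (rule mult_left_mono[rotated])
          finally show ?thesis .
        qed
      qed (auto intro: FG has_vector_derivative_at_within)
      then have "norm (F j (t + h n) x - F j t x - h n *\<^sub>R G j t x) \<le> \<bar>h n\<bar> * (C * \<bar>h n\<bar>)" by simp
      moreover have *: "(F j (t + h n) x - F j t x) /\<^sub>R h n - G j t x =
          (F j (t + h n) x - F j t x - h n *\<^sub>R G j t x) /\<^sub>R h n"
        using h(1) by (simp add: scaleR_diff_right)
      moreover have "\<bar>h n\<bar> > 0" using h(1) by simp
      ultimately show ?thesis
        unfolding * norm_scaleR abs_inverse by (subst inverse_eq_divide) (simp add: pos_divide_le_eq mult.commute)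
    qed
    show "uniform_limit UNIV (\<lambda>n. nderiv j (?\<Phi> n)) (G j t) sequentially"
      unfolding nd
    proof (rule uniform_limitI)
      fix e :: real assume "e > 0"
      have "(\<lambda>n. C * \<bar>h n\<bar>) \<longlonglongrightarrow> 0" using tendsto_mult_right_zero[OF tendsto_rabs_zero[OF h(2)]] .
      then have "\<forall>\<^sub>F n in sequentially. C * \<bar>h n\<bar> < e" using \<open>e > 0\<close> by (rule order_tendstoD)
      then show "\<forall>\<^sub>F n in sequentially. \<forall>x\<in>UNIV. dist ((F j (t + h n) x - F j t x) /\<^sub>R h n) (G j t x) < e"
        by eventually_elim (use est in \<open>auto simp: dist_norm intro: le_less_trans\<close>)
    qed
  qed
qed (rule test)

section \<open>Bump functions and the lemma of du Bois-Reymond\<close>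

text \<open>Coinduction: membership in a class closed under differentiation yields all derivatives
  at once. It serves where the higher derivatives have no handy closed form.\<close>

lemma smooth_coinduct:
  fixes \<phi> :: "real \<Rightarrow> 'a::real_normed_vector"
  assumes "C \<phi>" and step: "\<And>\<phi>. C \<phi> \<Longrightarrow> \<exists>\<psi>. C \<psi> \<and> (\<forall>x. (\<phi> has_vector_derivative \<psi> x) (at x))"
  shows "smooth \<phi>"
proof -
  have "C (nderiv j \<phi>)" for j
  proof (induction j)
    case (Suc j)
    then obtain \<psi> where "C \<psi>" "\<And>x. (nderiv j \<phi> has_vector_derivative \<psi> x) (at x)"
      using step by blast
    then show ?case using partial_eqI[of "nderiv j \<phi>" \<psi>] by (simp add: nderiv_Suc)
  qed (simp add: assms(1))
  then show ?thesis unfolding smooth_real_iff using step differentiableI_vector by blast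
qed

text \<open>By the product rule, sums of products are closed under differentiation, which single
  products are not.\<close>

inductive smooth_product_sum :: "(real \<Rightarrow> 'a::real_normed_algebra) \<Rightarrow> bool" where
  mult: "smooth f \<Longrightarrow> smooth g \<Longrightarrow> smooth_product_sum (\<lambda>x. f x * g x)"
| add: "smooth_product_sum f \<Longrightarrow> smooth_product_sum g \<Longrightarrow> smooth_product_sum (\<lambda>x. f x + g x)"

lemma smooth_has_vector_derivative:
  "smooth (\<phi> :: real \<Rightarrow> 'a::real_normed_vector) \<Longrightarrow> (\<phi> has_vector_derivative partial 1 \<phi> x) (at x)"
  using smooth_nderiv_has_vector_derivative[of \<phi> 0] by (simp add: nderiv_Suc)

lemma smooth_partial: "smooth (\<phi> :: real \<Rightarrow> 'a::real_normed_vector) \<Longrightarrow> smooth (partial 1 \<phi>)"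
  using smooth_nderiv[of \<phi> 1] by (simp add: nderiv_Suc)

lemma smooth_mult:
  fixes f g :: "real \<Rightarrow> 'a::real_normed_algebra"
  assumes "smooth f" "smooth g"
  shows "smooth (\<lambda>x. f x * g x)"
proof (rule smooth_coinduct[where C = smooth_product_sum])
  show "smooth_product_sum (\<lambda>x. f x * g x)" using assms by (rule smooth_product_sum.mult)
  fix \<phi> :: "real \<Rightarrow> 'a" assume "smooth_product_sum \<phi>"
  then show "\<exists>\<psi>. smooth_product_sum \<psi> \<and> (\<forall>x. (\<phi> has_vector_derivative \<psi> x) (at x))"
  proof induction
    case (mult f g)
    have "((\<lambda>x. f x * g x) has_vector_derivative f x * partial 1 g x + partial 1 f x * g x) (at x)" for x
      by (rule has_vector_derivative_mult[OF mult[THEN smooth_has_vector_derivative]])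
    moreover have "smooth_product_sum (\<lambda>x. f x * partial 1 g x + partial 1 f x * g x)"
      by (rule smooth_product_sum.add; rule smooth_product_sum.mult; rule mult smooth_partial[OF mult(1)] smooth_partial[OF mult(2)])
    ultimately show ?case by blast
  next
    case (add f g)
    then obtain f' g' where "smooth_product_sum f'" "smooth_product_sum g'"
      and d: "\<And>x. (f has_vector_derivative f' x) (at x)" "\<And>x. (g has_vector_derivative g' x) (at x)"
      by blast
    then have "smooth_product_sum (\<lambda>x. f' x + g' x)" by (intro smooth_product_sum.add)
    moreover have "((\<lambda>x. f x + g x) has_vector_derivative f' x + g' x) (at x)" for x
      by (rule has_vector_derivative_add[OF d])
    ultimately show ?case by blast
  qed
qed

lemma smooth_affine:
  fixes f :: "real \<Rightarrow> 'a::real_normed_vector"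
  assumes "smooth f"
  shows "smooth (\<lambda>x. f (a + b * x))"
proof -
  have "((\<lambda>x. b ^ j *\<^sub>R nderiv j f (a + b * x)) has_vector_derivative
      b ^ Suc j *\<^sub>R nderiv (Suc j) f (a + b * x)) (at x)" for j x
  proof -
    have "((\<lambda>x. a + b * x) has_vector_derivative b) (at x)"
      by (auto intro!: derivative_eq_intros simp: has_real_derivative_iff_has_vector_derivative[symmetric])
    from vector_diff_chain_at[OF this smooth_nderiv_has_vector_derivative[OF assms]]
    have "((\<lambda>x. nderiv j f (a + b * x)) has_vector_derivative b *\<^sub>R nderiv (Suc j) f (a + b * x)) (at x)"
      by (simp add: comp_def)
    from has_vector_derivative_scaleR[OF DERIV_const[of "b ^ j"] this] show ?thesis
      by (simp add: mult.commute)
  qed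
  from nderiv_sequenceI(2)[of "\<lambda>j x. b ^ j *\<^sub>R nderiv j f (a + b * x)", OF this] show ?thesis by simp
qed

section \<open>A flat function and compactly supported bumps\<close>

definition flat :: "real poly \<Rightarrow> real \<Rightarrow> real" where
  "flat p x = (if x > 0 then poly p (inverse x) * exp (- inverse x) else 0)"

lemma flat_tendsto_0: "(flat p \<longlongrightarrow> 0) (at 0)"
proof -
  have "((\<lambda>y. \<Sum>i\<le>degree p. coeff p i * (y ^ i / exp y)) \<longlongrightarrow> (\<Sum>i\<le>degree p. coeff p i * 0)) at_top"
    by (intro tendsto_intros tendsto_power_div_exp_0)
  then have "((\<lambda>y. poly p y * exp (- y)) \<longlongrightarrow> 0) at_top"
    by (simp add: poly_altdef exp_minus sum_distrib_right divide_inverse mult.assoc)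
  then have "((\<lambda>x. poly p (inverse x) * exp (- inverse x)) \<longlongrightarrow> 0) (at_right 0)"
    by (rule filterlim_compose[OF _ filterlim_inverse_at_top_right])
  then have "(flat p \<longlongrightarrow> 0) (at_right 0)"
    by (rule Lim_transform_eventually)
       (auto simp: eventually_at_right_field flat_def intro: exI[of _ 1])
  moreover have "(flat p \<longlongrightarrow> 0) (at_left 0)"
    by (rule tendsto_eventually) (auto simp: eventually_at_left_field flat_def intro: exI[of _ "-1"])
  ultimately show ?thesis by (simp add: filterlim_split_at)
qed

text \<open>With y = 1/x one has y' = -y^2, so p(y) exp(-y) has the derivative y^2 (p - p')(y)
  exp(-y). The polynomial is carried along to obtain a class closed under differentiation. At 0 the
  difference quotient is again of this form, with the polynomial y p(y), and tends to 0.\<close>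

lemma flat_has_real_derivative:
  "(flat p has_real_derivative flat ([:0, 0, 1:] * (p - pderiv p)) x) (at x)"
proof (cases x "0::real" rule: linorder_cases)
  case less
  have "((\<lambda>x. 0) has_real_derivative 0) (at x)" by simp
  then have "(flat p has_real_derivative 0) (at x)"
    by (rule has_field_derivative_transform_within_open[of _ _ _ "{..<0}"]) (use less in \<open>auto simp: flat_def\<close>)
  then show ?thesis using less by (simp add: flat_def)
next
  case equal
  have "((\<lambda>h. flat p h / h) \<longlongrightarrow> 0) (at 0)"
  proof (rule Lim_transform_eventually[OF flat_tendsto_0[of "[:0, 1:] * p"]])
    show "\<forall>\<^sub>F h in at 0. flat ([:0, 1:] * p) h = flat p h / h"
      by (rule always_eventually) (simp add: flat_def field_simps)
  qed
  then show ?thesis using equal by (simp add: DERIV_def flat_def)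
next
  case greater
  have "((\<lambda>x. poly p (inverse x) * exp (- inverse x)) has_real_derivative
      poly ([:0, 0, 1:] * (p - pderiv p)) (inverse x) * exp (- inverse x)) (at x)"
    using greater
    by (auto intro!: derivative_eq_intros DERIV_chain2[OF poly_DERIV] simp: algebra_simps power2_eq_square)
  then have "(flat p has_real_derivative poly ([:0, 0, 1:] * (p - pderiv p)) (inverse x) * exp (- inverse x)) (at x)"
    by (rule has_field_derivative_transform_within_open[of _ _ _ "{0<..}"]) (use greater in \<open>auto simp: flat_def\<close>)
  then show ?thesis using greater by (simp add: flat_def)
qed

lemma smooth_flat: "smooth (flat p)"
proof (rule smooth_coinduct[where C = "\<lambda>\<phi>. \<exists>p. \<phi> = flat p"])
  fix \<phi> assume "\<exists>p. \<phi> = flat p"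
  then show "\<exists>\<psi>. (\<exists>p. \<psi> = flat p) \<and> (\<forall>x. (\<phi> has_vector_derivative \<psi> x) (at x))"
    using flat_has_real_derivative has_real_derivative_iff_has_vector_derivative by blast
qed auto

text \<open>The coefficients 1 and -1 are written out so that both arguments have the form
  \<open>a + b * x\<close> of \<open>smooth_affine\<close>.\<close>

definition bump :: "real \<Rightarrow> real \<Rightarrow> real" where
  "bump d x = flat 1 (d + 1 * x) * flat 1 (d + (-1) * x)"

lemma smooth_bump: "smooth (bump d)"
  unfolding bump_def[abs_def] by (intro smooth_mult smooth_affine smooth_flat)

lemma bump_nonneg: "bump d x \<ge> 0"
  by (simp add: bump_def flat_def)

lemma bump_pos: "\<bar>x\<bar> < d \<Longrightarrow> bump d x > 0"
  by (auto simp: bump_def flat_def abs_less_iff)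

lemma bump_eq_0: "\<bar>x\<bar> \<ge> d \<Longrightarrow> bump d x = 0"
  by (auto simp: bump_def flat_def)

lemma test_function_bump: "test_function (bump d)"
  by (rule test_functionI[OF smooth_bump, of "{-d..d}"]) (auto intro: bump_eq_0)

section \<open>Integrals of compactly supported functions\<close>

lemma has_bochner_integral_compact_support:
  fixes f :: "real \<Rightarrow> 'a::euclidean_space"
  assumes "continuous_on {a..b} f" "\<And>x. x \<notin> {a..b} \<Longrightarrow> f x = 0"
  shows "has_bochner_integral lborel f (integral {a..b} f)"
proof -
  have i: "set_integrable lborel {a..b} f" using assms(1) by (rule borel_integrable_atLeastAtMost')
  have "(\<lambda>x. indicator {a..b} x *\<^sub>R f x) = f" using assms(2) by (auto simp: indicator_def)
  then show ?thesis
    using i set_borel_integral_eq_integral(2)[OF i]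
    by (simp add: has_bochner_integral_iff set_integrable_def set_lebesgue_integral_def)
qed

lemma has_bochner_integral_derivative_compact_support:
  fixes f :: "real \<Rightarrow> 'a::euclidean_space"
  assumes F: "\<And>t. (F has_vector_derivative f t) (at t)" and f: "continuous_on UNIV f"
    and 0: "\<And>t. \<bar>t\<bar> > R \<Longrightarrow> F t = 0" "\<And>t. \<bar>t\<bar> > R \<Longrightarrow> f t = 0"
  shows "has_bochner_integral lborel f 0"
proof -
  \<comment> \<open>Strictly beyond \<open>R\<close>, so that \<open>F\<close> vanishes at both
    ends.\<close>
  let ?M = "\<bar>R\<bar> + 1"
  have "(f has_integral F ?M - F (- ?M)) {- ?M..?M}"
    by (rule fundamental_theorem_of_calculus) (auto intro: F has_vector_derivative_at_within)
  then have "integral {- ?M..?M} f = 0" using 0(1) by (simp add: integral_unique)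
  moreover have "has_bochner_integral lborel f (integral {- ?M..?M} f)"
    by (rule has_bochner_integral_compact_support) (use f continuous_on_subset 0(2) in auto)
  ultimately show ?thesis by simp
qed

text \<open>
  The test function used is \<open>\<lambda>t. \<integral>\<^sub>a\<^sup>b \<rho> (t - r) dr\<close> with a narrow bump \<open>\<rho>\<close>; its derivative is the
  difference of the translates of \<open>\<rho>\<close> to \<open>a\<close> and \<open>b\<close>.
\<close>

lemma du_Bois_Reymond:
  fixes m :: "real \<Rightarrow> 'a::euclidean_space"
  assumes m: "continuous_on UNIV m"
    and int: "\<And>\<xi> :: real \<Rightarrow> real. test_function \<xi> \<Longrightarrow> (LINT t|lborel. partial 1 \<xi> t *\<^sub>R m t) = 0"
  shows "m a = m b"
proof (rule linorder_wlog[where a = a and b = b])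
  fix a b :: real assume "a \<le> b"
  \<comment> \<open>The values at \<open>a\<close> and \<open>b\<close> are compared together with
    their neighbourhoods, since a bump sees only a weighted mean; the goal is
    \<open>q 0 = 0\<close>.\<close>
  define q where "q s = m (a + s) - m (b + s)" for s
  have q: "continuous_on A q" for A
    unfolding q_def by (intro continuous_intros continuous_on_compose2[OF m]) auto
  show "m a = m b"
  proof (rule ccontr)
    assume "m a \<noteq> m b"
    then have q0: "q 0 \<bullet> q 0 > 0" by (simp add: q_def)
    \<comment> \<open>The inner product with \<open>q 0\<close> reduces vector values to a scalar
      that is positive near 0.\<close>
    have "isCont (\<lambda>s. q s \<bullet> q 0) 0"
      using q[of UNIV] by (intro continuous_intros) (simp add: continuous_on_eq_continuous_at)
    then have "\<forall>\<^sub>F s in nhds 0. q s \<bullet> q 0 > 0"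
      using q0 by (metis isContD order_tendstoD(1) tendsto_at_iff_tendsto_nhds)
    then obtain d where d: "d > 0" "\<And>s. \<bar>s\<bar> < d \<Longrightarrow> q s \<bullet> q 0 > 0"
      by (auto simp: eventually_nhds_metric dist_real_def)
    let ?\<rho> = "bump d"
    define \<zeta> where "\<zeta> t = 1 * ?\<rho> (- a + 1 * t) + (-1) * ?\<rho> (- b + 1 * t)" for t
    have s\<zeta>: "smooth \<zeta>"
      unfolding \<zeta>_def[abs_def] by (intro smooth_lincomb smooth_affine smooth_bump)
    define \<xi> where "\<xi> t = integral {a..b} (\<lambda>r. ?\<rho> (t - r))" for t
    have c\<rho>: "continuous_on A ?\<rho>" for A by (rule test_function_continuous[OF test_function_bump])
    have c\<rho>': "continuous_on A (partial 1 ?\<rho>)" for A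
      by (rule test_function_continuous[OF test_function_partial[OF test_function_bump]]) simp
    have d\<rho>: "(?\<rho> has_vector_derivative partial 1 ?\<rho> t) (at t)" for t
      by (rule smooth_has_vector_derivative[OF smooth_bump])
    have d\<xi>: "(\<xi> has_vector_derivative \<zeta> t) (at t)" for t
    proof -
      have "((\<lambda>t. integral (cbox a b) (\<lambda>r. ?\<rho> (t - r))) has_vector_derivative
          integral (cbox a b) (\<lambda>r. partial 1 ?\<rho> (t - r))) (at t within UNIV)"
      proof (rule leibniz_rule_vector_derivative)
        show "((\<lambda>t. ?\<rho> (t - r)) has_vector_derivative partial 1 ?\<rho> (t - r)) (at t within UNIV)" for t r
        proof -
          have "((\<lambda>t. t - r) has_vector_derivative 1) (at t)" by (auto intro!: derivative_eq_intros)
          from vector_diff_chain_at[OF this d\<rho>] show ?thesis by (simp add: comp_def)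
        qed
        show "(\<lambda>r. ?\<rho> (t - r)) integrable_on cbox a b" for t
          by (intro integrable_continuous continuous_on_compose2[OF c\<rho>] continuous_intros) auto
        show "continuous_on (UNIV \<times> cbox a b) (\<lambda>(t, r). partial 1 ?\<rho> (t - r))"
          unfolding split_beta by (intro continuous_on_compose2[OF c\<rho>'] continuous_intros) auto
      qed auto
      moreover have "((\<lambda>r. partial 1 ?\<rho> (t - r)) has_integral (- ?\<rho> (t - b)) - (- ?\<rho> (t - a))) {a..b}"
      proof (rule fundamental_theorem_of_calculus[OF \<open>a \<le> b\<close>])
        fix r
        have "((\<lambda>r. t - r) has_vector_derivative -1) (at r)" by (auto intro!: derivative_eq_intros)
        from has_vector_derivative_minus[OF vector_diff_chain_at[OF this d\<rho>]]
        show "((\<lambda>r. - ?\<rho> (t - r)) has_vector_derivative partial 1 ?\<rho> (t - r)) (at r within {a..b})"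
          by (simp add: comp_def has_vector_derivative_at_within)
      qed
      ultimately show ?thesis
        by (simp add: \<xi>_def[abs_def] \<zeta>_def integral_unique)
    qed
    have "smooth \<xi>"
    proof -
      \<comment> \<open>\<open>\<xi>\<close> has the smooth derivative \<open>\<zeta>\<close>, so
        its further derivatives are those of \<open>\<zeta>\<close>.\<close>
      define g where "g j = (case j of 0 \<Rightarrow> \<xi> | Suc i \<Rightarrow> nderiv i \<zeta>)" for j
      have "(g j has_vector_derivative g (Suc j) x) (at x)" for j x
        by (cases j) (simp_all add: g_def d\<xi> smooth_nderiv_has_vector_derivative[OF s\<zeta>])
      from nderiv_sequenceI(2)[of g, OF this] show ?thesis by (simp add: g_def)
    qed
    moreover have "\<xi> t = 0" if "t \<notin> {a - d..b + d}" for t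
    proof -
      have "?\<rho> (t - r) = 0" if "r \<in> {a..b}" for r using \<open>t \<notin> _\<close> that by (intro bump_eq_0) auto
      then have "\<xi> t = integral {a..b} (\<lambda>r. 0)" unfolding \<xi>_def by (intro integral_cong) auto
      then show ?thesis by simp
    qed
    ultimately have "test_function \<xi>" by (intro test_functionI[of _ "{a - d..b + d}"]) auto
    from int[OF this] have z: "(LINT t|lborel. \<zeta> t *\<^sub>R m t) = 0" by (simp add: partial_eqI[OF d\<xi>])
    \<comment> \<open>Translation moves the bumps at \<open>a\<close> and \<open>b\<close> to the
      origin; the difference of the two integrals becomes the integral of the bump against
      \<open>q\<close>.\<close>
    have tr: "has_bochner_integral lborel (\<lambda>t. ?\<rho> (t - e) *\<^sub>R m t) (LINT s|lborel. ?\<rho> s *\<^sub>R m (e + s))" for e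
    proof -
      have "has_bochner_integral lborel (\<lambda>t. ?\<rho> (t - e) *\<^sub>R m t)
          (integral {e - d..e + d} (\<lambda>t. ?\<rho> (t - e) *\<^sub>R m t))"
        by (rule has_bochner_integral_compact_support)
           (auto intro!: continuous_intros continuous_on_compose2[OF c\<rho>] continuous_on_subset[OF m] bump_eq_0)
      then have i: "integrable lborel (\<lambda>t. ?\<rho> (t - e) *\<^sub>R m t)" by (rule integrable.intros)
      have "(LINT t|lborel. ?\<rho> (t - e) *\<^sub>R m t) = (LINT s|lborel. ?\<rho> s *\<^sub>R m (e + s))"
        using lborel_integral_real_affine[of 1 "\<lambda>t. ?\<rho> (t - e) *\<^sub>R m t" e] by simp
      with i show ?thesis by (simp add: has_bochner_integral_iff)
    qed
    have i\<rho>: "has_bochner_integral lborel (\<lambda>s. ?\<rho> s *\<^sub>R m (e + s)) (integral {-d..d} (\<lambda>s. ?\<rho> s *\<^sub>R m (e + s)))" for e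
      by (rule has_bochner_integral_compact_support)
         (auto intro!: continuous_intros c\<rho> continuous_on_compose2[OF m] bump_eq_0)
    have "has_bochner_integral lborel (\<lambda>s. ?\<rho> s *\<^sub>R q s)
        ((LINT s|lborel. ?\<rho> s *\<^sub>R m (a + s)) - (LINT s|lborel. ?\<rho> s *\<^sub>R m (b + s)))"
      using has_bochner_integral_diff[OF i\<rho>[of a] i\<rho>[of b]] i\<rho>[of a] i\<rho>[of b]
      by (simp add: q_def scaleR_diff_right has_bochner_integral_iff)
    moreover have "has_bochner_integral lborel (\<lambda>t. \<zeta> t *\<^sub>R m t)
        ((LINT s|lborel. ?\<rho> s *\<^sub>R m (a + s)) - (LINT s|lborel. ?\<rho> s *\<^sub>R m (b + s)))"
      using has_bochner_integral_diff[OF tr[of a] tr[of b]] by (simp add: \<zeta>_def scaleR_diff_left)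
    ultimately have "(LINT s|lborel. ?\<rho> s *\<^sub>R q s) = 0"
      using z by (simp add: has_bochner_integral_iff)
    moreover have "has_bochner_integral lborel (\<lambda>s. ?\<rho> s *\<^sub>R q s) (integral {-d..d} (\<lambda>s. ?\<rho> s *\<^sub>R q s))"
      by (rule has_bochner_integral_compact_support) (auto intro!: continuous_intros c\<rho> q bump_eq_0)
    ultimately have "integral {-d..d} (\<lambda>s. ?\<rho> s *\<^sub>R q s) = 0" by (simp add: has_bochner_integral_iff)
    moreover have "(\<lambda>s. ?\<rho> s *\<^sub>R q s) integrable_on {-d..d}"
      by (intro integrable_continuous_interval continuous_intros c\<rho> q)
    note has_integral_linear[OF integrable_integral[OF this] bounded_linear_inner_left[of "q 0"]]
    ultimately have "((\<lambda>s. (?\<rho> s *\<^sub>R q s) \<bullet> q 0) has_integral 0 \<bullet> q 0) {-d..d}"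
      by (simp add: comp_def)
    then have "integral {-d..d} (\<lambda>s. ?\<rho> s * (q s \<bullet> q 0)) = 0" by (simp add: integral_unique)
    moreover have "continuous_on {-d..d} (\<lambda>s. ?\<rho> s * (q s \<bullet> q 0))" by (intro continuous_intros c\<rho> q)
    moreover have "?\<rho> s * (q s \<bullet> q 0) \<ge> 0" for s
      using d(2)[of s] bump_nonneg[of d s] bump_eq_0[of d s] by (cases "\<bar>s\<bar> < d") auto
    \<comment> \<open>A continuous nonnegative function with integral 0 vanishes on the interval, in
      particular at 0, where this one is positive.\<close>
    ultimately have "?\<rho> 0 * (q 0 \<bullet> q 0) = 0"
      using integral_eq_0_iff[of "-d" d "\<lambda>s. ?\<rho> s * (q s \<bullet> q 0)"] d(1) by auto
    with q0 bump_pos[of 0 d] d(1) show False by simp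
  qed
qed simp

section \<open>Test functions of two variables\<close>

lemma has_vector_derivative_slice_fst:
  fixes F :: "real \<times> real \<Rightarrow> 'a::real_normed_vector"
  assumes "F differentiable (at (x, t))"
  shows "((\<lambda>x. F (x, t)) has_vector_derivative partial (1, 0) F (x, t)) (at x)"
proof -
  have F: "(F has_derivative frechet_derivative F (at (x, t))) (at (x, t))"
    using assms frechet_derivative_works by blast
  have "((\<lambda>x. (x, t)) has_vector_derivative (1, 0)) (at x)"
    unfolding has_vector_derivative_def by (auto intro!: derivative_eq_intros)
  from vector_derivative_diff_chain_within[OF this, of F "frechet_derivative F (at (x, t))"] F
  show ?thesis by (simp add: comp_def partial_def has_derivative_at_withinI)
qed

lemma has_vector_derivative_slice_snd:
  fixes F :: "real \<times> real \<Rightarrow> 'a::real_normed_vector"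
  assumes "F differentiable (at (x, t))"
  shows "((\<lambda>t. F (x, t)) has_vector_derivative partial (0, 1) F (x, t)) (at t)"
proof -
  have F: "(F has_derivative frechet_derivative F (at (x, t))) (at (x, t))"
    using assms frechet_derivative_works by blast
  have "((\<lambda>t. (x, t)) has_vector_derivative (0, 1)) (at t)"
    unfolding has_vector_derivative_def by (auto intro!: derivative_eq_intros)
  from vector_derivative_diff_chain_within[OF this, of F "frechet_derivative F (at (x, t))"] F
  show ?thesis by (simp add: comp_def partial_def has_derivative_at_withinI)
qed

lemma Basis_real_prod: "(Basis :: (real \<times> real) set) = {(1, 0), (0, 1)}"
  by (auto simp: Basis_prod_def)

text \<open>Every mixed derivative of a test function is again a test function, hence globally
  bounded, and the projection of the support is one compact set for all slices. This is what
  \<open>has_tderivI\<close> asks for.\<close>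

lemma test_function_slices:
  fixes F :: "real \<times> real \<Rightarrow> 'a::{real_normed_field, banach}"
  assumes F: "test_function F"
  shows "partial 1 (\<lambda>x. F (x, t)) = (\<lambda>x. partial (1, 0) F (x, t))"
    and "test_function (\<lambda>x. F (x, t))"
    and "has_tderiv (\<lambda>t x. F (x, t)) (\<lambda>t x. partial (0, 1) F (x, t))"
proof -
  define G where "G j = (partial (1, 0) ^^ j) F" for j
  have G: "test_function (G j)" for j
    by (induction j) (auto simp: G_def F Basis_real_prod intro: test_function_partial)
  have G_t: "test_function (partial (0, 1) (G j))" "test_function (partial (0, 1) (partial (0, 1) (G j)))" for j
    by (intro test_function_partial G; simp add: Basis_real_prod)+
  have step: "((\<lambda>x. G j (x, t)) has_vector_derivative G (Suc j) (x, t)) (at x)" for j x t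
    using has_vector_derivative_slice_fst[OF test_function_differentiable[OF G[of j]]] by (simp add: G_def)
  note nd = nderiv_sequenceI[of "\<lambda>j x. G j (x, t)" for t, OF step]
  show "partial 1 (\<lambda>x. F (x, t)) = (\<lambda>x. partial (1, 0) F (x, t))"
    using nd(1)[of 1 t] by (simp add: nderiv_Suc G_def)
  let ?K = "fst ` supp F"
  have K: "compact ?K"
    using F by (intro compact_continuous_image continuous_intros) (simp add: test_function_def)
  have K0: "F (x, t) = 0" if "x \<notin> ?K" for x t
    using that by (metis fst_conv image_eqI notin_supp)
  have t: "test_function (\<lambda>x. F (x, t))" for t
    using nd(2)[of t] by (intro test_functionI[OF _ K K0]) (simp add: G_def)
  then show "test_function (\<lambda>x. F (x, t))" .
  have "has_tderiv (\<lambda>t x. G 0 (x, t)) (\<lambda>t x. partial (0, 1) (G 0) (x, t))"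
  proof (rule has_tderivI[where F = "\<lambda>j t x. G j (x, t)" and G = "\<lambda>j t x. partial (0, 1) (G j) (x, t)"
        and H = "\<lambda>j t x. partial (0, 1) (partial (0, 1) (G j)) (x, t)"])
    show "test_function (\<lambda>x. G 0 (x, t))" for t using t by (simp add: G_def)
    show "nderiv j (\<lambda>x. G 0 (x, t)) = (\<lambda>x. G j (x, t))" for j t by (rule nd(1))
    show "\<exists>K. compact K \<and> (\<forall>t x. \<bar>t\<bar> \<le> R \<longrightarrow> x \<notin> K \<longrightarrow> G 0 (x, t) = 0)" for R
      using K K0 by (auto simp: G_def intro!: exI[of _ ?K])
    show "((\<lambda>t. G j (x, t)) has_vector_derivative partial (0, 1) (G j) (x, t)) (at t)" for j t x
      by (rule has_vector_derivative_slice_snd[OF test_function_differentiable[OF G]])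
    show "((\<lambda>t. partial (0, 1) (G j) (x, t)) has_vector_derivative
        partial (0, 1) (partial (0, 1) (G j)) (x, t)) (at t)" for j t x
      by (rule has_vector_derivative_slice_snd[OF test_function_differentiable[OF G_t(1)]])
    show "\<exists>C. \<forall>t x. \<bar>t\<bar> \<le> R \<longrightarrow> norm (partial (0, 1) (partial (0, 1) (G j)) (x, t)) \<le> C" for j R
      using test_function_bounded[OF G_t(2)[of j]] by metis
  qed
  then show "has_tderiv (\<lambda>t x. F (x, t)) (\<lambda>t x. partial (0, 1) F (x, t))" by (simp add: G_def)
qed

section \<open>Tensor products of a real factor in t and a test function in x\<close>

lemma tensor_has_derivative:
  fixes \<phi> :: "real \<Rightarrow> 'a::real_normed_vector" and \<xi> :: "real \<Rightarrow> real"
  assumes "test_function \<phi>" "test_function \<xi>"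
  shows "((\<lambda>p. \<xi> (snd p) *\<^sub>R \<phi> (fst p)) has_derivative
     (\<lambda>h. \<xi> (snd p) *\<^sub>R (fst h *\<^sub>R partial 1 \<phi> (fst p)) + (snd h * partial 1 \<xi> (snd p)) *\<^sub>R \<phi> (fst p))) (at p)"
proof (rule has_derivative_scaleR)
  show "((\<lambda>p. \<xi> (snd p)) has_derivative (\<lambda>h. snd h * partial 1 \<xi> (snd p))) (at p)"
    using has_derivative_compose[OF has_derivative_snd[OF has_derivative_ident], of \<xi> "\<lambda>h. h * partial 1 \<xi> (snd p)" p UNIV]
      test_function_has_vector_derivative[OF assms(2), of "snd p"]
    by (simp add: has_vector_derivative_def)
  show "((\<lambda>p. \<phi> (fst p)) has_derivative (\<lambda>h. fst h *\<^sub>R partial 1 \<phi> (fst p))) (at p)"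
    using has_derivative_compose[OF has_derivative_fst[OF has_derivative_ident], of \<phi> "\<lambda>h. h *\<^sub>R partial 1 \<phi> (fst p)" p UNIV]
      test_function_has_vector_derivative[OF assms(1), of "fst p"]
    by (simp add: has_vector_derivative_def)
qed

lemma partial_tensor:
  fixes \<phi> :: "real \<Rightarrow> 'a::real_normed_vector" and \<xi> :: "real \<Rightarrow> real"
  assumes "test_function \<phi>" "test_function \<xi>"
  shows "partial (1, 0) (\<lambda>p. \<xi> (snd p) *\<^sub>R \<phi> (fst p)) = (\<lambda>p. \<xi> (snd p) *\<^sub>R partial 1 \<phi> (fst p))"
    and "partial (0, 1) (\<lambda>p. \<xi> (snd p) *\<^sub>R \<phi> (fst p)) = (\<lambda>p. partial 1 \<xi> (snd p) *\<^sub>R \<phi> (fst p))"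
  unfolding partial_def[of "(_, _)"]
  by (simp_all add: frechet_derivative_at[OF tensor_has_derivative[OF assms], symmetric])

text \<open>A partial derivative of a tensor product is again one, with one factor differentiated.
  Induction on the list of directions thus writes every iterated partial derivative as a tensor
  product of test functions.\<close>

lemma test_function_tensor:
  fixes \<phi> :: "real \<Rightarrow> 'a::real_normed_vector" and \<xi> :: "real \<Rightarrow> real"
  assumes "test_function \<phi>" "test_function \<xi>"
  shows "test_function (\<lambda>p. \<xi> (snd p) *\<^sub>R \<phi> (fst p))"
proof (rule test_functionI)
  have "\<exists>\<phi>' \<xi>'. test_function \<phi>' \<and> test_function \<xi>' \<and>
      partials bs (\<lambda>p. \<xi> (snd p) *\<^sub>R \<phi> (fst p)) = (\<lambda>p. \<xi>' (snd p) *\<^sub>R \<phi>' (fst p))"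
    if "set bs \<subseteq> Basis" for bs :: "(real \<times> real) list"
    using that
  proof (induction bs)
    case Nil
    then show ?case using assms by (auto simp: partials_def)
  next
    case (Cons b bs)
    then obtain \<phi>' and \<xi>' :: "real \<Rightarrow> real" where t: "test_function \<phi>'" "test_function \<xi>'"
      and e: "partials bs (\<lambda>p. \<xi> (snd p) *\<^sub>R \<phi> (fst p)) = (\<lambda>p. \<xi>' (snd p) *\<^sub>R \<phi>' (fst p))" by auto
    have e': "partials (b # bs) (\<lambda>p. \<xi> (snd p) *\<^sub>R \<phi> (fst p)) = partial b (\<lambda>p. \<xi>' (snd p) *\<^sub>R \<phi>' (fst p))"
      using e by (simp add: partials_def)
    from Cons.prems consider "b = (1, 0)" | "b = (0, 1)" by (auto simp: Basis_real_prod)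
    then show ?case
    proof cases
      case 1
      then show ?thesis unfolding e' using t partial_tensor(1)[OF t] test_function_partial[OF t(1), of 1]
        by (intro exI[of _ "partial 1 \<phi>'"] exI[of _ \<xi>']) simp
    next
      case 2
      then show ?thesis unfolding e' using t partial_tensor(2)[OF t] test_function_partial[OF t(2), of 1]
        by (intro exI[of _ \<phi>'] exI[of _ "partial 1 \<xi>'"]) simp
    qed
  qed
  note * = this
  show "smooth (\<lambda>p. \<xi> (snd p) *\<^sub>R \<phi> (fst p))"
    unfolding smooth_def
  proof (intro allI impI)
    fix bs :: "(real \<times> real) list" and p assume "set bs \<subseteq> Basis"
    from *[OF this] obtain \<phi>' and \<xi>' :: "real \<Rightarrow> real" where t: "test_function \<phi>'" "test_function \<xi>'"
      and e: "partials bs (\<lambda>p. \<xi> (snd p) *\<^sub>R \<phi> (fst p)) = (\<lambda>p. \<xi>' (snd p) *\<^sub>R \<phi>' (fst p))" by blast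
    show "partials bs (\<lambda>p. \<xi> (snd p) *\<^sub>R \<phi> (fst p)) differentiable (at p)"
      unfolding e by (rule differentiableI[OF tensor_has_derivative[OF t]])
  qed
  show "compact (supp \<phi> \<times> supp \<xi>)" using assms by (auto simp: test_function_def intro: compact_Times)
  show "\<xi> (snd p) *\<^sub>R \<phi> (fst p) = 0" if "p \<notin> supp \<phi> \<times> supp \<xi>" for p
    using that notin_supp[of "fst p" \<phi>] notin_supp[of "snd p" \<xi>] by (auto simp: mem_Times_iff)
qed

section \<open>Weak and classical solutions of the damped wave equation\<close>

text \<open>The equation read pointwise in time. Two derivatives in x move to the test function, so
  no sign appears. The second use of \<open>C1_dist\<close> makes the product rule for pairings
  available for the velocity \<open>v\<close> as well.\<close>

definition classical_damped_wave ::
    "real \<Rightarrow> real \<Rightarrow> (real \<Rightarrow> (real \<Rightarrow> 'a::{real_normed_field, euclidean_space}) \<Rightarrow> 'a) \<Rightarrow>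
     (real \<Rightarrow> (real \<Rightarrow> 'a) \<Rightarrow> 'a) \<Rightarrow> bool" where
  "classical_damped_wave k c u v \<longleftrightarrow> C1_dist u v \<and>
     C1_dist v (\<lambda>t \<phi>. c\<^sup>2 *\<^sub>R u t (partial 1 (partial 1 \<phi>)) - k *\<^sub>R v t \<phi>)"

lemma test_function_partial_real: "test_function (\<phi> :: real \<Rightarrow> 'a::real_normed_vector) \<Longrightarrow> test_function (partial (1::real) \<phi>)"
  by (rule test_function_partial) simp_all

lemma C1_dist_distribution: "C1_dist u v \<Longrightarrow> distribution (u t)"
  by (simp add: C1_dist_def)

lemma continuous_on_pairing:
  assumes "C1_dist u v" "has_tderiv \<eta> \<eta>'"
  shows "continuous_on A (\<lambda>t. u t (\<eta> t))"
  using pairing_has_vector_derivative[OF assms] has_vector_derivative_continuous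
  by (metis continuous_at_imp_continuous_on)

text \<open>The tested expression \<open>r\<close> is the time derivative of \<open>m\<close>, that
  is, of u(\<phi>_t) - k u(\<phi>) - v(\<phi>): on differentiating, v(\<phi>_t) and k v(\<phi>)
  cancel, and the equation replaces the derivative of \<open>v\<close>. As \<open>m\<close> has
  compact support, the integral of \<open>r\<close> is 0.\<close>

lemma classical_imp_weak_damped_wave:
  assumes "classical_damped_wave k c u v"
  shows "weak_damped_wave k c u"
  unfolding weak_damped_wave_def
proof (intro allI impI)
  fix \<phi> :: "real \<times> real \<Rightarrow> 'a" assume \<phi>: "test_function \<phi>"
  have uv: "C1_dist u v" and v: "C1_dist v (\<lambda>t \<phi>. c\<^sup>2 *\<^sub>R u t (partial 1 (partial 1 \<phi>)) - k *\<^sub>R v t \<phi>)"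
    using assms by (simp_all add: classical_damped_wave_def)
  note du = C1_dist_distribution[OF uv] and dv = C1_dist_distribution[OF v]
  let ?t = "partial (0, 1) \<phi>" let ?tt = "partial (0, 1) ?t" let ?xx = "partial (1, 0) (partial (1, 0) \<phi>)"
  have tt: "test_function ?t" "test_function ?tt" "test_function (partial (1, 0) \<phi>)" "test_function ?xx"
    by (intro test_function_partial \<phi>; simp add: Basis_real_prod)+
  note c = test_function_slices(3)[OF \<phi>] test_function_slices(3)[OF tt(1)]
    test_function_slices(3)[OF tt(2)] test_function_slices(3)[OF tt(4)]
  note s = test_function_slices(2)[OF \<phi>] test_function_slices(2)[OF tt(1)]
    test_function_slices(2)[OF tt(2)] test_function_slices(2)[OF tt(4)]
  have xx: "partial 1 (partial 1 (\<lambda>x. \<phi> (x, t))) = (\<lambda>x. ?xx (x, t))" for t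
    by (simp add: test_function_slices(1)[OF \<phi>] test_function_slices(1)[OF tt(3)])
  define m where "m t = u t (\<lambda>x. ?t (x, t)) - k *\<^sub>R u t (\<lambda>x. \<phi> (x, t)) - v t (\<lambda>x. \<phi> (x, t))" for t
  define r where "r t = u t (\<lambda>x. ?tt (x, t)) - k *\<^sub>R u t (\<lambda>x. ?t (x, t)) - c\<^sup>2 *\<^sub>R u t (\<lambda>x. ?xx (x, t))" for t
  have r: "r t = u t (\<lambda>x. ?tt (x, t) - k *\<^sub>R ?t (x, t) - c\<^sup>2 *\<^sub>R ?xx (x, t))" for t
    unfolding r_def by (simp add: distribution_diff[OF du] distribution_scaleR[OF du] s
        test_function_diff test_function_scaleR)
  have dm: "(m has_vector_derivative r t) (at t)" for t
  proof -
    have "(m has_vector_derivative (v t (\<lambda>x. ?t (x, t)) + u t (\<lambda>x. ?tt (x, t)))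
        - k *\<^sub>R (v t (\<lambda>x. \<phi> (x, t)) + u t (\<lambda>x. ?t (x, t)))
        - ((c\<^sup>2 *\<^sub>R u t (partial 1 (partial 1 (\<lambda>x. \<phi> (x, t)))) - k *\<^sub>R v t (\<lambda>x. \<phi> (x, t)))
           + v t (\<lambda>x. ?t (x, t)))) (at t)"
      unfolding m_def[abs_def]
      by (intro has_vector_derivative_diff bounded_linear.has_vector_derivative[OF bounded_linear_scaleR_right]
          pairing_has_vector_derivative[OF uv c(2)] pairing_has_vector_derivative[OF uv c(1)]
          pairing_has_vector_derivative[OF v c(1)])
    then show ?thesis by (simp add: xx r_def algebra_simps)
  qed
  have cr: "continuous_on UNIV r"
    unfolding r_def[abs_def]
    by (intro continuous_intros continuous_on_pairing[OF uv c(3)] continuous_on_pairing[OF uv c(2)]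
        continuous_on_pairing[OF uv c(4)])
  obtain R where R: "\<And>x t. \<bar>t\<bar> > R \<Longrightarrow> (x, t) \<notin> supp \<phi>"
  proof -
    have "bounded (supp \<phi>)" using \<phi> compact_imp_bounded by (auto simp: test_function_def)
    then obtain R where R: "\<And>p. p \<in> supp \<phi> \<Longrightarrow> norm p \<le> R" using bounded_iff by blast
    have "(x, t) \<notin> supp \<phi>" if "\<bar>t\<bar> > R" for x t
    proof
      assume "(x, t) \<in> supp \<phi>"
      then have "norm (x, t) \<le> R" by (rule R)
      moreover have "norm t \<le> norm (x, t)" by (metis norm_snd_le)
      ultimately show False using that by simp
    qed
    with that show ?thesis by blast
  qed
  have z: "(\<lambda>x. \<phi> (x, t)) = (\<lambda>x. 0)" "(\<lambda>x. ?t (x, t)) = (\<lambda>x. 0)" "(\<lambda>x. ?tt (x, t)) = (\<lambda>x. 0)"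
      "(\<lambda>x. ?xx (x, t)) = (\<lambda>x. 0)" if "\<bar>t\<bar> > R" for t
  proof -
    have "supp (partial b \<phi>) \<subseteq> supp \<phi>" for b
      by (rule supp_subsetI) (auto simp: supp_def[of \<phi>] partial_supp_zero[unfolded supp_def])
    then show "(\<lambda>x. \<phi> (x, t)) = (\<lambda>x. 0)" "(\<lambda>x. ?t (x, t)) = (\<lambda>x. 0)" "(\<lambda>x. ?tt (x, t)) = (\<lambda>x. 0)"
      "(\<lambda>x. ?xx (x, t)) = (\<lambda>x. 0)"
      using R[OF that] by (auto simp: fun_eq_iff notin_supp intro!: partial_supp_zero)
  qed
  then have z0: "m t = 0" "r t = 0" if "\<bar>t\<bar> > R" for t
    using that by (simp_all add: m_def r_def distribution_zero[OF du] distribution_zero[OF dv])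
  have "has_bochner_integral lborel r 0"
    by (rule has_bochner_integral_derivative_compact_support[OF dm cr z0])
  then show "has_bochner_integral lborel (\<lambda>t. u t (\<lambda>x. ?tt (x, t) - k *\<^sub>R ?t (x, t) - c\<^sup>2 *\<^sub>R ?xx (x, t))) 0"
    by (simp only: r[symmetric])
qed

section \<open>From the weak to the classical equation\<close>

lemma test_converges_partial:
  fixes \<phi> :: "real \<Rightarrow> 'a::{real_normed_field, banach}"
  assumes "test_converges \<Phi> \<phi>"
  shows "test_converges (\<lambda>n. partial 1 (\<Phi> n)) (partial 1 \<phi>)"
proof -
  obtain K where K: "compact K" "\<And>n x. x \<notin> K \<Longrightarrow> \<Phi> n x = 0"
    using assms unfolding test_converges_real_iff by meson
  have K': "partial 1 (\<Phi> n) x = 0" if "x \<notin> K" for n x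
    using supp_subsetI[of K "\<Phi> n"] K compact_imp_closed that by (intro partial_supp_zero) auto
  show ?thesis
    using assms K(1) K' unfolding test_converges_real_iff
    by (auto simp: nderiv_partial test_function_partial_real)
qed

lemma distribution_wave_rhs:
  assumes f: "distribution f" and g: "distribution g"
  shows "distribution (\<lambda>\<phi> :: real \<Rightarrow> 'a::{real_normed_field, euclidean_space}.
           a *\<^sub>R f (partial 1 (partial 1 \<phi>)) - b *\<^sub>R g \<phi>)"
  unfolding distribution_def
proof (intro conjI allI impI)
  fix \<phi> \<eta> :: "real \<Rightarrow> 'a" and p q assume t: "test_function \<phi>" "test_function \<eta>"
  have "nderiv 2 (\<lambda>x. p * \<phi> x + q * \<eta> x) = (\<lambda>x. p * nderiv 2 \<phi> x + q * nderiv 2 \<eta> x)"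
    using t by (intro smooth_lincomb) (simp_all add: test_function_def)
  then show "a *\<^sub>R f (partial 1 (partial 1 (\<lambda>x. p * \<phi> x + q * \<eta> x))) - b *\<^sub>R g (\<lambda>x. p * \<phi> x + q * \<eta> x) =
    p * (a *\<^sub>R f (partial 1 (partial 1 \<phi>)) - b *\<^sub>R g \<phi>) + q * (a *\<^sub>R f (partial 1 (partial 1 \<eta>)) - b *\<^sub>R g \<eta>)"
    using t by (simp add: nderiv_Suc numeral_2_eq_2 distribution_lincomb[OF f] distribution_lincomb[OF g]
        test_function_partial_real algebra_simps)
next
  fix \<Phi> and \<phi> :: "real \<Rightarrow> 'a" assume c: "test_converges \<Phi> \<phi>"
  show "(\<lambda>n. a *\<^sub>R f (partial 1 (partial 1 (\<Phi> n))) - b *\<^sub>R g (\<Phi> n)) \<longlonglongrightarrow>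
      a *\<^sub>R f (partial 1 (partial 1 \<phi>)) - b *\<^sub>R g \<phi>"
    by (rule tendsto_diff[OF tendsto_scaleR[OF tendsto_const distribution_tendsto[OF f]]
          tendsto_scaleR[OF tendsto_const distribution_tendsto[OF g c]]])
       (intro test_converges_partial c)
qed

lemma continuous_imp_antiderivative:
  fixes q :: "real \<Rightarrow> 'a::euclidean_space"
  assumes "continuous_on UNIV q"
  obtains Q where "\<And>t. (Q has_vector_derivative q t) (at t)"
proof
  fix t :: real
  \<comment> \<open>The interval contains the base point 0 and has \<open>t\<close> in its interior,
    so the derivative within it is the full derivative.\<close>
  have "((\<lambda>t. LBINT y=0..t. q y) has_vector_derivative q t) (at t within {- \<bar>t\<bar> - 1..\<bar>t\<bar> + 1})"
    using interval_integral_FTC2[of "- \<bar>t\<bar> - 1" 0 "\<bar>t\<bar> + 1" q t] continuous_on_subset[OF assms]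
    by (simp add: zero_ereal_def)
  moreover have "at t within {- \<bar>t\<bar> - 1..\<bar>t\<bar> + 1} = at t" by (rule at_within_interior) auto
  ultimately show "((\<lambda>t. LBINT y=0..t. q y) has_vector_derivative q t) (at t)" by simp
qed

text \<open>No second time derivative is available yet, so the spatial term is hidden in an
  antiderivative \<open>Q\<close> of u(\<phi>_xx). The weak equation for a tensor product then says
  that \<open>m\<close>, which is v + k u - c^2 Q, integrates to 0 against every derivative of a
  test function. So \<open>m\<close> is constant, and solving for \<open>v\<close> shows it to be
  differentiable with the derivative that the equation prescribes.\<close>

lemma weak_imp_classical_damped_wave:
  assumes uv: "C1_dist u v" and weak: "weak_damped_wave k c u"
  shows "classical_damped_wave k c u v"
proof -
  have d: "distribution (u t)" "distribution (v t)" for t using uv by (simp_all add: C1_dist_def)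
  have main: "((\<lambda>s. v s \<phi>) has_vector_derivative c\<^sup>2 *\<^sub>R u t (partial 1 (partial 1 \<phi>)) - k *\<^sub>R v t \<phi>) (at t)"
    if \<phi>: "test_function \<phi>" for \<phi> t
  proof -
    let ?q = "\<lambda>t. u t (partial 1 (partial 1 \<phi>))"
    have \<phi>2: "test_function (partial 1 (partial 1 \<phi>))" by (intro test_function_partial_real \<phi>)
    have du: "((\<lambda>s. u s \<psi>) has_vector_derivative v t \<psi>) (at t)" if "test_function \<psi>" for \<psi> t
      using uv that by (simp add: C1_dist_iff)
    have cu: "continuous_on A (\<lambda>t. u t \<psi>)" if "test_function \<psi>" for A \<psi>
      using du[OF that] has_vector_derivative_continuous by (metis continuous_at_imp_continuous_on)
    have cv: "continuous_on A (\<lambda>t. v t \<phi>)" for A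
      using uv \<phi> by (simp add: C1_dist_iff continuous_at_imp_continuous_on)
    obtain Q where Q: "\<And>t. (Q has_vector_derivative ?q t) (at t)"
      using continuous_imp_antiderivative[OF cu[OF \<phi>2]] by blast
    have cQ: "continuous_on A Q" for A
      using Q has_vector_derivative_continuous by (metis continuous_at_imp_continuous_on)
    define m where "m t = v t \<phi> + k *\<^sub>R u t \<phi> - c\<^sup>2 *\<^sub>R Q t" for t
    have m: "m a = m b" for a b
    proof (rule du_Bois_Reymond)
      show "continuous_on UNIV m" unfolding m_def[abs_def] by (intro continuous_intros cv cu[OF \<phi>] cQ)
      fix \<xi> :: "real \<Rightarrow> real" assume \<xi>: "test_function \<xi>"
      let ?d = "partial 1 \<xi>" let ?dd = "partial 1 ?d"
      have td: "test_function ?d" "test_function ?dd" by (intro test_function_partial_real \<xi>)+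
      have cd: "continuous_on A \<xi>" "continuous_on A ?d" "continuous_on A ?dd" for A
        by (intro test_function_continuous \<xi> td)+
      define w where "w t = ?dd t *\<^sub>R u t \<phi> - k *\<^sub>R (?d t *\<^sub>R u t \<phi>) - c\<^sup>2 *\<^sub>R (\<xi> t *\<^sub>R ?q t)" for t
      have w0: "has_bochner_integral lborel w 0"
      proof -
        let ?F = "\<lambda>p. \<xi> (snd p) *\<^sub>R \<phi> (fst p)"
        note F = partial_tensor[OF \<phi> \<xi>] partial_tensor(2)[OF \<phi> td(1)]
          partial_tensor(1)[OF test_function_partial_real[OF \<phi>] \<xi>]
        have "has_bochner_integral lborel
          (\<lambda>t. u t (\<lambda>x. partial (0, 1) (partial (0, 1) ?F) (x, t)
                        - k *\<^sub>R partial (0, 1) ?F (x, t)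
                        - c\<^sup>2 *\<^sub>R partial (1, 0) (partial (1, 0) ?F) (x, t))) 0"
          using weak test_function_tensor[OF \<phi> \<xi>] unfolding weak_damped_wave_def by blast
        moreover have "w t = u t (\<lambda>x. partial (0, 1) (partial (0, 1) ?F) (x, t)
                        - k *\<^sub>R partial (0, 1) ?F (x, t)
                        - c\<^sup>2 *\<^sub>R partial (1, 0) (partial (1, 0) ?F) (x, t))" for t
          unfolding F w_def
          by (simp add: distribution_diff[OF d(1)] distribution_scaleR[OF d(1)] \<phi> \<phi>2
              test_function_diff test_function_scaleR del: scaleR_scaleR)
        ultimately show ?thesis by presburger
      qed
      obtain R where R: "\<And>t. \<bar>t\<bar> > R \<Longrightarrow> \<xi> t = 0" "\<And>t. \<bar>t\<bar> > R \<Longrightarrow> ?d t = 0" "\<And>t. \<bar>t\<bar> > R \<Longrightarrow> ?dd t = 0"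
      proof -
        obtain R1 where "\<And>t. \<bar>t\<bar> > R1 \<Longrightarrow> \<xi> t = 0" using test_function_bounded_support[OF \<xi>] by blast
        moreover obtain R2 where "\<And>t. \<bar>t\<bar> > R2 \<Longrightarrow> ?d t = 0" using test_function_bounded_support[OF td(1)] by blast
        moreover obtain R3 where "\<And>t. \<bar>t\<bar> > R3 \<Longrightarrow> ?dd t = 0" using test_function_bounded_support[OF td(2)] by blast
        ultimately show ?thesis by (intro that[of "max R1 (max R2 R3)"]) auto
      qed
      \<comment> \<open>Chosen such that \<open>F'\<close> minus the weak integrand \<open>w\<close>
        is exactly \<open>m\<close> times the derivative of \<open>\<xi>\<close>. Both
        \<open>F'\<close> and \<open>w\<close> have integral 0, hence so has that product.\<close>
      define F where "F t = ?d t *\<^sub>R u t \<phi> - c\<^sup>2 *\<^sub>R (\<xi> t *\<^sub>R Q t)" for t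
      define F' where "F' t = (?d t *\<^sub>R v t \<phi> + ?dd t *\<^sub>R u t \<phi>) - c\<^sup>2 *\<^sub>R (\<xi> t *\<^sub>R ?q t + ?d t *\<^sub>R Q t)" for t
      have d\<xi>: "(\<xi> has_real_derivative ?d t) (at t)" "(?d has_real_derivative ?dd t) (at t)" for t
        unfolding has_real_derivative_iff_has_vector_derivative
        by (intro test_function_has_vector_derivative \<xi> td)+
      have "has_bochner_integral lborel F' 0"
      proof (rule has_bochner_integral_derivative_compact_support[where R = R])
        show "(F has_vector_derivative F' t) (at t)" for t
          unfolding F_def[abs_def] F'_def
          by (intro has_vector_derivative_diff bounded_linear.has_vector_derivative[OF bounded_linear_scaleR_right]
              has_vector_derivative_scaleR d\<xi> Q du[OF \<phi>])
        show "continuous_on UNIV F'"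
          unfolding F'_def[abs_def] by (intro continuous_intros cd cQ cv cu[OF \<phi>] cu[OF \<phi>2])
      qed (simp_all add: F_def F'_def R)
      from has_bochner_integral_diff[OF this w0]
      have "has_bochner_integral lborel (\<lambda>t. ?d t *\<^sub>R m t) 0"
        by (simp add: F'_def w_def m_def algebra_simps)
      then show "(LINT t|lborel. ?d t *\<^sub>R m t) = 0" by (rule has_bochner_integral_integral_eq)
    qed
    have "(\<lambda>s. v s \<phi>) = (\<lambda>s. m 0 - k *\<^sub>R u s \<phi> + c\<^sup>2 *\<^sub>R Q s)"
      using m[of _ 0] by (auto simp: m_def fun_eq_iff algebra_simps)
    moreover have "((\<lambda>s. m 0 - k *\<^sub>R u s \<phi> + c\<^sup>2 *\<^sub>R Q s) has_vector_derivative 0 - k *\<^sub>R v t \<phi> + c\<^sup>2 *\<^sub>R ?q t) (at t)"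
      by (intro has_vector_derivative_diff has_vector_derivative_add has_vector_derivative_const
          bounded_linear.has_vector_derivative[OF bounded_linear_scaleR_right] Q du[OF \<phi>])
    ultimately show ?thesis by simp
  qed
  have "isCont (\<lambda>s. c\<^sup>2 *\<^sub>R u s (partial 1 (partial 1 \<phi>)) - k *\<^sub>R v s \<phi>) t" if \<phi>: "test_function \<phi>" for \<phi> t
  proof -
    have "isCont (\<lambda>s. u s (partial 1 (partial 1 \<phi>))) t"
      by (rule has_vector_derivative_continuous[of _ "v t (partial 1 (partial 1 \<phi>))"])
         (use uv \<phi> in \<open>simp add: C1_dist_iff test_function_partial_real\<close>)
    moreover have "isCont (\<lambda>s. v s \<phi>) t" using uv \<phi> by (simp add: C1_dist_iff)
    ultimately show ?thesis by (intro continuous_intros)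
  qed
  with main uv d show ?thesis
    by (simp add: classical_damped_wave_def C1_dist_iff distribution_wave_rhs)
qed

section \<open>The series of the Bessel kernel\<close>

text \<open>For r \<ge> 0 this is I0(2 sqrt r), without the square root and so smooth where the
  radicand vanishes. In this variable the modified Bessel equation z^2 I'' + z I' = z^2 I becomes r
  E'' + E' = E.\<close>

definition bessel_entire :: "real \<Rightarrow> real" where
  "bessel_entire r = (\<Sum>n. (1 / (fact n)\<^sup>2) * r ^ n)"

definition bessel_entire' :: "real \<Rightarrow> real" where
  "bessel_entire' r = (\<Sum>n. diffs (\<lambda>n. 1 / (fact n)\<^sup>2) n * r ^ n)"

definition bessel_entire'' :: "real \<Rightarrow> real" where
  "bessel_entire'' r = (\<Sum>n. diffs (diffs (\<lambda>n. 1 / (fact n)\<^sup>2)) n * r ^ n)"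

lemma summable_bessel_entire: "summable (\<lambda>n. (1 / (fact n)\<^sup>2) * r ^ n :: real)"
proof (rule summable_comparison_test'[OF summable_exp[of "\<bar>r\<bar>"]])
  fix n
  have "fact n * 1 \<le> fact n * (fact n :: real)" by (intro mult_left_mono) auto
  then have "1 / (fact n)\<^sup>2 \<le> inverse (fact n :: real)"
    by (simp add: power2_eq_square inverse_eq_divide frac_le)
  then show "norm ((1 / (fact n)\<^sup>2) * r ^ n :: real) \<le> inverse (fact n) * \<bar>r\<bar> ^ n"
    using mult_right_mono[of "1 / (fact n)\<^sup>2" "inverse (fact n)" "\<bar>r\<bar> ^ n"] by (simp add: abs_mult power_abs)
qed

lemma bessel_entire_deriv: "(bessel_entire has_real_derivative bessel_entire' r) (at r)"
  unfolding bessel_entire_def[abs_def] bessel_entire'_def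
  by (rule termdiffs_strong_converges_everywhere[OF summable_bessel_entire])

lemma summable_bessel_entire': "summable (\<lambda>n. diffs (\<lambda>n. 1 / (fact n)\<^sup>2) n * r ^ n :: real)"
  by (rule termdiff_converges_all[OF summable_bessel_entire])

lemma bessel_entire'_deriv: "(bessel_entire' has_real_derivative bessel_entire'' r) (at r)"
  unfolding bessel_entire'_def[abs_def] bessel_entire''_def
  by (rule termdiffs_strong_converges_everywhere[OF summable_bessel_entire'])

lemma bessel_entire_0: "bessel_entire 0 = 1"
  using powser_zero[of "\<lambda>n. 1 / (fact n)\<^sup>2 :: real"] by (simp add: bessel_entire_def)

text \<open>\<open>r E'(r) = \<Sum> n a\<^sub>n r\<^sup>n\<close>, and differentiating this reproduces the coefficients \<open>a\<^sub>n = 1 / (n!)\<^sup>2\<close>.\<close>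

lemma bessel_entire_ode: "bessel_entire' r + r * bessel_entire'' r = bessel_entire r"
proof -
  define b where "b n = real n * (1 / (fact n)\<^sup>2)" for n
  have Suc: "b (Suc n) * x ^ Suc n = x * (diffs (\<lambda>n. 1 / (fact n)\<^sup>2) n * x ^ n)" for n x
    by (simp add: b_def diffs_def)
  have sb: "summable (\<lambda>n. b n * x ^ n)" for x
    using summable_mult[OF summable_bessel_entire', of x x] unfolding Suc[symmetric]
    by (rule summable_Suc_iff[of "\<lambda>n. b n * x ^ n", THEN iffD1])
  have "(\<Sum>n. b n * x ^ n) = x * bessel_entire' x" for x
    using suminf_split_head[OF sb[of x]] suminf_mult[OF summable_bessel_entire', of x x]
    unfolding Suc by (simp add: b_def bessel_entire'_def)
  moreover have "diffs b = (\<lambda>n. 1 / (fact n)\<^sup>2)"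
    by (auto simp: diffs_def b_def fun_eq_iff power2_eq_square field_simps simp del: of_nat_Suc)
  ultimately have "((\<lambda>x. x * bessel_entire' x) has_real_derivative bessel_entire r) (at r)"
    using termdiffs_strong_converges_everywhere[OF sb, of r] by (simp add: bessel_entire_def)
  moreover have "((\<lambda>x. x * bessel_entire' x) has_real_derivative bessel_entire' r + r * bessel_entire'' r) (at r)"
    by (auto intro!: derivative_eq_intros bessel_entire'_deriv)
  ultimately show ?thesis by (rule DERIV_unique[rotated])
qed

lemma continuous_on_bessel_entire [continuous_intros]:
  assumes "continuous_on A f"
  shows "continuous_on A (\<lambda>x. bessel_entire (f x))" "continuous_on A (\<lambda>x. bessel_entire' (f x))"
  using continuous_on_compose2[OF DERIV_continuous_on[of UNIV] assms] bessel_entire_deriv bessel_entire'_deriv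
  by blast+

lemma bessel_I0_eq: "bessel_I0 z = bessel_entire (z\<^sup>2 / 4)"
proof -
  have "(z / 2) ^ (2 * m) = (z\<^sup>2 / 4) ^ m" for m
    by (simp only: power_mult) (simp add: power_divide)
  then show ?thesis by (simp add: bessel_I0_def bessel_entire_def)
qed

lemma deriv_bessel_I0: "deriv bessel_I0 z = bessel_entire' (z\<^sup>2 / 4) * (z / 2)"
proof (rule DERIV_imp_deriv)
  have "((\<lambda>z. bessel_entire (z\<^sup>2 / 4)) has_real_derivative bessel_entire' (z\<^sup>2 / 4) * (z / 2)) (at z)"
    by (rule DERIV_chain2[OF bessel_entire_deriv]) (auto intro!: derivative_eq_intros)
  then show "(bessel_I0 has_real_derivative bessel_entire' (z\<^sup>2 / 4) * (z / 2)) (at z)"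
    by (simp add: bessel_I0_eq[abs_def])
qed

lemma bessel_entire'_0: "bessel_entire' 0 = 1"
  using powser_zero[of "diffs (\<lambda>n. 1 / (fact n)\<^sup>2 :: real)"] by (simp add: bessel_entire'_def diffs_def)

text \<open>As E'(0) = 1, the value that \<open>bessel_quot\<close> prescribes at 0 is that of the
  same analytic expression, and the case distinction disappears.\<close>

lemma bessel_quot_eq: "bessel_quot a z = a * bessel_entire' ((a * z)\<^sup>2)"
  by (simp add: bessel_quot_def deriv_bessel_I0 bessel_entire'_0 power_mult_distrib)

section \<open>Weighted averages\<close>

text \<open>Convolution after the substitution y = e s, with the Jacobian absorbed in
  \<open>q\<close>. With \<open>e = c * t\<close>, time sits in the kernel and in the argument of
  \<open>\<phi>\<close>, not in the domain of integration.\<close>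

definition avg :: "(real \<Rightarrow> real) \<Rightarrow> real \<Rightarrow> (real \<Rightarrow> 'a::euclidean_space) \<Rightarrow> real \<Rightarrow> 'a" where
  "avg q e \<phi> x = integral {-1..1} (\<lambda>s. q s *\<^sub>R \<phi> (x - e * s))"

lemma avg_integrable:
  fixes \<phi> :: "real \<Rightarrow> 'a::euclidean_space"
  assumes "continuous_on {-1..1} q" "test_function \<phi>"
  shows "(\<lambda>s. q s *\<^sub>R \<phi> (x - e * s)) integrable_on {-1..1}"
  by (intro integrable_continuous_interval continuous_intros assms(1)
      continuous_on_compose2[OF test_function_continuous[OF assms(2), of UNIV]]) auto

lemma avg_has_vector_derivative:
  assumes q: "continuous_on {-1..1} q" and \<phi>: "test_function \<phi>"
  shows "(avg q e \<phi> has_vector_derivative avg q e (partial 1 \<phi>) x) (at x)"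
proof -
  have "((\<lambda>x. integral (cbox (-1) 1) (\<lambda>s. q s *\<^sub>R \<phi> (x - e * s))) has_vector_derivative
      integral (cbox (-1) 1) (\<lambda>s. q s *\<^sub>R partial 1 \<phi> (x - e * s))) (at x within UNIV)"
  proof (rule leibniz_rule_vector_derivative)
    show "((\<lambda>x. q s *\<^sub>R \<phi> (x - e * s)) has_vector_derivative q s *\<^sub>R partial 1 \<phi> (x - e * s)) (at x within UNIV)" for x s
    proof -
      have "((\<lambda>x. x - e * s) has_vector_derivative 1) (at x)" by (auto intro!: derivative_eq_intros)
      from bounded_linear.has_vector_derivative[OF bounded_linear_scaleR_right[of "q s"]
          vector_diff_chain_at[OF this test_function_has_vector_derivative[OF \<phi>]]]
      show ?thesis by (simp add: comp_def)
    qed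
    show "(\<lambda>s. q s *\<^sub>R \<phi> (x - e * s)) integrable_on cbox (-1) 1" for x
      using avg_integrable[OF q \<phi>] by simp
    have "continuous_on (UNIV \<times> cbox (-1) 1) (\<lambda>p. q (snd p) *\<^sub>R partial 1 \<phi> (fst p - e * snd p))"
      by (intro continuous_intros continuous_on_compose2[OF q]
          continuous_on_compose2[OF test_function_continuous[OF test_function_partial_real[OF \<phi>], of UNIV]]) auto
    then show "continuous_on (UNIV \<times> cbox (-1) 1) (\<lambda>(x, s). q s *\<^sub>R partial 1 \<phi> (x - e * s))"
      by (simp add: split_beta)
  qed auto
  then show ?thesis by (simp add: avg_def[abs_def])
qed

lemma avg_eq_0:
  assumes "\<And>x. \<bar>x\<bar> > R \<Longrightarrow> \<phi> x = 0" "\<bar>x\<bar> > R + \<bar>e\<bar>"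
  shows "avg q e \<phi> x = 0"
proof -
  have "\<phi> (x - e * s) = 0" if "s \<in> {-1..1}" for s
  proof (rule assms(1))
    have "\<bar>e * s\<bar> \<le> \<bar>e\<bar> * 1" unfolding abs_mult using that by (intro mult_left_mono) auto
    then show "\<bar>x - e * s\<bar> > R" using assms(2) by linarith
  qed
  then have "avg q e \<phi> x = integral {-1..1} (\<lambda>s::real. 0)" unfolding avg_def by (intro integral_cong) auto
  then show ?thesis by simp
qed

lemma
  assumes q: "continuous_on {-1..1} q" and \<phi>: "test_function \<phi>"
  shows nderiv_avg: "nderiv j (avg q e \<phi>) = avg q e (nderiv j \<phi>)"
    and test_function_avg: "test_function (avg q e \<phi>)"
proof -
  have *: "(avg q e (nderiv j \<phi>) has_vector_derivative avg q e (nderiv (Suc j) \<phi>) x) (at x)" for j x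
    using avg_has_vector_derivative[OF q test_function_nderiv[OF \<phi>]] by (simp add: nderiv_Suc)
  note nd = nderiv_sequenceI[of "\<lambda>j. avg q e (nderiv j \<phi>)", OF *]
  show "nderiv j (avg q e \<phi>) = avg q e (nderiv j \<phi>)" using nd(1) by simp
  obtain R where "\<And>x. \<bar>x\<bar> > R \<Longrightarrow> \<phi> x = 0" using test_function_bounded_support[OF \<phi>] by blast
  then have "avg q e \<phi> x = 0" if "x \<notin> {- (R + \<bar>e\<bar>)..R + \<bar>e\<bar>}" for x
    using avg_eq_0[of R \<phi> e x q] that by fastforce
  then show "test_function (avg q e \<phi>)"
    using nd(2) by (intro test_functionI[of _ "{- (R + \<bar>e\<bar>)..R + \<bar>e\<bar>}"]) auto
qed

lemma avg_bound:
  assumes "continuous_on {-1..1} q" "test_function \<phi>"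
    and "\<And>s. s \<in> {-1..1} \<Longrightarrow> \<bar>q s\<bar> \<le> K" "\<And>x. norm (\<phi> x) \<le> C"
  shows "norm (avg q e \<phi> x) \<le> 2 * K * C"
proof -
  have "K \<ge> 0" using assms(3)[of 0] by simp
  have "norm (avg q e \<phi> x) \<le> K * C * (1 - (-1))"
    unfolding avg_def
  proof (rule integral_bound)
    show "continuous_on {-1..1} (\<lambda>s. q s *\<^sub>R \<phi> (x - e * s))"
      by (intro continuous_intros assms(1)
          continuous_on_compose2[OF test_function_continuous[OF assms(2), of UNIV]]) auto
    show "norm (q s *\<^sub>R \<phi> (x - e * s)) \<le> K * C" if "s \<in> {-1..1}" for s
      using assms(3)[OF that] assms(4) \<open>K \<ge> 0\<close> by (simp add: mult_mono)
  qed simp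
  then show ?thesis by simp
qed

lemma avg_lincomb:
  fixes \<phi> \<psi> :: "real \<Rightarrow> 'a::{real_normed_field, euclidean_space}"
  assumes q: "continuous_on {-1..1} q" and t: "test_function \<phi>" "test_function \<psi>"
  shows "avg q e (\<lambda>x. a * \<phi> x + b * \<psi> x) x = a * avg q e \<phi> x + b * avg q e \<psi> x"
proof -
  note i = avg_integrable[OF q t(1), of x e] avg_integrable[OF q t(2), of x e]
  have "((\<lambda>s. a * (q s *\<^sub>R \<phi> (x - e * s)) + b * (q s *\<^sub>R \<psi> (x - e * s))) has_integral
      a * avg q e \<phi> x + b * avg q e \<psi> x) {-1..1}"
    unfolding avg_def by (intro has_integral_add has_integral_mult_right integrable_integral i)
  then show ?thesis
    unfolding avg_def by (intro integral_unique) (simp add: scaleR_add_right)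
qed

lemma avg_kernel_add:
  assumes "continuous_on {-1..1} p" "continuous_on {-1..1} q" "test_function \<phi>"
  shows "avg (\<lambda>s. p s + q s) e \<phi> x = avg p e \<phi> x + avg q e \<phi> x"
  unfolding avg_def scaleR_add_left
  using assms by (intro integral_add avg_integrable)

lemma avg_kernel_scale: "avg (\<lambda>s. a * q s) e \<phi> x = a *\<^sub>R avg q e \<phi> x"
  unfolding avg_def by (simp flip: scaleR_scaleR)

text \<open>The s-derivative of \<phi>(x - e s) produces a factor -e. Keeping \<open>e\<close> in
  the kernel on the left avoids division by it, so that \<open>e = 0\<close> is covered.\<close>

lemma avg_by_parts:
  assumes q: "\<And>s. (q has_real_derivative q' s) (at s)" and q': "continuous_on {-1..1} q'"
    and \<phi>: "test_function \<phi>"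
  shows "avg (\<lambda>s. e * q s) e (partial 1 \<phi>) x = q (-1) *\<^sub>R \<phi> (x + e) - q 1 *\<^sub>R \<phi> (x - e) + avg q' e \<phi> x"
proof -
  have cq: "continuous_on A q" for A
    by (rule DERIV_continuous_on[OF has_field_derivative_at_within[OF q]])
  have "((\<lambda>s. q s *\<^sub>R \<phi> (x - e * s)) has_vector_derivative
      q s *\<^sub>R (- e *\<^sub>R partial 1 \<phi> (x - e * s)) + q' s *\<^sub>R \<phi> (x - e * s)) (at s)" for s
  proof -
    have "((\<lambda>s. x - e * s) has_vector_derivative - e) (at s)"
      unfolding has_real_derivative_iff_has_vector_derivative[symmetric] by (auto intro!: derivative_eq_intros)
    from has_vector_derivative_scaleR[OF q vector_diff_chain_at[OF this test_function_has_vector_derivative[OF \<phi>]]]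
    show ?thesis by (simp add: comp_def)
  qed
  then have "((\<lambda>s. q s *\<^sub>R (- e *\<^sub>R partial 1 \<phi> (x - e * s)) + q' s *\<^sub>R \<phi> (x - e * s)) has_integral
      q 1 *\<^sub>R \<phi> (x - e * 1) - q (-1) *\<^sub>R \<phi> (x - e * (-1))) {-1..1}"
    by (intro fundamental_theorem_of_calculus) (auto intro: has_vector_derivative_at_within)
  moreover have "((\<lambda>s. q' s *\<^sub>R \<phi> (x - e * s) - (e * q s) *\<^sub>R partial 1 \<phi> (x - e * s)) has_integral
      avg q' e \<phi> x - avg (\<lambda>s. e * q s) e (partial 1 \<phi>) x) {-1..1}"
    unfolding avg_def
    by (intro has_integral_diff integrable_integral avg_integrable q' \<phi> test_function_partial_real continuous_intros cq)
  ultimately have "q 1 *\<^sub>R \<phi> (x - e) - q (-1) *\<^sub>R \<phi> (x + e) =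
      avg q' e \<phi> x - avg (\<lambda>s. e * q s) e (partial 1 \<phi>) x"
    by (intro has_integral_unique) (simp_all add: algebra_simps)
  then show ?thesis by (simp add: algebra_simps)
qed

text \<open>Leibniz's rule for the two places where \<open>t\<close> occurs: the kernel, and the
  argument x - c t s, whose inner derivative is -c s. The resulting term with \<phi>' is left to
  \<open>avg_by_parts\<close>.\<close>

lemma avg_time_derivative:
  assumes Q: "\<And>t s. ((\<lambda>t. Q t s) has_real_derivative Q' t s) (at t)"
    and cQ: "continuous_on UNIV (\<lambda>(t, s). Q t s)" and cQ': "continuous_on UNIV (\<lambda>(t, s). Q' t s)"
    and \<phi>: "test_function \<phi>"
  shows "((\<lambda>t. avg (Q t) (c * t) \<phi> x) has_vector_derivative
     avg (Q' t) (c * t) \<phi> x + avg (\<lambda>s. (- c * s) * Q t s) (c * t) (partial 1 \<phi>) x) (at t)"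
proof -
  have c1: "continuous_on A (\<lambda>p. Q (f p) (g p))" "continuous_on A (\<lambda>p. Q' (f p) (g p))"
    if "continuous_on A f" "continuous_on A g" for A :: "'z::topological_space set" and f g
    using continuous_on_compose2[OF cQ continuous_on_Pair[OF that]]
      continuous_on_compose2[OF cQ' continuous_on_Pair[OF that]] by auto
  note cphi = continuous_on_compose2[OF test_function_continuous[OF \<phi>, of UNIV]]
    continuous_on_compose2[OF test_function_continuous[OF test_function_partial_real[OF \<phi>], of UNIV]]
  let ?g = "\<lambda>t s. Q' t s *\<^sub>R \<phi> (x - c * t * s) + ((- c * s) * Q t s) *\<^sub>R partial 1 \<phi> (x - c * t * s)"
  have "((\<lambda>t. integral (cbox (-1) 1) (\<lambda>s. Q t s *\<^sub>R \<phi> (x - c * t * s))) has_vector_derivative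
      integral (cbox (-1) 1) (?g t)) (at t within UNIV)"
  proof (rule leibniz_rule_vector_derivative)
    show "((\<lambda>t. Q t s *\<^sub>R \<phi> (x - c * t * s)) has_vector_derivative ?g t s) (at t within UNIV)" for t s
    proof -
      have "((\<lambda>t. x - c * t * s) has_vector_derivative - (c * s)) (at t)"
        unfolding has_real_derivative_iff_has_vector_derivative[symmetric] by (auto intro!: derivative_eq_intros)
      from has_vector_derivative_scaleR[OF Q vector_diff_chain_at[OF this test_function_has_vector_derivative[OF \<phi>]]]
      show ?thesis by (simp add: comp_def mult_ac add.commute)
    qed
    show "(\<lambda>s. Q t s *\<^sub>R \<phi> (x - c * t * s)) integrable_on cbox (-1) 1" for t
      unfolding cbox_interval by (intro avg_integrable[of _ _ x "c * t"] \<phi> c1 continuous_intros)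
    have "continuous_on (UNIV \<times> cbox (-1) 1) (\<lambda>p. ?g (fst p) (snd p))"
      by (intro continuous_intros c1 cphi) auto
    then show "continuous_on (UNIV \<times> cbox (-1) 1) (\<lambda>(t, s). ?g t s)" by (simp add: split_beta)
  qed auto
  moreover have "integral {-1..1} (?g t) =
      avg (Q' t) (c * t) \<phi> x + avg (\<lambda>s. (- c * s) * Q t s) (c * t) (partial 1 \<phi>) x"
    unfolding avg_def
    by (intro integral_add avg_integrable[of _ _ x "c * t"] \<phi> test_function_partial_real c1 continuous_intros)
  ultimately show ?thesis by (simp add: avg_def[abs_def])
qed

section \<open>The propagators\<close>

text \<open>Under y = c t s the prefactor |c t| sgn(t) / (2c) becomes t/2, and \<alpha>^2 (c^2 t^2 -
  y^2) becomes (k^2/16) t^2 (1 - s^2), because \<alpha> c = k/4. The wave speed has left the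
  kernel.\<close>

definition propagator_kernel :: "real \<Rightarrow> real \<Rightarrow> real \<Rightarrow> real" where
  "propagator_kernel k t s = t / 2 * bessel_entire (k\<^sup>2 / 16 * t\<^sup>2 * (1 - s\<^sup>2))"

text \<open>Here the Jacobian |c t|, the factor \<alpha> c |t| and the \<alpha> from
  \<open>bessel_quot\<close> combine to (\<alpha> c t)^2 = (k^2/16) t^2.\<close>

definition propagator_kernel' :: "real \<Rightarrow> real \<Rightarrow> real \<Rightarrow> real" where
  "propagator_kernel' k t s = k\<^sup>2 / 16 * t\<^sup>2 * bessel_entire' (k\<^sup>2 / 16 * t\<^sup>2 * (1 - s\<^sup>2))"

definition propagator :: "real \<Rightarrow> real \<Rightarrow> real \<Rightarrow> (real \<Rightarrow> 'a::euclidean_space) \<Rightarrow> real \<Rightarrow> 'a" where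
  "propagator k c t \<phi> = avg (propagator_kernel k t) (c * t) \<phi>"

definition propagator' :: "real \<Rightarrow> real \<Rightarrow> real \<Rightarrow> (real \<Rightarrow> 'a::euclidean_space) \<Rightarrow> real \<Rightarrow> 'a" where
  "propagator' k c t \<phi> = (\<lambda>x. (1 / 2) *\<^sub>R (\<phi> (x - c * t) + \<phi> (x + c * t)) + avg (propagator_kernel' k t) (c * t) \<phi> x)"

lemma continuous_on_propagator_kernel:
  assumes "continuous_on A f" "continuous_on A g"
  shows "continuous_on A (\<lambda>p. propagator_kernel k (f p) (g p))" "continuous_on A (\<lambda>p. propagator_kernel' k (f p) (g p))"
  unfolding propagator_kernel_def propagator_kernel'_def by (intro continuous_intros assms; simp)+

text \<open>In the integration by parts the radicand is 0 at both ends and E(0) = 1, so the boundary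
  terms are the two Dirac masses of weight 1/2. In the remaining integral the terms with E cancel,
  and (1 - s^2) + s^2 = 1 collects those with E' into \<open>propagator_kernel'\<close>.\<close>

lemma propagator_has_vector_derivative:
  assumes \<phi>: "test_function \<phi>"
  shows "((\<lambda>t. propagator k c t \<phi> x) has_vector_derivative propagator' k c t \<phi> x) (at t)"
proof -
  let ?E = "bessel_entire" and ?E' = "bessel_entire'"
  let ?w = "\<lambda>t s. k\<^sup>2 / 16 * t\<^sup>2 * (1 - s\<^sup>2)"
  let ?Q' = "\<lambda>t s. ?E (?w t s) / 2 + ?w t s * ?E' (?w t s)"
  have 1: "((\<lambda>t. avg (propagator_kernel k t) (c * t) \<phi> x) has_vector_derivative
     avg (?Q' t) (c * t) \<phi> x + avg (\<lambda>s. (- c * s) * propagator_kernel k t s) (c * t) (partial 1 \<phi>) x) (at t)"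
  proof (rule avg_time_derivative[OF _ _ _ \<phi>])
    show "((\<lambda>t. propagator_kernel k t s) has_real_derivative ?Q' t s) (at t)" for t s
      unfolding propagator_kernel_def
      by (auto intro!: derivative_eq_intros DERIV_chain2[OF bessel_entire_deriv] simp: power2_eq_square field_simps)
  qed (auto simp: split_beta intro!: continuous_intros continuous_on_propagator_kernel)
  \<comment> \<open>\<open>?q\<close> is what remains of \<open>- c * s\<close> times the kernel
    when \<open>c * t\<close> is split off, the form that \<open>avg_by_parts\<close> needs.\<close>
  let ?q = "\<lambda>s. - s / 2 * ?E (?w t s)" and ?q' = "\<lambda>s. - ?E (?w t s) / 2 + k\<^sup>2 / 16 * t\<^sup>2 * s\<^sup>2 * ?E' (?w t s)"
  have "avg (\<lambda>s. (c * t) * ?q s) (c * t) (partial 1 \<phi>) x =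
      ?q (-1) *\<^sub>R \<phi> (x + c * t) - ?q 1 *\<^sub>R \<phi> (x - c * t) + avg ?q' (c * t) \<phi> x"
  proof (rule avg_by_parts[OF _ _ \<phi>])
    show "(?q has_real_derivative ?q' s) (at s)" for s
      by (auto intro!: derivative_eq_intros DERIV_chain2[OF bessel_entire_deriv] simp: power2_eq_square field_simps)
    show "continuous_on {-1..1} ?q'" by (intro continuous_intros) auto
  qed
  also have "(\<lambda>s. (c * t) * ?q s) = (\<lambda>s. (- c * s) * propagator_kernel k t s)"
    by (simp add: propagator_kernel_def fun_eq_iff)
  finally have 2: "avg (\<lambda>s. (- c * s) * propagator_kernel k t s) (c * t) (partial 1 \<phi>) x =
      (1 / 2) *\<^sub>R (\<phi> (x - c * t) + \<phi> (x + c * t)) + avg ?q' (c * t) \<phi> x"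
    by (simp add: bessel_entire_0 algebra_simps)
  have "avg (?Q' t) (c * t) \<phi> x + avg ?q' (c * t) \<phi> x = avg (\<lambda>s. ?Q' t s + ?q' s) (c * t) \<phi> x"
    by (rule avg_kernel_add[symmetric, OF _ _ \<phi>]) (intro continuous_intros; simp)+
  also have "(\<lambda>s. ?Q' t s + ?q' s) = propagator_kernel' k t"
    by (simp add: propagator_kernel'_def fun_eq_iff field_simps)
  finally show ?thesis using 1 2 by (simp add: propagator_def propagator'_def add_ac)
qed

text \<open>The t-derivative of the kernel is (k^2/8) t (E' + w E''), which the differential
  equation of E turns into k^2/4 times \<open>propagator_kernel\<close>. The other terms come from
  c^2 times the propagator of \<phi>'' by one integration by parts, whose boundary terms are the
  derivatives of the two travelling point values.\<close>

lemma propagator'_has_vector_derivative: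
  assumes \<phi>: "test_function \<phi>"
  shows "((\<lambda>t. propagator' k c t \<phi> x) has_vector_derivative
     c\<^sup>2 *\<^sub>R propagator k c t (nderiv 2 \<phi>) x + (k\<^sup>2 / 4) *\<^sub>R propagator k c t \<phi> x) (at t)"
proof -
  let ?E = "bessel_entire" and ?E' = "bessel_entire'" and ?d = "partial 1 \<phi>"
  let ?w = "\<lambda>t s. k\<^sup>2 / 16 * t\<^sup>2 * (1 - s\<^sup>2)"
  have d: "test_function ?d" by (rule test_function_partial_real[OF \<phi>])
  have "((\<lambda>t. avg (propagator_kernel' k t) (c * t) \<phi> x) has_vector_derivative
     avg (\<lambda>s. k\<^sup>2 / 4 * propagator_kernel k t s) (c * t) \<phi> x +
     avg (\<lambda>s. (- c * s) * propagator_kernel' k t s) (c * t) ?d x) (at t)"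
  proof (rule avg_time_derivative[OF _ _ _ \<phi>])
    show "((\<lambda>t. propagator_kernel' k t s) has_real_derivative k\<^sup>2 / 4 * propagator_kernel k t s) (at t)" for t s
    proof -
      have "((\<lambda>t. propagator_kernel' k t s) has_real_derivative
          k\<^sup>2 / 8 * t * (?E' (?w t s) + ?w t s * bessel_entire'' (?w t s))) (at t)"
        unfolding propagator_kernel'_def
        by (auto intro!: derivative_eq_intros DERIV_chain2[OF bessel_entire'_deriv] simp: power2_eq_square field_simps)
      then show ?thesis unfolding bessel_entire_ode by (simp add: propagator_kernel_def mult.assoc)
    qed
  qed (auto simp: split_beta intro!: continuous_intros continuous_on_propagator_kernel)
  moreover have "((\<lambda>t. \<phi> (x + e * t)) has_vector_derivative e *\<^sub>R ?d (x + e * t)) (at t)" for e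
  proof -
    have "((\<lambda>t. x + e * t) has_vector_derivative e) (at t)"
      unfolding has_real_derivative_iff_has_vector_derivative[symmetric] by (auto intro!: derivative_eq_intros)
    from vector_diff_chain_at[OF this test_function_has_vector_derivative[OF \<phi>]] show ?thesis by (simp add: comp_def)
  qed
  from has_vector_derivative_add[OF this[of "-c"] this[of c]]
  have "((\<lambda>t. (1 / 2) *\<^sub>R (\<phi> (x - c * t) + \<phi> (x + c * t))) has_vector_derivative
      (1 / 2) *\<^sub>R (- c *\<^sub>R ?d (x - c * t) + c *\<^sub>R ?d (x + c * t))) (at t)"
    by (intro bounded_linear.has_vector_derivative[OF bounded_linear_scaleR_right]) simp
  ultimately have 1: "((\<lambda>t. propagator' k c t \<phi> x) has_vector_derivative
      (1 / 2) *\<^sub>R (- c *\<^sub>R ?d (x - c * t) + c *\<^sub>R ?d (x + c * t)) +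
      (avg (\<lambda>s. k\<^sup>2 / 4 * propagator_kernel k t s) (c * t) \<phi> x +
      avg (\<lambda>s. (- c * s) * propagator_kernel' k t s) (c * t) ?d x)) (at t)"
    unfolding propagator'_def by (rule has_vector_derivative_add[rotated])
  \<comment> \<open>The starting point is c times the propagator of \<phi>'', with
    \<open>c * t\<close> split off from its kernel; the second factor c is multiplied in
    afterwards.\<close>
  let ?q = "\<lambda>s. ?E (?w t s) / 2" and ?q' = "\<lambda>s. - s * propagator_kernel' k t s"
  have "avg (\<lambda>s. (c * t) * ?q s) (c * t) (partial 1 ?d) x =
      ?q (-1) *\<^sub>R ?d (x + c * t) - ?q 1 *\<^sub>R ?d (x - c * t) + avg ?q' (c * t) ?d x"
  proof (rule avg_by_parts[OF _ _ d])
    show "(?q has_real_derivative ?q' s) (at s)" for s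
      unfolding propagator_kernel'_def
      by (auto intro!: derivative_eq_intros DERIV_chain2[OF bessel_entire_deriv] simp: power2_eq_square field_simps)
    show "continuous_on {-1..1} ?q'" by (intro continuous_intros continuous_on_propagator_kernel)
  qed
  moreover have "(\<lambda>s. (c * t) * ?q s) = (\<lambda>s. c * propagator_kernel k t s)"
    by (simp add: propagator_kernel_def fun_eq_iff)
  moreover have "partial 1 ?d = nderiv 2 \<phi>" by (simp add: nderiv_Suc numeral_2_eq_2)
  ultimately have "c *\<^sub>R propagator k c t (nderiv 2 \<phi>) x =
      (1 / 2) *\<^sub>R (- ?d (x - c * t) + ?d (x + c * t)) + avg ?q' (c * t) ?d x"
    by (simp add: bessel_entire_0 propagator_def avg_kernel_scale algebra_simps)
  then have "c *\<^sub>R (c *\<^sub>R propagator k c t (nderiv 2 \<phi>) x) =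
      c *\<^sub>R ((1 / 2) *\<^sub>R (- ?d (x - c * t) + ?d (x + c * t)) + avg ?q' (c * t) ?d x)" by simp
  moreover have "avg (\<lambda>s. (- c * s) * propagator_kernel' k t s) (c * t) ?d x = c *\<^sub>R avg ?q' (c * t) ?d x"
    using avg_kernel_scale[of c ?q' "c * t" ?d x] by (simp add: mult_ac)
  ultimately have "(1 / 2) *\<^sub>R (- c *\<^sub>R ?d (x - c * t) + c *\<^sub>R ?d (x + c * t)) +
      (avg (\<lambda>s. k\<^sup>2 / 4 * propagator_kernel k t s) (c * t) \<phi> x +
      avg (\<lambda>s. (- c * s) * propagator_kernel' k t s) (c * t) ?d x) =
      c\<^sup>2 *\<^sub>R propagator k c t (nderiv 2 \<phi>) x + (k\<^sup>2 / 4) *\<^sub>R propagator k c t \<phi> x"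
    unfolding avg_kernel_scale[of "k\<^sup>2 / 4"] by (simp add: power2_eq_square propagator_def algebra_simps)
  with 1 show ?thesis by simp
qed

lemma continuous_on_kernels:
  "continuous_on A (propagator_kernel k t)" "continuous_on A (propagator_kernel' k t)"
  using continuous_on_propagator_kernel[of A "\<lambda>_. t" "\<lambda>s. s" k] by simp_all

lemma
  assumes \<phi>: "test_function \<phi>"
  shows nderiv_propagator: "nderiv j (propagator k c t \<phi>) = propagator k c t (nderiv j \<phi>)"
    and test_function_propagator: "test_function (propagator k c t \<phi>)"
  unfolding propagator_def by (intro nderiv_avg test_function_avg continuous_on_kernels \<phi>)+

lemma propagator_eq_0:
  assumes "\<And>x. \<bar>x\<bar> > R \<Longrightarrow> \<phi> x = 0" "\<bar>x\<bar> > R + \<bar>c * t\<bar>"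
  shows "propagator k c t \<phi> x = 0"
  unfolding propagator_def using assms by (rule avg_eq_0)

lemma propagator'_eq_0:
  assumes "\<And>x. \<bar>x\<bar> > R \<Longrightarrow> \<phi> x = 0" "\<bar>x\<bar> > R + \<bar>c * t\<bar>"
  shows "propagator' k c t \<phi> x = 0"
proof -
  have "\<bar>x - c * t\<bar> > R" "\<bar>x + c * t\<bar> > R" using assms(2) by linarith+
  then show ?thesis
    unfolding propagator'_def using assms(1) avg_eq_0[OF assms] by simp
qed

lemma
  assumes \<phi>: "test_function \<phi>"
  shows nderiv_propagator': "nderiv j (propagator' k c t \<phi>) = propagator' k c t (nderiv j \<phi>)"
    and test_function_propagator': "test_function (propagator' k c t \<phi>)"
proof -
  have shift: "((\<lambda>x. nderiv j \<phi> (x + e)) has_vector_derivative nderiv (Suc j) \<phi> (x + e)) (at x)" for j x e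
  proof -
    have "((\<lambda>x. x + e) has_vector_derivative 1) (at x)" by (auto intro!: derivative_eq_intros)
    from vector_diff_chain_at[OF this smooth_nderiv_has_vector_derivative[of \<phi> j]] \<phi>
    show ?thesis by (simp add: comp_def test_function_def)
  qed
  have a: "(avg (propagator_kernel' k t) (c * t) (nderiv j \<phi>) has_vector_derivative
      avg (propagator_kernel' k t) (c * t) (nderiv (Suc j) \<phi>) x) (at x)" for j x
    unfolding nderiv_Suc by (intro avg_has_vector_derivative continuous_on_kernels test_function_nderiv \<phi>)
  have *: "(propagator' k c t (nderiv j \<phi>) has_vector_derivative propagator' k c t (nderiv (Suc j) \<phi>) x) (at x)" for j x
    using has_vector_derivative_add[OF bounded_linear.has_vector_derivative[OF bounded_linear_scaleR_right[of "1/2"]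
          has_vector_derivative_add[OF shift[of j "- (c * t)" x] shift[of j "c * t" x]]] a[of j x]]
    by (simp add: propagator'_def)
  note nd = nderiv_sequenceI[of "\<lambda>j. propagator' k c t (nderiv j \<phi>)", OF *]
  show "nderiv j (propagator' k c t \<phi>) = propagator' k c t (nderiv j \<phi>)" using nd(1) by simp
  obtain R where R: "\<And>x. \<bar>x\<bar> > R \<Longrightarrow> \<phi> x = 0" using test_function_bounded_support[OF \<phi>] by blast
  have "propagator' k c t \<phi> x = 0" if "x \<notin> {- (R + \<bar>c * t\<bar>)..R + \<bar>c * t\<bar>}" for x
    by (rule propagator'_eq_0[OF R]) (use that in auto)
  then show "test_function (propagator' k c t \<phi>)"
    using nd(2) by (intro test_functionI[of _ "{- (R + \<bar>c * t\<bar>)..R + \<bar>c * t\<bar>}"]) auto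
qed

text \<open>One constant serves all \<phi> and all times up to \<open>R\<close>. Since the
  propagators commute with \<open>nderiv\<close>, such a bound in the supremum norm controls every
  derivative; it gives the estimates for time derivatives as well as continuity on test
  functions.\<close>

lemma propagators_bounded:
  fixes R :: real
  obtains K where "\<And>t \<phi> C x. \<bar>t\<bar> \<le> R \<Longrightarrow> test_function \<phi> \<Longrightarrow> (\<And>x. norm (\<phi> x) \<le> C) \<Longrightarrow>
      norm (propagator k c t (\<phi> :: real \<Rightarrow> 'a::euclidean_space) x) \<le> K * C"
    and "\<And>t \<phi> C x. \<bar>t\<bar> \<le> R \<Longrightarrow> test_function \<phi> \<Longrightarrow> (\<And>x. norm (\<phi> x) \<le> C) \<Longrightarrow>
      norm (propagator' k c t (\<phi> :: real \<Rightarrow> 'a) x) \<le> K * C"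
proof -
  let ?S = "{-R..R} \<times> {-1..1 :: real}"
  have "compact ((\<lambda>p. propagator_kernel k (fst p) (snd p)) ` ?S)"
    "compact ((\<lambda>p. propagator_kernel' k (fst p) (snd p)) ` ?S)"
    by (intro compact_continuous_image continuous_on_propagator_kernel continuous_intros compact_Times compact_Icc)+
  then have "bounded ((\<lambda>p. propagator_kernel k (fst p) (snd p)) ` ?S)"
    "bounded ((\<lambda>p. propagator_kernel' k (fst p) (snd p)) ` ?S)" by (simp_all add: compact_imp_bounded)
  then obtain A B where AB: "\<And>p. p \<in> ?S \<Longrightarrow> \<bar>propagator_kernel k (fst p) (snd p)\<bar> \<le> A"
      "\<And>p. p \<in> ?S \<Longrightarrow> \<bar>propagator_kernel' k (fst p) (snd p)\<bar> \<le> B"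
    unfolding bounded_iff real_norm_def by blast
  \<comment> \<open>The 2 is the length of [-1, 1]; the 1 pays for the two point values of weight
    1/2.\<close>
  define K where "K = 2 * \<bar>A\<bar> + 2 * \<bar>B\<bar> + 1"
  show ?thesis
  proof
    fix t C x and \<phi> :: "real \<Rightarrow> 'a" assume t: "\<bar>t\<bar> \<le> R" and \<phi>: "test_function \<phi>" and C: "\<And>x. norm (\<phi> x) \<le> C"
    have C0: "C \<ge> 0" using C[of 0] norm_ge_zero order_trans by blast
    have "\<bar>propagator_kernel k t s\<bar> \<le> \<bar>A\<bar>" "\<bar>propagator_kernel' k t s\<bar> \<le> \<bar>B\<bar>" if "s \<in> {-1..1}" for s
    proof -
      have "(t, s) \<in> ?S" using t that by (auto simp: abs_le_iff)
      from AB[OF this] show "\<bar>propagator_kernel k t s\<bar> \<le> \<bar>A\<bar>" "\<bar>propagator_kernel' k t s\<bar> \<le> \<bar>B\<bar>"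
        by simp_all
    qed
    then have 1: "norm (avg (propagator_kernel k t) (c * t) \<phi> x) \<le> 2 * \<bar>A\<bar> * C"
      "norm (avg (propagator_kernel' k t) (c * t) \<phi> x) \<le> 2 * \<bar>B\<bar> * C"
      by (intro avg_bound[OF _ \<phi> _ C] continuous_on_kernels; blast)+
    have "norm (propagator k c t \<phi> x) \<le> 2 * \<bar>A\<bar> * C" using 1 by (simp add: propagator_def)
    also have "\<dots> \<le> K * C" using C0 by (intro mult_right_mono) (auto simp: K_def)
    finally show "norm (propagator k c t \<phi> x) \<le> K * C" .
    have "norm (\<phi> (x - c * t) + \<phi> (x + c * t)) \<le> C + C" by (intro norm_triangle_le add_mono C)
    then have "norm ((1 / 2) *\<^sub>R (\<phi> (x - c * t) + \<phi> (x + c * t))) \<le> C" by simp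
    then have "norm (propagator' k c t \<phi> x) \<le> C + 2 * \<bar>B\<bar> * C"
      unfolding propagator'_def using 1(2) by (intro norm_triangle_le add_mono)
    also have "\<dots> = (2 * \<bar>B\<bar> + 1) * C" by (simp add: algebra_simps)
    also have "\<dots> \<le> K * C" using C0 by (intro mult_right_mono) (auto simp: K_def)
    finally show "norm (propagator' k c t \<phi> x) \<le> K * C" .
  qed
qed

lemma
  fixes \<phi> \<psi> :: "real \<Rightarrow> 'a::{real_normed_field, euclidean_space}"
  assumes t: "test_function \<phi>" "test_function \<psi>"
  shows propagator_lincomb: "propagator k c t (\<lambda>x. a * \<phi> x + b * \<psi> x) =
      (\<lambda>x. a * propagator k c t \<phi> x + b * propagator k c t \<psi> x)"
    and propagator'_lincomb: "propagator' k c t (\<lambda>x. a * \<phi> x + b * \<psi> x) =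
      (\<lambda>x. a * propagator' k c t \<phi> x + b * propagator' k c t \<psi> x)"
  unfolding propagator_def propagator'_def fun_eq_iff
  by (simp_all add: avg_lincomb[OF continuous_on_kernels(1) t] avg_lincomb[OF continuous_on_kernels(2) t]
      scaleR_conv_of_real algebra_simps)

text \<open>The pointwise time derivatives apply to every \<open>nderiv j \<phi>\<close>, and the
  propagators commute with \<open>nderiv\<close>, so \<open>has_tderivI\<close> can be used at all
  orders. The second time derivatives are again combinations of propagators and therefore
  bounded.\<close>

lemma propagator_has_tderiv:
  fixes \<phi> :: "real \<Rightarrow> 'a::{real_normed_field, euclidean_space}"
  assumes \<phi>: "test_function \<phi>"
  shows "has_tderiv (\<lambda>t. propagator k c t \<phi>) (\<lambda>t. propagator' k c t \<phi>)"
    and "has_tderiv (\<lambda>t. propagator' k c t \<phi>)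
      (\<lambda>t x. c\<^sup>2 *\<^sub>R propagator k c t (nderiv 2 \<phi>) x + (k\<^sup>2 / 4) *\<^sub>R propagator k c t \<phi> x)"
proof -
  have \<phi>j: "test_function (nderiv j \<phi>)" "test_function (nderiv 2 (nderiv j \<phi>))" for j
    by (intro test_function_nderiv \<phi>)+
  obtain r where r: "\<And>x. \<bar>x\<bar> > r \<Longrightarrow> \<phi> x = 0" using test_function_bounded_support[OF \<phi>] by blast
  \<comment> \<open>Finite speed of propagation: up to time \<open>R\<close> the support grows by at
    most |c| R.\<close>
  have K: "\<bar>x\<bar> > r + \<bar>c * t\<bar>" if "\<bar>t\<bar> \<le> R" "x \<notin> {- (r + \<bar>c\<bar> * R)..r + \<bar>c\<bar> * R}" for x t R
  proof -
    have "\<bar>c * t\<bar> \<le> \<bar>c\<bar> * R" unfolding abs_mult using that(1) by (intro mult_left_mono) auto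
    moreover have "\<bar>x\<bar> > r + \<bar>c\<bar> * R" using that(2) unfolding atLeastAtMost_iff by linarith
    ultimately show ?thesis by linarith
  qed
  have bd: "\<exists>C. \<forall>t x. \<bar>t\<bar> \<le> R \<longrightarrow> norm (propagator k c t \<psi> x) \<le> C \<and> norm (propagator' k c t \<psi> x) \<le> C"
    if \<psi>: "test_function \<psi>" for R and \<psi> :: "real \<Rightarrow> 'a"
  proof -
    obtain C where C: "\<And>x. norm (\<psi> x) \<le> C" using test_function_bounded[OF \<psi>] by blast
    obtain K where "\<And>t x. \<bar>t\<bar> \<le> R \<Longrightarrow> norm (propagator k c t \<psi> x) \<le> K * C"
        "\<And>t x. \<bar>t\<bar> \<le> R \<Longrightarrow> norm (propagator' k c t \<psi> x) \<le> K * C"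
      using propagators_bounded[of R k c thesis] \<psi> C by blast
    then show ?thesis by blast
  qed
  have bd2: "\<exists>C. \<forall>t x. \<bar>t\<bar> \<le> R \<longrightarrow>
      norm (c\<^sup>2 *\<^sub>R propagator k c t \<psi> x + (k\<^sup>2 / 4) *\<^sub>R propagator k c t \<eta> x) \<le> C \<and>
      norm (c\<^sup>2 *\<^sub>R propagator' k c t \<psi> x + (k\<^sup>2 / 4) *\<^sub>R propagator' k c t \<eta> x) \<le> C"
    if \<psi>: "test_function \<psi>" "test_function \<eta>" for R and \<psi> \<eta> :: "real \<Rightarrow> 'a"
  proof -
    obtain A B where "\<And>t x. \<bar>t\<bar> \<le> R \<Longrightarrow> norm (propagator k c t \<psi> x) \<le> A \<and> norm (propagator' k c t \<psi> x) \<le> A"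
        "\<And>t x. \<bar>t\<bar> \<le> R \<Longrightarrow> norm (propagator k c t \<eta> x) \<le> B \<and> norm (propagator' k c t \<eta> x) \<le> B"
      using bd[OF \<psi>(1), of R] bd[OF \<psi>(2), of R] by blast
    then show ?thesis
      by (intro exI[of _ "c\<^sup>2 * A + k\<^sup>2 / 4 * B"] allI impI conjI norm_triangle_le add_mono)
         (simp_all add: mult_left_mono)
  qed
  have "has_tderiv (\<lambda>t. propagator k c t (nderiv 0 \<phi>)) (\<lambda>t. propagator' k c t (nderiv 0 \<phi>))"
  proof (rule has_tderivI[where F = "\<lambda>j t. propagator k c t (nderiv j \<phi>)" and G = "\<lambda>j t. propagator' k c t (nderiv j \<phi>)"
        and H = "\<lambda>j t x. c\<^sup>2 *\<^sub>R propagator k c t (nderiv 2 (nderiv j \<phi>)) x + (k\<^sup>2 / 4) *\<^sub>R propagator k c t (nderiv j \<phi>) x"])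
    show "\<exists>K. compact K \<and> (\<forall>t x. \<bar>t\<bar> \<le> R \<longrightarrow> x \<notin> K \<longrightarrow> propagator k c t (nderiv 0 \<phi>) x = 0)" for R
      by (rule exI[of _ "{- (r + \<bar>c\<bar> * R)..r + \<bar>c\<bar> * R}"])
         (use K propagator_eq_0[of r \<phi>, OF r] in \<open>simp del: atLeastAtMost_iff\<close>)
    show "\<exists>C. \<forall>t x. \<bar>t\<bar> \<le> R \<longrightarrow> norm (c\<^sup>2 *\<^sub>R propagator k c t (nderiv 2 (nderiv j \<phi>)) x +
        (k\<^sup>2 / 4) *\<^sub>R propagator k c t (nderiv j \<phi>) x) \<le> C" for j R
      using bd2[OF \<phi>j(2)[of j] \<phi>j(1)[of j], of R] by blast
  qed (simp_all add: test_function_propagator nderiv_propagator propagator_has_vector_derivative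
      propagator'_has_vector_derivative \<phi> \<phi>j)
  then show "has_tderiv (\<lambda>t. propagator k c t \<phi>) (\<lambda>t. propagator' k c t \<phi>)" by simp
  have "has_tderiv (\<lambda>t. propagator' k c t (nderiv 0 \<phi>))
      (\<lambda>t x. c\<^sup>2 *\<^sub>R propagator k c t (nderiv 2 (nderiv 0 \<phi>)) x + (k\<^sup>2 / 4) *\<^sub>R propagator k c t (nderiv 0 \<phi>) x)"
  proof (rule has_tderivI[where F = "\<lambda>j t. propagator' k c t (nderiv j \<phi>)"
        and G = "\<lambda>j t x. c\<^sup>2 *\<^sub>R propagator k c t (nderiv 2 (nderiv j \<phi>)) x + (k\<^sup>2 / 4) *\<^sub>R propagator k c t (nderiv j \<phi>) x"
        and H = "\<lambda>j t x. c\<^sup>2 *\<^sub>R propagator' k c t (nderiv 2 (nderiv j \<phi>)) x + (k\<^sup>2 / 4) *\<^sub>R propagator' k c t (nderiv j \<phi>) x"])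
    show "\<exists>K. compact K \<and> (\<forall>t x. \<bar>t\<bar> \<le> R \<longrightarrow> x \<notin> K \<longrightarrow> propagator' k c t (nderiv 0 \<phi>) x = 0)" for R
      by (rule exI[of _ "{- (r + \<bar>c\<bar> * R)..r + \<bar>c\<bar> * R}"])
         (use K propagator'_eq_0[of r \<phi>, OF r] in \<open>simp del: atLeastAtMost_iff\<close>)
    show "\<exists>C. \<forall>t x. \<bar>t\<bar> \<le> R \<longrightarrow> norm (c\<^sup>2 *\<^sub>R propagator' k c t (nderiv 2 (nderiv j \<phi>)) x +
        (k\<^sup>2 / 4) *\<^sub>R propagator' k c t (nderiv j \<phi>) x) \<le> C" for j R
      using bd2[OF \<phi>j(2)[of j] \<phi>j(1)[of j], of R] by blast
    show "((\<lambda>t. c\<^sup>2 *\<^sub>R propagator k c t (nderiv 2 (nderiv j \<phi>)) x + (k\<^sup>2 / 4) *\<^sub>R propagator k c t (nderiv j \<phi>) x)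
        has_vector_derivative
        c\<^sup>2 *\<^sub>R propagator' k c t (nderiv 2 (nderiv j \<phi>)) x + (k\<^sup>2 / 4) *\<^sub>R propagator' k c t (nderiv j \<phi>) x) (at t)" for j t x
      by (intro has_vector_derivative_add bounded_linear.has_vector_derivative[OF bounded_linear_scaleR_right]
          propagator_has_vector_derivative \<phi>j)
  qed (simp_all add: test_function_propagator' nderiv_propagator' propagator'_has_vector_derivative \<phi> \<phi>j)
  then show "has_tderiv (\<lambda>t. propagator' k c t \<phi>)
      (\<lambda>t x. c\<^sup>2 *\<^sub>R propagator k c t (nderiv 2 \<phi>) x + (k\<^sup>2 / 4) *\<^sub>R propagator k c t \<phi> x)" by simp
qed

section \<open>Time reversal, and distributions composed with propagators\<close>

lemma has_tderiv_reverse: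
  fixes \<eta> :: "real \<Rightarrow> real \<Rightarrow> 'a::{real_normed_field, banach}"
  assumes "has_tderiv \<eta> \<eta>'"
  shows "has_tderiv (\<lambda>t. \<eta> (T - t)) (\<lambda>t x. - \<eta>' (T - t) x)"
  unfolding has_tderiv_def
proof (intro conjI allI impI)
  fix t and h :: "nat \<Rightarrow> real" assume h: "\<forall>n. h n \<noteq> 0" "h \<longlonglongrightarrow> 0"
  \<comment> \<open>At the reversed time the steps are \<open>- h n\<close>; returning to division
    by \<open>h n\<close> produces the minus sign.\<close>
  then have "test_converges (\<lambda>n x. (\<eta> (T - t + - h n) x - \<eta> (T - t) x) /\<^sub>R (- h n)) (\<eta>' (T - t))"
    using tendsto_minus[OF h(2)]
    by (intro assms[unfolded has_tderiv_def, THEN conjunct2, rule_format]) simp_all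
  from test_converges_lincomb[OF this this, of "-1" 0]
  show "test_converges (\<lambda>n x. (\<eta> (T - (t + h n)) x - \<eta> (T - t) x) /\<^sub>R h n) (\<lambda>x. - \<eta>' (T - t) x)"
    by (simp add: algebra_simps)
qed (rule has_tderiv_test_function[OF assms])

text \<open>Transposition of an operator on test functions. Commuting with \<open>nderiv\<close>
  reduces convergence of all derivatives to the supremum bound, and supports grow by the fixed
  amount \<open>r\<close>, so \<open>F\<close> preserves convergence of test functions.\<close>

lemma distribution_compose:
  fixes F :: "(real \<Rightarrow> 'a::{real_normed_field, euclidean_space}) \<Rightarrow> real \<Rightarrow> 'a"
  assumes f: "distribution f"
    and test: "\<And>\<phi>. test_function \<phi> \<Longrightarrow> test_function (F \<phi>)"
    and nd: "\<And>\<phi> j. test_function \<phi> \<Longrightarrow> nderiv j (F \<phi>) = F (nderiv j \<phi>)"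
    and lin: "\<And>\<phi> \<psi> a b. test_function \<phi> \<Longrightarrow> test_function \<psi> \<Longrightarrow>
       F (\<lambda>x. a * \<phi> x + b * \<psi> x) = (\<lambda>x. a * F \<phi> x + b * F \<psi> x)"
    and bound: "\<And>\<phi> C x. test_function \<phi> \<Longrightarrow> (\<And>x. norm (\<phi> x) \<le> C) \<Longrightarrow> norm (F \<phi> x) \<le> K * C"
    and supp: "\<And>\<phi> R x. (\<And>x. \<bar>x\<bar> > R \<Longrightarrow> \<phi> x = 0) \<Longrightarrow> \<bar>x\<bar> > R + r \<Longrightarrow> F \<phi> x = 0"
  shows "distribution (\<lambda>\<phi>. f (F \<phi>))"
  unfolding distribution_def
proof (intro conjI allI impI)
  fix \<phi> \<eta> :: "real \<Rightarrow> 'a" and a b assume "test_function \<phi>" "test_function \<eta>"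
  then show "f (F (\<lambda>x. a * \<phi> x + b * \<eta> x)) = a * f (F \<phi>) + b * f (F \<eta>)"
    by (simp add: lin distribution_lincomb[OF f] test)
next
  fix \<Phi> and \<phi> :: "real \<Rightarrow> 'a" assume c: "test_converges \<Phi> \<phi>"
  then have t: "test_function \<phi>" "test_function (\<Phi> n)" for n by (simp_all add: test_converges_def)
  obtain L where L: "compact L" "\<And>n x. x \<notin> L \<Longrightarrow> \<Phi> n x = 0" using c unfolding test_converges_real_iff by meson
  obtain R where R: "\<And>x. x \<in> L \<Longrightarrow> \<bar>x\<bar> \<le> R"
    using compact_imp_bounded[OF L(1)] by (auto simp: bounded_iff)
  have "test_converges (\<lambda>n. F (\<Phi> n)) (F (nderiv 0 \<phi>))"
  proof (rule test_convergesI[where g = "\<lambda>j. F (nderiv j \<phi>)" and K = "{- (R + r)..R + r}"])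
    show "F (\<Phi> n) x = 0" if "x \<notin> {- (R + r)..R + r}" for n x
    proof (rule supp)
      show "\<Phi> n x = 0" if "\<bar>x\<bar> > R" for x using L(2) R that by force
      show "\<bar>x\<bar> > R + r" using that by auto
    qed
    fix j
    show "uniform_limit UNIV (\<lambda>n. nderiv j (F (\<Phi> n))) (F (nderiv j \<phi>)) sequentially"
    proof (rule uniform_limitI)
      fix e :: real assume e: "e > 0"
      have "uniform_limit UNIV (\<lambda>n. nderiv j (\<Phi> n)) (nderiv j \<phi>) sequentially"
        using c by (simp add: test_converges_real_iff)
      \<comment> \<open>The sign of \<open>K\<close> is not known, so the tolerance is divided by
        |K| + 1.\<close>
      then have "\<forall>\<^sub>F n in sequentially. \<forall>x\<in>UNIV. dist (nderiv j (\<Phi> n) x) (nderiv j \<phi> x) < e / (\<bar>K\<bar> + 1)"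
        by (rule uniform_limitD) (use e in simp)
      then show "\<forall>\<^sub>F n in sequentially. \<forall>x\<in>UNIV. dist (nderiv j (F (\<Phi> n)) x) (F (nderiv j \<phi>) x) < e"
      proof eventually_elim
        case (elim n)
        note tj = test_function_nderiv[OF t(2), of j n] test_function_nderiv[OF t(1), of j]
        show ?case
        proof
          fix x
          have "nderiv j (F (\<Phi> n)) x - F (nderiv j \<phi>) x = F (\<lambda>x. nderiv j (\<Phi> n) x - nderiv j \<phi> x) x"
            using lin[OF tj, of 1 "-1"] by (simp add: nd[OF t(2)])
          also have "norm \<dots> \<le> K * (e / (\<bar>K\<bar> + 1))"
            using elim by (intro bound test_function_diff tj) (simp add: dist_norm less_imp_le)
          also have "\<dots> < e"
          proof -
            have "K * e < (\<bar>K\<bar> + 1) * e" using e by (intro mult_strict_right_mono) auto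
            moreover have "\<bar>K\<bar> + 1 > 0" by simp
            ultimately show ?thesis by (simp add: pos_divide_less_eq mult.commute)
          qed
          finally show "dist (nderiv j (F (\<Phi> n)) x) (F (nderiv j \<phi>) x) < e" by (simp add: dist_norm)
        qed
      qed
    qed
  qed (use t test in auto)
  then show "(\<lambda>n. f (F (\<Phi> n))) \<longlonglongrightarrow> f (F \<phi>)" using distribution_tendsto[OF f] by simp
qed

lemma
  assumes f: "distribution (f :: (real \<Rightarrow> 'a::{real_normed_field, euclidean_space}) \<Rightarrow> 'a)"
  shows distribution_propagator: "distribution (\<lambda>\<phi>. f (propagator k c t \<phi>))"
    and distribution_propagator': "distribution (\<lambda>\<phi>. f (propagator' k c t \<phi>))"
proof -
  obtain K where K: "\<And>\<phi> C x. test_function \<phi> \<Longrightarrow> (\<And>x. norm (\<phi> x) \<le> C) \<Longrightarrow>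
      norm (propagator k c t (\<phi> :: real \<Rightarrow> 'a) x) \<le> K * C"
    "\<And>\<phi> C x. test_function \<phi> \<Longrightarrow> (\<And>x. norm (\<phi> x) \<le> C) \<Longrightarrow>
      norm (propagator' k c t (\<phi> :: real \<Rightarrow> 'a) x) \<le> K * C"
    using propagators_bounded[of "\<bar>t\<bar>" k c thesis] by blast
  show "distribution (\<lambda>\<phi>. f (propagator k c t \<phi>))"
    by (rule distribution_compose[OF f test_function_propagator nderiv_propagator propagator_lincomb K(1) propagator_eq_0])
  show "distribution (\<lambda>\<phi>. f (propagator' k c t \<phi>))"
    by (rule distribution_compose[OF f test_function_propagator' nderiv_propagator' propagator'_lincomb K(2) propagator'_eq_0])
qed

section \<open>Values at time 0, and convolution with the Bessel kernels\<close>

lemma propagator_0: "propagator k c 0 \<phi> = (\<lambda>x. 0)"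
  by (simp add: propagator_def avg_def[abs_def] propagator_kernel_def)

lemma propagator'_0: "propagator' k c 0 \<phi> = \<phi>"
  by (simp add: propagator'_def avg_def[abs_def] propagator_kernel'_def scaleR_2[symmetric])

text \<open>The linear substitution needs c t to be nonzero; its Jacobian |c t| takes care of
  negative times. The second condition on \<open>K\<close> is what the indicator in the kernels
  supplies.\<close>

lemma LINT_kernel_eq_avg:
  assumes ct: "c * t \<noteq> 0" and q: "continuous_on {-1..1} q" and \<phi>: "test_function \<phi>"
    and K: "\<And>s. s \<in> {-1..1} \<Longrightarrow> \<bar>c * t\<bar> * K (c * t * s) = q s" "\<And>s. s \<notin> {-1..1} \<Longrightarrow> K (c * t * s) = 0"
  shows "(LINT y|lborel. K y *\<^sub>R \<phi> (x - y)) = avg q (c * t) \<phi> x"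
proof -
  have "(LINT y|lborel. K y *\<^sub>R \<phi> (x - y)) =
      \<bar>c * t\<bar> *\<^sub>R (LINT s|lborel. K (c * t * s) *\<^sub>R \<phi> (x - c * t * s))"
    using lborel_integral_real_affine[OF ct, of "\<lambda>y. K y *\<^sub>R \<phi> (x - y)" 0] by simp
  also have "\<dots> = (LINT s|lborel. \<bar>c * t\<bar> *\<^sub>R (K (c * t * s) *\<^sub>R \<phi> (x - c * t * s)))"
    by (simp del: scaleR_scaleR)
  also have "\<dots> = (LINT s:{-1..1}|lborel. q s *\<^sub>R \<phi> (x - c * t * s))"
    unfolding set_lebesgue_integral_def
  proof (rule Bochner_Integration.integral_cong)
    fix s
    show "\<bar>c * t\<bar> *\<^sub>R (K (c * t * s) *\<^sub>R \<phi> (x - c * t * s)) =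
        indicator {-1..1} s *\<^sub>R (q s *\<^sub>R \<phi> (x - c * t * s))"
      unfolding scaleR_scaleR using K[of s] by (cases "s \<in> {-1..1}") auto
  qed simp
  also have "\<dots> = integral {-1..1} (\<lambda>s. q s *\<^sub>R \<phi> (x - c * t * s))"
    by (intro set_borel_integral_eq_integral borel_integrable_atLeastAtMost' continuous_intros q
        continuous_on_compose2[OF test_function_continuous[OF \<phi>, of UNIV]]) auto
  finally show ?thesis by (simp add: avg_def)
qed

lemma
  fixes \<phi> :: "real \<Rightarrow> 'a::euclidean_space"
  assumes c: "c > 0" and \<phi>: "test_function \<phi>"
  shows psi_convolution: "dist_conv (psi k c t) \<phi> = propagator k c t \<phi>"
    and psi_t_convolution: "dist_conv (psi_t k c t) \<phi> = propagator' k c t \<phi>"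
proof -
  have rad: "c\<^sup>2 * t\<^sup>2 - (c * t * s)\<^sup>2 = c\<^sup>2 * t\<^sup>2 * (1 - s\<^sup>2)" for s
    by (simp add: power_mult_distrib algebra_simps)
  \<comment> \<open>Within the interval the radicand is nonnegative, so squaring undoes
    \<open>sqrt\<close>.\<close>
  have nn: "c\<^sup>2 * t\<^sup>2 * (1 - s\<^sup>2) \<ge> 0" if "s \<in> {-1..1}" for s
    using that by (simp add: abs_square_le_1 abs_le_iff)
  have mem: "c * t * s \<in> {- c * \<bar>t\<bar>..c * \<bar>t\<bar>} \<longleftrightarrow> s \<in> {-1..1}" if "t \<noteq> 0" for s
  proof -
    have "c * t * s \<in> {- c * \<bar>t\<bar>..c * \<bar>t\<bar>} \<longleftrightarrow> \<bar>c * t * s\<bar> \<le> c * \<bar>t\<bar>" by (auto simp: abs_le_iff)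
    also have "\<dots> \<longleftrightarrow> (c * \<bar>t\<bar>) * \<bar>s\<bar> \<le> (c * \<bar>t\<bar>) * 1" using c by (simp add: abs_mult mult_ac)
    also have "\<dots> \<longleftrightarrow> \<bar>s\<bar> \<le> 1" using c that by (intro mult_le_cancel_left_pos) simp
    finally show ?thesis by (auto simp: abs_le_iff)
  qed
  have "dist_conv (psi k c t) \<phi> x = propagator k c t \<phi> x" for x
  proof (cases "t = 0")
    \<comment> \<open>The substitution degenerates at t = 0; the left side vanishes because sgn 0 =
      0, the right side because the kernel has the factor t.\<close>
    case True
    then show ?thesis
      by (simp add: dist_conv_def psi_def regular_dist_def psi_kernel_def propagator_0)
  next
    case False
    show ?thesis
      unfolding dist_conv_def psi_def regular_dist_def propagator_def
    proof (rule LINT_kernel_eq_avg[OF _ continuous_on_kernels(1) \<phi>])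
      show "c * t \<noteq> 0" using c False by simp
      show "psi_kernel k c t (c * t * s) = 0" if "s \<notin> {-1..1}" for s
        using mem[OF False, of s] that by (simp add: psi_kernel_def indicator_def)
      show "\<bar>c * t\<bar> * psi_kernel k c t (c * t * s) = propagator_kernel k t s" if s: "s \<in> {-1..1}" for s
      proof -
        have "psi_kernel k c t (c * t * s) =
            sgn t * (1 / (2 * c)) * bessel_I0 (2 * (k / (4 * c)) * sqrt (c\<^sup>2 * t\<^sup>2 * (1 - s\<^sup>2)))"
          using mem[OF False, of s] s by (simp add: psi_kernel_def Let_def rad)
        moreover have e: "(2 * (k / (4 * c)))\<^sup>2 * (c\<^sup>2 * t\<^sup>2 * (1 - s\<^sup>2)) / 4 = k\<^sup>2 / 16 * t\<^sup>2 * (1 - s\<^sup>2)"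
          using c by (simp add: power_divide power_mult_distrib)
        then have "bessel_I0 (2 * (k / (4 * c)) * sqrt (c\<^sup>2 * t\<^sup>2 * (1 - s\<^sup>2))) =
            bessel_entire (k\<^sup>2 / 16 * t\<^sup>2 * (1 - s\<^sup>2))"
          unfolding bessel_I0_eq power_mult_distrib[of _ "sqrt _"] real_sqrt_pow2[OF nn[OF s]] e by simp
        moreover have "\<bar>c * t\<bar> * (sgn t * (1 / (2 * c))) = t / 2"
          using c by (cases t "0::real" rule: linorder_cases) (simp_all add: abs_mult)
        ultimately show ?thesis by (simp only: propagator_kernel_def flip: mult.assoc)
      qed
    qed
  qed
  then show "dist_conv (psi k c t) \<phi> = propagator k c t \<phi>" by (rule ext)
  have "regular_dist (psi_t_kernel k c t) (\<lambda>y. \<phi> (x - y)) = avg (propagator_kernel' k t) (c * t) \<phi> x" for x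
  proof (cases "t = 0")
    \<comment> \<open>Only the regular part vanishes at t = 0; the two Dirac terms, added at the
      end, merge into one full point mass.\<close>
    case True
    then show ?thesis
      by (simp add: regular_dist_def psi_t_kernel_def avg_def propagator_kernel'_def)
  next
    case False
    show ?thesis
      unfolding regular_dist_def
    proof (rule LINT_kernel_eq_avg[OF _ continuous_on_kernels(2) \<phi>])
      show "c * t \<noteq> 0" using c False by simp
      show "psi_t_kernel k c t (c * t * s) = 0" if "s \<notin> {-1..1}" for s
        using mem[OF False, of s] that by (simp add: psi_t_kernel_def indicator_def)
      show "\<bar>c * t\<bar> * psi_t_kernel k c t (c * t * s) = propagator_kernel' k t s" if s: "s \<in> {-1..1}" for s
      proof -
        have "psi_t_kernel k c t (c * t * s) =
            k / (4 * c) * c * \<bar>t\<bar> * (k / (4 * c) * bessel_entire' ((k / (4 * c) * sqrt (c\<^sup>2 * t\<^sup>2 * (1 - s\<^sup>2)))\<^sup>2))"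
          using mem[OF False, of s] s by (simp add: psi_t_kernel_def Let_def rad bessel_quot_eq)
        also have "(k / (4 * c) * sqrt (c\<^sup>2 * t\<^sup>2 * (1 - s\<^sup>2)))\<^sup>2 = k\<^sup>2 / 16 * t\<^sup>2 * (1 - s\<^sup>2)"
          unfolding power_mult_distrib[of _ "sqrt _"] real_sqrt_pow2[OF nn[OF s]]
          using c by (simp add: power_divide power_mult_distrib)
        finally have "\<bar>c * t\<bar> * psi_t_kernel k c t (c * t * s) =
            (c * (k / (4 * c)))\<^sup>2 * \<bar>t\<bar>\<^sup>2 * bessel_entire' (k\<^sup>2 / 16 * t\<^sup>2 * (1 - s\<^sup>2))"
          using c by (simp only: abs_mult power2_eq_square abs_of_pos mult_ac)
        then show ?thesis using c by (simp add: propagator_kernel'_def power_divide)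
      qed
    qed
  qed
  then show "dist_conv (psi_t k c t) \<phi> = propagator' k c t \<phi>"
    by (simp add: fun_eq_iff dist_conv_def psi_t_def dirac_def propagator'_def)
qed

section \<open>Existence and uniqueness\<close>

lemma nderiv_2: "nderiv 2 \<phi> = partial 1 (partial 1 \<phi>)"
  by (simp add: nderiv_Suc numeral_2_eq_2)

lemma distribution_lincombR:
  assumes "distribution (f :: (real \<Rightarrow> 'a::{real_normed_field, euclidean_space}) \<Rightarrow> 'a)" "distribution g"
  shows "distribution (\<lambda>\<phi>. a *\<^sub>R f \<phi> + b *\<^sub>R g \<phi>)"
proof -
  have "(\<lambda>n. a *\<^sub>R f (\<Phi> n) + b *\<^sub>R g (\<Phi> n)) \<longlonglongrightarrow> a *\<^sub>R f \<phi> + b *\<^sub>R g \<phi>"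
    if "test_converges \<Phi> \<phi>" for \<Phi> and \<phi> :: "real \<Rightarrow> 'a"
    by (rule tendsto_add[OF tendsto_scaleR[OF tendsto_const distribution_tendsto[OF assms(1) that]]
          tendsto_scaleR[OF tendsto_const distribution_tendsto[OF assms(2) that]]])
  then show ?thesis
    unfolding distribution_def
    by (simp add: distribution_lincomb[OF assms(1)] distribution_lincomb[OF assms(2)] algebra_simps)
qed

text \<open>Functionals are prescribed on test functions only and may be arbitrary elsewhere, so the
  given \<open>u\<close> need not equal \<open>cauchy_solution\<close> in HOL. Properties have to be
  transferred along equality on test functions.\<close>

lemma distribution_cong:
  assumes "\<And>\<phi>. test_function \<phi> \<Longrightarrow> S \<phi> = T \<phi>" and T: "distribution (T :: (real \<Rightarrow> 'a::{real_normed_field, euclidean_space}) \<Rightarrow> 'a)"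
  shows "distribution S"
  unfolding distribution_def
proof (intro conjI allI impI)
  fix \<phi> \<eta> :: "real \<Rightarrow> 'a" and a b assume "test_function \<phi>" "test_function \<eta>"
  then show "S (\<lambda>x. a * \<phi> x + b * \<eta> x) = a * S \<phi> + b * S \<eta>"
    by (simp add: assms(1) test_function_lincomb distribution_lincomb[OF T])
next
  fix \<Phi> and \<phi> :: "real \<Rightarrow> 'a" assume "test_converges \<Phi> \<phi>"
  then show "(\<lambda>n. S (\<Phi> n)) \<longlonglongrightarrow> S \<phi>"
    using distribution_tendsto[OF T, of \<Phi> \<phi>] by (simp add: assms(1) test_converges_def)
qed

lemma C1_dist_cong:
  assumes uv: "C1_dist U V"
    and u: "\<And>t \<phi>. test_function \<phi> \<Longrightarrow> u t \<phi> = U t \<phi>" and v: "\<And>t \<phi>. test_function \<phi> \<Longrightarrow> v t \<phi> = V t \<phi>"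
  shows "C1_dist u v"
  using uv distribution_cong[of "u _" "U _"] distribution_cong[of "v _" "V _"]
  unfolding C1_dist_iff by (simp add: u v)

definition cauchy_solution ::
    "real \<Rightarrow> real \<Rightarrow> ((real \<Rightarrow> 'a::{real_normed_field, euclidean_space}) \<Rightarrow> 'a) \<Rightarrow> ((real \<Rightarrow> 'a) \<Rightarrow> 'a) \<Rightarrow>
     real \<Rightarrow> (real \<Rightarrow> 'a) \<Rightarrow> 'a" where
  "cauchy_solution k c f g t \<phi> = exp (- (k / 2) * t) *\<^sub>R
     (f (propagator' k c t \<phi>) + (k / 2) *\<^sub>R f (propagator k c t \<phi>) + g (propagator k c t \<phi>))"

text \<open>The time derivative of \<open>cauchy_solution\<close>: the terms (k^2/4) f(psi * \<phi>)
  and (k/2) f(psi_t * \<phi>) cancel against the derivative of the exponential, so \<open>f\<close>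
  keeps only the term with \<phi>''.\<close>

definition cauchy_velocity ::
    "real \<Rightarrow> real \<Rightarrow> ((real \<Rightarrow> 'a::{real_normed_field, euclidean_space}) \<Rightarrow> 'a) \<Rightarrow> ((real \<Rightarrow> 'a) \<Rightarrow> 'a) \<Rightarrow>
     real \<Rightarrow> (real \<Rightarrow> 'a) \<Rightarrow> 'a" where
  "cauchy_velocity k c f g t \<phi> = exp (- (k / 2) * t) *\<^sub>R
     (c\<^sup>2 *\<^sub>R f (propagator k c t (nderiv 2 \<phi>)) + g (propagator' k c t \<phi>) - (k / 2) *\<^sub>R g (propagator k c t \<phi>))"

lemma has_vector_derivative_exp_scaleR:
  fixes F :: "real \<Rightarrow> 'a::real_normed_vector"
  assumes "(F has_vector_derivative F') (at t)"
  shows "((\<lambda>t. exp (a * t) *\<^sub>R F t) has_vector_derivative exp (a * t) *\<^sub>R (F' + a *\<^sub>R F t)) (at t)"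
proof -
  have "((\<lambda>t. exp (a * t)) has_real_derivative exp (a * t) * a) (at t)"
    by (auto intro!: derivative_eq_intros)
  from has_vector_derivative_scaleR[OF this assms] show ?thesis by (simp add: scaleR_add_right)
qed

text \<open>Each differentiation of the exponential contributes -k/2 times the bracket; together
  with the k^2/4 in the second time derivative of the propagator this adds up to the damping term -k
  u_t.\<close>

lemma classical_cauchy_solution:
  fixes f g :: "(real \<Rightarrow> 'a::{real_normed_field, euclidean_space}) \<Rightarrow> 'a"
  assumes f: "distribution f" and g: "distribution g"
  shows "classical_damped_wave k c (cauchy_solution k c f g) (cauchy_velocity k c f g)"
proof -
  let ?U = "cauchy_solution k c f g" and ?V = "cauchy_velocity k c f g"
  let ?W = "\<lambda>t \<phi>. c\<^sup>2 *\<^sub>R ?U t (partial 1 (partial 1 \<phi>)) - k *\<^sub>R ?V t \<phi>"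
  have p: "((\<lambda>t. h (propagator k c t \<phi>)) has_vector_derivative h (propagator' k c t \<phi>)) (at t)"
    if "distribution h" "test_function \<phi>" for h :: "(real \<Rightarrow> 'a) \<Rightarrow> 'a" and \<phi> t
    using distribution_has_vector_derivative[OF that(1) propagator_has_tderiv(1)[OF that(2)]] .
  have p': "((\<lambda>t. h (propagator' k c t \<phi>)) has_vector_derivative
      c\<^sup>2 *\<^sub>R h (propagator k c t (nderiv 2 \<phi>)) + (k\<^sup>2 / 4) *\<^sub>R h (propagator k c t \<phi>)) (at t)"
    if h: "distribution h" and \<phi>: "test_function \<phi>" for h :: "(real \<Rightarrow> 'a) \<Rightarrow> 'a" and \<phi> t
  proof -
    have "test_function (propagator k c t (nderiv 2 \<phi>))" "test_function (propagator k c t \<phi>)"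
      by (intro test_function_propagator test_function_nderiv \<phi>)+
    then show ?thesis
      using distribution_has_vector_derivative[OF h propagator_has_tderiv(2)[OF \<phi>, of k c], of t]
      by (simp add: distribution_add[OF h] distribution_scaleR[OF h] test_function_scaleR)
  qed
  note scale = bounded_linear.has_vector_derivative[OF bounded_linear_scaleR_right]
  have U: "((\<lambda>t. ?U t \<phi>) has_vector_derivative ?V t \<phi>) (at t)" if \<phi>: "test_function \<phi>" for \<phi> t
  proof -
    have "((\<lambda>t. ?U t \<phi>) has_vector_derivative exp (- (k / 2) * t) *\<^sub>R
       ((c\<^sup>2 *\<^sub>R f (propagator k c t (nderiv 2 \<phi>)) + (k\<^sup>2 / 4) *\<^sub>R f (propagator k c t \<phi>)
          + (k / 2) *\<^sub>R f (propagator' k c t \<phi>) + g (propagator' k c t \<phi>))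
        + (- (k / 2)) *\<^sub>R (f (propagator' k c t \<phi>) + (k / 2) *\<^sub>R f (propagator k c t \<phi>) + g (propagator k c t \<phi>)))) (at t)"
      unfolding cauchy_solution_def
      by (intro has_vector_derivative_exp_scaleR has_vector_derivative_add scale p p' f g \<phi>)
    then show ?thesis by (simp add: cauchy_velocity_def algebra_simps power2_eq_square)
  qed
  have V: "((\<lambda>t. ?V t \<phi>) has_vector_derivative ?W t \<phi>) (at t)" if \<phi>: "test_function \<phi>" for \<phi> t
  proof -
    have "((\<lambda>t. ?V t \<phi>) has_vector_derivative exp (- (k / 2) * t) *\<^sub>R
       ((c\<^sup>2 *\<^sub>R f (propagator' k c t (nderiv 2 \<phi>))
          + (c\<^sup>2 *\<^sub>R g (propagator k c t (nderiv 2 \<phi>)) + (k\<^sup>2 / 4) *\<^sub>R g (propagator k c t \<phi>))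
          - (k / 2) *\<^sub>R g (propagator' k c t \<phi>))
        + (- (k / 2)) *\<^sub>R (c\<^sup>2 *\<^sub>R f (propagator k c t (nderiv 2 \<phi>)) + g (propagator' k c t \<phi>)
            - (k / 2) *\<^sub>R g (propagator k c t \<phi>)))) (at t)"
      unfolding cauchy_velocity_def
      by (intro has_vector_derivative_exp_scaleR has_vector_derivative_add has_vector_derivative_diff scale p p' f g
          \<phi> test_function_nderiv)
    moreover have "exp (- (k / 2) * t) *\<^sub>R
       ((c\<^sup>2 *\<^sub>R f (propagator' k c t (nderiv 2 \<phi>))
          + (c\<^sup>2 *\<^sub>R g (propagator k c t (nderiv 2 \<phi>)) + (k\<^sup>2 / 4) *\<^sub>R g (propagator k c t \<phi>))
          - (k / 2) *\<^sub>R g (propagator' k c t \<phi>))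
        + (- (k / 2)) *\<^sub>R (c\<^sup>2 *\<^sub>R f (propagator k c t (nderiv 2 \<phi>)) + g (propagator' k c t \<phi>)
            - (k / 2) *\<^sub>R g (propagator k c t \<phi>))) =
      c\<^sup>2 *\<^sub>R ?U t (nderiv 2 \<phi>) - k *\<^sub>R ?V t \<phi>" (is "exp ?e *\<^sub>R ?l = _")
    proof -
      let ?u = "f (propagator' k c t (nderiv 2 \<phi>)) + (k / 2) *\<^sub>R f (propagator k c t (nderiv 2 \<phi>))
        + g (propagator k c t (nderiv 2 \<phi>))"
      let ?v = "c\<^sup>2 *\<^sub>R f (propagator k c t (nderiv 2 \<phi>)) + g (propagator' k c t \<phi>) - (k / 2) *\<^sub>R g (propagator k c t \<phi>)"
      \<comment> \<open>Splitting \<open>k\<close> in halves makes the coefficients comparable with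
        those that the exponential produces.\<close>
      have half: "k *\<^sub>R x = (k / 2) *\<^sub>R x + (k / 2) *\<^sub>R x" for x :: 'a by (simp flip: scaleR_add_left)
      have "?l = c\<^sup>2 *\<^sub>R ?u - k *\<^sub>R ?v"
        unfolding half by (simp add: algebra_simps power2_eq_square)
      then have "exp ?e *\<^sub>R ?l = c\<^sup>2 *\<^sub>R (exp ?e *\<^sub>R ?u) - k *\<^sub>R (exp ?e *\<^sub>R ?v)"
        by (simp only: scaleR_diff_right scaleR_left_commute[of "exp ?e"])
      then show ?thesis by (simp only: cauchy_solution_def cauchy_velocity_def)
    qed
    ultimately show ?thesis by (simp only: nderiv_2)
  qed
  have dU: "distribution (?U t)" for t
  proof (rule distribution_cong)
    \<comment> \<open>Coefficients 1 and 0 are inserted to fit the two-term pattern of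
      \<open>distribution_lincombR\<close>.\<close>
    show "distribution (\<lambda>\<phi>. exp (- (k / 2) * t) *\<^sub>R (1 *\<^sub>R (1 *\<^sub>R f (propagator' k c t \<phi>) + (k / 2) *\<^sub>R f (propagator k c t \<phi>))
        + 1 *\<^sub>R g (propagator k c t \<phi>)) + 0 *\<^sub>R f \<phi>)"
      by (intro distribution_lincombR distribution_propagator distribution_propagator' f g)
  qed (simp add: cauchy_solution_def)
  have dV: "distribution (?V t)" for t
  proof (rule distribution_cong)
    show "distribution (\<lambda>\<phi>. exp (- (k / 2) * t) *\<^sub>R (1 *\<^sub>R (c\<^sup>2 *\<^sub>R f (propagator k c t (partial 1 (partial 1 \<phi>)))
        - (k / 2) *\<^sub>R g (propagator k c t \<phi>)) + 1 *\<^sub>R g (propagator' k c t \<phi>)) + 0 *\<^sub>R f \<phi>)"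
      by (intro distribution_lincombR distribution_wave_rhs[where f = "\<lambda>\<phi>. f (propagator k c t \<phi>)"]
          distribution_propagator distribution_propagator' f g)
  qed (simp add: cauchy_velocity_def nderiv_2)
  have cont: "isCont (\<lambda>t. ?V t \<phi>) t" "isCont (\<lambda>t. ?W t \<phi>) t" if \<phi>: "test_function \<phi>" for \<phi> t
  proof -
    show V': "isCont (\<lambda>t. ?V t \<phi>) t" by (rule has_vector_derivative_continuous[OF V[OF \<phi>]])
    have "isCont (\<lambda>t. ?U t (partial 1 (partial 1 \<phi>))) t"
      by (intro has_vector_derivative_continuous[OF U] test_function_partial_real \<phi>)
    with V' show "isCont (\<lambda>t. ?W t \<phi>) t" by (intro continuous_intros)
  qed
  show ?thesis
    unfolding classical_damped_wave_def C1_dist_iff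
    using U V dU dV cont distribution_wave_rhs[OF dU dV] by blast
qed

text \<open>
  The bracket in \<open>m\<close> pairs \<open>v\<close> and its time derivative with the solution of the adjoint problem that
  equals \<open>0\<close> with velocity \<open>\<phi>\<close> (up to sign) at time \<open>T\<close>; it is conserved up to the damping factor.
\<close>

lemma classical_damped_wave_unique:
  fixes f g :: "(real \<Rightarrow> 'a::{real_normed_field, euclidean_space}) \<Rightarrow> 'a"
  assumes sol: "classical_damped_wave k c v v'" and f: "dist_eq (v 0) f" and g: "dist_eq (v' 0) g"
    and \<phi>: "test_function \<phi>"
  shows "v T \<phi> = cauchy_solution k c f g T \<phi>"
proof -
  have uv: "C1_dist v v'" and v': "C1_dist v' (\<lambda>t \<phi>. c\<^sup>2 *\<^sub>R v t (partial 1 (partial 1 \<phi>)) - k *\<^sub>R v' t \<phi>)"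
    using sol by (simp_all add: classical_damped_wave_def)
  note du = C1_dist_distribution[OF uv] and dv = C1_dist_distribution[OF v']
  let ?P = "\<lambda>t. propagator k c (T - t) \<phi>" and ?P' = "\<lambda>t. propagator' k c (T - t) \<phi>"
    and ?P2 = "\<lambda>t. propagator k c (T - t) (nderiv 2 \<phi>)"
  have tf: "test_function (?P t)" "test_function (?P' t)" "test_function (?P2 t)" for t
    by (intro test_function_propagator test_function_propagator' test_function_nderiv \<phi>)+
  note \<eta> = has_tderiv_reverse[OF propagator_has_tderiv(1)[OF \<phi>, of k c], of T]
    has_tderiv_reverse[OF propagator_has_tderiv(2)[OF \<phi>, of k c], of T]
  have neg: "D (\<lambda>x. - h x) = - D h" if "distribution D" "test_function h" for D and h :: "real \<Rightarrow> 'a"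
    using distribution_mult[OF that, of "-1"] by simp
  have P2: "partial 1 (partial 1 (?P t)) = ?P2 t" for t
    unfolding nderiv_2[symmetric] by (rule nderiv_propagator[OF \<phi>])
  have 1: "((\<lambda>t. v' t (?P t)) has_vector_derivative c\<^sup>2 *\<^sub>R v t (?P2 t) - k *\<^sub>R v' t (?P t) - v' t (?P' t)) (at t)" for t
    using pairing_has_vector_derivative[OF v' \<eta>(1), of t] by (simp add: P2 neg[OF dv tf(2)])
  have 2: "((\<lambda>t. v t (?P' t)) has_vector_derivative
      v' t (?P' t) - (c\<^sup>2 *\<^sub>R v t (?P2 t) + (k\<^sup>2 / 4) *\<^sub>R v t (?P t))) (at t)" for t
  proof -
    have "v t (\<lambda>x. - (c\<^sup>2 *\<^sub>R ?P2 t x + (k\<^sup>2 / 4) *\<^sub>R ?P t x)) = - (c\<^sup>2 *\<^sub>R v t (?P2 t) + (k\<^sup>2 / 4) *\<^sub>R v t (?P t))"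
      by (subst neg[OF du]) (simp_all add: distribution_add[OF du] distribution_scaleR[OF du]
          test_function_add test_function_scaleR tf)
    from pairing_has_vector_derivative[OF uv \<eta>(2), of t, unfolded this add_uminus_conv_diff] show ?thesis .
  qed
  have 3: "((\<lambda>t. v t (?P t)) has_vector_derivative v' t (?P t) - v t (?P' t)) (at t)" for t
    using pairing_has_vector_derivative[OF uv \<eta>(1), of t] by (simp add: neg[OF du tf(2)])
  \<comment> \<open>At \<open>t = T\<close> the propagator is 0 and its derivative the identity, so
    only \<open>v T \<phi>\<close> remains, up to the exponential; at \<open>t = 0\<close> only the
    data enter. The factor exp(kt/2) and the term with k/2 compensate the damping.\<close>
  define m where "m t = exp (k / 2 * t) *\<^sub>R (v' t (?P t) + v t (?P' t) + (k / 2) *\<^sub>R v t (?P t))" for t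
  have m: "(m has_vector_derivative 0) (at t)" for t
  proof -
    note scale = bounded_linear.has_vector_derivative[OF bounded_linear_scaleR_right]
    have half: "k *\<^sub>R x = (k / 2) *\<^sub>R x + (k / 2) *\<^sub>R x" for x :: 'a by (simp flip: scaleR_add_left)
    have z: "(c\<^sup>2 *\<^sub>R v t (?P2 t) - k *\<^sub>R v' t (?P t) - v' t (?P' t)
          + (v' t (?P' t) - (c\<^sup>2 *\<^sub>R v t (?P2 t) + (k\<^sup>2 / 4) *\<^sub>R v t (?P t)))
          + (k / 2) *\<^sub>R (v' t (?P t) - v t (?P' t)))
        + (k / 2) *\<^sub>R (v' t (?P t) + v t (?P' t) + (k / 2) *\<^sub>R v t (?P t)) = 0"
      unfolding half by (simp add: algebra_simps power2_eq_square)
    have "(m has_vector_derivative exp (k / 2 * t) *\<^sub>R 0) (at t)"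
      unfolding m_def[abs_def] z[symmetric]
      by (intro has_vector_derivative_exp_scaleR has_vector_derivative_add scale 1 2 3)
    then show ?thesis by simp
  qed
  \<comment> \<open>A bound 0 on the derivative gives the Lipschitz constant 0.\<close>
  have "norm (m T - m 0) \<le> 0 * \<bar>T - 0\<bar>"
    by (rule has_vector_derivative_lipschitz[of "\<bar>T\<bar>" m "\<lambda>_. 0"]) (use m in auto)
  then have "m T = m 0" by simp
  moreover have "m T = exp (k / 2 * T) *\<^sub>R v T \<phi>"
    by (simp add: m_def propagator_0 propagator'_0 distribution_zero[OF du] distribution_zero[OF dv])
  moreover have "m 0 = g (?P 0) + f (?P' 0) + (k / 2) *\<^sub>R f (?P 0)"
    using f g tf[of 0] by (simp add: m_def dist_eq_def)
  ultimately have "exp (- (k / 2) * T) *\<^sub>R (exp (k / 2 * T) *\<^sub>R v T \<phi>) =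
      exp (- (k / 2) * T) *\<^sub>R (g (?P 0) + f (?P' 0) + (k / 2) *\<^sub>R f (?P 0))" by simp
  then show ?thesis by (simp add: cauchy_solution_def add_ac flip: exp_add)
qed

theorem mainTheorem4:
  fixes k c :: real
    and f g :: "(real \<Rightarrow> 'a::{real_normed_field, euclidean_space}) \<Rightarrow> 'a"
    and u :: "real \<Rightarrow> (real \<Rightarrow> 'a) \<Rightarrow> 'a"
  assumes "k > 0" and "c > 0"
    and "distribution f" and "distribution g"
    and u: "\<And>t \<phi>. test_function \<phi> \<Longrightarrow>
      u t \<phi> = exp (- (k / 2) * t) *\<^sub>R
        (f (dist_conv (\<lambda>\<eta>. psi_t k c t \<eta> + (k / 2) *\<^sub>R psi k c t \<eta>) \<phi>)
         + g (dist_conv (psi k c t) \<phi>))"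
  shows "(\<forall>t \<phi>. test_function \<phi> \<longrightarrow>
            u t \<phi> = exp (- (k / 2) * t) *\<^sub>R
              (f (dist_conv (psi_t k c t) \<phi>)
               + (\<lambda>\<eta>. (k / 2) *\<^sub>R f \<eta> + g \<eta>) (dist_conv (psi k c t) \<phi>)))
         \<and> solves_damped_wave k c f g u
         \<and> (\<forall>v. solves_damped_wave k c f g v \<longrightarrow> (\<forall>t. dist_eq (v t) (u t)))"
proof -
  note f = \<open>distribution f\<close> and g = \<open>distribution g\<close>
  let ?U = "cauchy_solution k c f g" and ?V = "cauchy_velocity k c f g"
  note conv = psi_convolution[OF \<open>c > 0\<close>] psi_t_convolution[OF \<open>c > 0\<close>]
  have uU: "u t \<phi> = ?U t \<phi>" if \<phi>: "test_function \<phi>" for t \<phi>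
  proof -
    \<comment> \<open>Functionals may be added before or after convolving, by definition; linearity
      on test functions is needed only for the application of \<open>f\<close>.\<close>
    have "dist_conv (\<lambda>\<eta>. psi_t k c t \<eta> + (k / 2) *\<^sub>R psi k c t \<eta>) \<phi> =
        (\<lambda>x. dist_conv (psi_t k c t) \<phi> x + (k / 2) *\<^sub>R dist_conv (psi k c t) \<phi> x)"
      by (simp add: dist_conv_def)
    then show ?thesis
      by (simp add: u[OF \<phi>] conv[OF \<phi>] cauchy_solution_def distribution_add[OF f] distribution_scaleR[OF f]
          test_function_propagator[OF \<phi>] test_function_propagator'[OF \<phi>] test_function_scaleR)
  qed
  have cl: "classical_damped_wave k c ?U ?V" by (rule classical_cauchy_solution[OF f g])
  then have UV: "C1_dist ?U ?V" by (simp add: classical_damped_wave_def)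
  have "classical_damped_wave k c u ?V"
    unfolding classical_damped_wave_def
  proof
    show "C1_dist u ?V" by (rule C1_dist_cong[OF UV uU refl])
    \<comment> \<open>The right-hand side evaluates \<open>u\<close> at \<phi>_xx, again a test
      function, so \<open>u\<close> may replace \<open>cauchy_solution\<close> there.\<close>
    show "C1_dist ?V (\<lambda>t \<phi>. c\<^sup>2 *\<^sub>R u t (partial 1 (partial 1 \<phi>)) - k *\<^sub>R ?V t \<phi>)"
      by (rule C1_dist_cong[OF cl[unfolded classical_damped_wave_def, THEN conjunct2] refl])
         (simp add: uU test_function_partial_real)
  qed
  then have "weak_damped_wave k c u" by (rule classical_imp_weak_damped_wave)
  moreover have "C1_dist u ?V" by (rule C1_dist_cong[OF UV uU refl])
  moreover have "dist_eq (u 0) f"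
    by (simp add: dist_eq_def uU cauchy_solution_def propagator_0 propagator'_0 distribution_zero[OF f] distribution_zero[OF g])
  moreover have "dist_eq (?V 0) g"
    by (simp add: dist_eq_def cauchy_velocity_def propagator_0 propagator'_0 distribution_zero[OF f] distribution_zero[OF g])
  ultimately have "solves_damped_wave k c f g u" unfolding solves_damped_wave_def by blast
  moreover have "dist_eq (v t) (u t)" if "solves_damped_wave k c f g v" for v t
  proof -
    obtain v' where v': "C1_dist v v'" "weak_damped_wave k c v" "dist_eq (v 0) f" "dist_eq (v' 0) g"
      using \<open>solves_damped_wave k c f g v\<close> unfolding solves_damped_wave_def by blast
    have "classical_damped_wave k c v v'" by (rule weak_imp_classical_damped_wave[OF v'(1,2)])
    from classical_damped_wave_unique[OF this v'(3,4)] show ?thesis by (simp add: dist_eq_def uU)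
  qed
  ultimately show ?thesis
    by (simp add: uU conv cauchy_solution_def add.assoc)
qed

end
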